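(* Let $\eta_0\in H^2(\mathbb{T}^2)$ be real-valued with zero mean. Then for every $0<T<\infty$ the initial value problem $$\eta_t+\eta\eta_x+(\beta-1)\eta_{xx}-\eta_{yy}-\delta\Lambda^3\eta+\epsilon\Delta^2\eta=0,\quad (x,y)\in\mathbb{T}^2,\ t>0,\qquad \eta(x,y,0)=\eta_0(x,y),$$ has a unique solution $$\eta\in C([0,T];H^2(\mathbb{T}^2))\cap L^2(0,T;H^4(\mathbb{T}^2)).$$
   Context: $\mathbb{T}^2=[0,2\pi]^2$ with periodic boundary conditions; functions are real-valued. Fourier coefficients are $\widehat{\eta}(\xi)=(2\pi)^{-2}\int_{\mathbb{T}^2}e^{-i\xi_1x-i\xi_2y}\eta(x,y)\,dx\,dy$, $\xi=(\xi_1,\xi_2)\in\mathbb{Z}^2$. The nonlocal operator $\Lambda$ is defined by $\widehat{\Lambda u}(\xi)=|\xi|\widehat{u}(\xi)$ with $|\xi|=(\xi_1^2+\xi_2^2)^{1/2}$. The parameters are $\beta>0$, $\delta=\gamma\lambda$ and $\epsilon=\lambda^2$, where $0\le\gamma\le 2$ and $\lambda=2\pi/L$ with $L>0$. A function in the stated class has $\eta_t\in L^2(0,T;L^2(\mathbb{T}^2))$ when it solves the equation, and the equation is understood in $L^2(0,T;L^2(\mathbb{T}^2))$. *)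

theory Defs
  imports "HOL-Analysis.Analysis"
begin

text \<open>
  A function on the torus is a map on pairs of reals of which only the restriction to the
  period cell matters.  Elements of the Lebesgue and Sobolev spaces are represented by functions,
  so that equality in these spaces is equality almost everywhere with respect to \<open>torus\<close>.
\<close>

type_synonym tfun = "real \<times> real \<Rightarrow> real"

definition torus :: "(real \<times> real) measure" where
  "torus = lebesgue_on ({0..2 * pi} \<times> {0..2 * pi})"

definition L2_space :: "tfun set" where
  "L2_space = {u. u \<in> borel_measurable torus \<and> integrable torus (\<lambda>p. (u p)\<^sup>2)}"

definition L2_norm :: "tfun \<Rightarrow> real" where
  "L2_norm u = sqrt (\<integral>p. (u p)\<^sup>2 \<partial>torus)"

definition L2_inner :: "tfun \<Rightarrow> tfun \<Rightarrow> real" where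
  "L2_inner u v = (\<integral>p. u p * v p \<partial>torus)"

definition fourier_coeff :: "tfun \<Rightarrow> int \<times> int \<Rightarrow> complex" where
  "fourier_coeff u \<xi> =
     (\<integral>p. exp (- \<i> * of_int (fst \<xi>) * of_real (fst p) - \<i> * of_int (snd \<xi>) * of_real (snd p))
           * of_real (u p) \<partial>torus) / of_real ((2 * pi)\<^sup>2)"

definition freq_norm :: "int \<times> int \<Rightarrow> real" where
  "freq_norm \<xi> = sqrt ((of_int (fst \<xi>))\<^sup>2 + (of_int (snd \<xi>))\<^sup>2)"

definition sobolev :: "nat \<Rightarrow> tfun set" where
  "sobolev s = {u \<in> L2_space.
     (\<lambda>\<xi>. (1 + (freq_norm \<xi>)\<^sup>2) ^ s * (cmod (fourier_coeff u \<xi>))\<^sup>2) summable_on UNIV}"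

definition sobolev_norm :: "nat \<Rightarrow> tfun \<Rightarrow> real" where
  "sobolev_norm s u =
     sqrt (\<Sum>\<^sub>\<infinity>\<xi>. (1 + (freq_norm \<xi>)\<^sup>2) ^ s * (cmod (fourier_coeff u \<xi>))\<^sup>2)"

text \<open>
  The square-integrable function with Fourier coefficients \<open>m \<xi> * fourier_coeff u \<xi>\<close>.  It is
  unique up to null sets when it exists, and unspecified otherwise; the operators below are only
  used on functions that are regular enough for it to exist.  Since the trigonometric polynomials
  are dense in the smooth functions on the torus, the symbols \<open>\<i> \<xi>\<^sub>1\<close> and \<open>\<i> \<xi>\<^sub>2\<close> give the
  distributional partial derivatives of periodic functions.
\<close>

definition fourier_multiplier :: "(int \<times> int \<Rightarrow> complex) \<Rightarrow> tfun \<Rightarrow> tfun" where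
  "fourier_multiplier m u =
     (SOME v. v \<in> L2_space \<and> (\<forall>\<xi>. fourier_coeff v \<xi> = m \<xi> * fourier_coeff u \<xi>))"

definition dx :: "tfun \<Rightarrow> tfun" where
  "dx = fourier_multiplier (\<lambda>\<xi>. \<i> * of_int (fst \<xi>))"

definition dy :: "tfun \<Rightarrow> tfun" where
  "dy = fourier_multiplier (\<lambda>\<xi>. \<i> * of_int (snd \<xi>))"

definition laplacian :: "tfun \<Rightarrow> tfun" where
  "laplacian u = (\<lambda>p. dx (dx u) p + dy (dy u) p)"

definition Lam :: "tfun \<Rightarrow> tfun" where
  "Lam = fourier_multiplier (\<lambda>\<xi>. of_real (freq_norm \<xi>))"

text \<open>
  In the following definitions \<open>X\<close> is a space of functions on the torus and \<open>N\<close> its norm.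
\<close>

definition cont_space :: "real \<Rightarrow> tfun set \<Rightarrow> (tfun \<Rightarrow> real) \<Rightarrow> (real \<Rightarrow> tfun) set" where
  "cont_space T X N = {u. (\<forall>t\<in>{0..T}. u t \<in> X) \<and>
     (\<forall>t\<in>{0..T}. ((\<lambda>s. N (\<lambda>p. u s p - u t p)) \<longlongrightarrow> 0) (at t within {0..T}))}"

definition strongly_measurable :: "real \<Rightarrow> tfun set \<Rightarrow> (tfun \<Rightarrow> real) \<Rightarrow> (real \<Rightarrow> tfun) \<Rightarrow> bool" where
  "strongly_measurable T X N u \<longleftrightarrow>
     (\<exists>S :: nat \<Rightarrow> real \<Rightarrow> tfun.
        (\<forall>n. simple_function (lebesgue_on {0<..<T}) (S n) \<and> (\<forall>t\<in>{0<..<T}. S n t \<in> X)) \<and>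
        (AE t in lebesgue_on {0<..<T}. (\<lambda>n. N (\<lambda>p. S n t p - u t p)) \<longlonglongrightarrow> 0))"

definition bochner_L2 :: "real \<Rightarrow> tfun set \<Rightarrow> (tfun \<Rightarrow> real) \<Rightarrow> (real \<Rightarrow> tfun) set" where
  "bochner_L2 T X N = {u. (AE t in lebesgue_on {0<..<T}. u t \<in> X) \<and>
     strongly_measurable T X N u \<and>
     integrable (lebesgue_on {0<..<T}) (\<lambda>t. (N (u t))\<^sup>2)}"

definition test_function :: "real \<Rightarrow> (real \<Rightarrow> real) \<Rightarrow> bool" where
  "test_function T \<phi> \<longleftrightarrow>
     (\<forall>n. (deriv ^^ n) \<phi> differentiable_on UNIV) \<and> closure {t. \<phi> t \<noteq> 0} \<subseteq> {0<..<T}"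

text \<open>
  The time derivative is taken in the sense of distributions on \<open>(0,T)\<close> with values in \<open>L\<^sup>2\<close>:
  the integrals of \<open>\<phi>' u\<close> and \<open>- \<phi> g\<close> over \<open>(0,T)\<close> agree in \<open>L\<^sup>2\<close>, that is, after pairing
  with every element of \<open>L\<^sup>2\<close>.
\<close>

definition weak_time_derivative :: "real \<Rightarrow> (real \<Rightarrow> tfun) \<Rightarrow> (real \<Rightarrow> tfun) \<Rightarrow> bool" where
  "weak_time_derivative T u g \<longleftrightarrow>
     (\<forall>\<phi> \<psi>. test_function T \<phi> \<longrightarrow> \<psi> \<in> L2_space \<longrightarrow>
        (\<integral>t. deriv \<phi> t * L2_inner (u t) \<psi> \<partial>lebesgue_on {0<..<T}) =
        - (\<integral>t. \<phi> t * L2_inner (g t) \<psi> \<partial>lebesgue_on {0<..<T}))"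

definition solves_ivp ::
    "real \<Rightarrow> real \<Rightarrow> real \<Rightarrow> real \<Rightarrow> tfun \<Rightarrow> (real \<Rightarrow> tfun) \<Rightarrow> bool" where
  "solves_ivp \<beta> \<delta> \<epsilon> T \<eta>\<^sub>0 \<eta> \<longleftrightarrow>
     (\<exists>\<eta>\<^sub>t \<in> bochner_L2 T L2_space L2_norm.
        weak_time_derivative T \<eta> \<eta>\<^sub>t \<and>
        (AE t in lebesgue_on {0<..<T}. AE p in torus.
           \<eta>\<^sub>t t p + \<eta> t p * dx (\<eta> t) p + (\<beta> - 1) * dx (dx (\<eta> t)) p - dy (dy (\<eta> t)) p
             - \<delta> * (Lam ^^ 3) (\<eta> t) p + \<epsilon> * laplacian (laplacian (\<eta> t)) p = 0)) \<and>
     (AE p in torus. \<eta> 0 p = \<eta>\<^sub>0 p)"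

definition solution_class :: "real \<Rightarrow> (real \<Rightarrow> tfun) set" where
  "solution_class T =
     cont_space T (sobolev 2) (sobolev_norm 2) \<inter> bochner_L2 T (sobolev 4) (sobolev_norm 4)"

end

theory Submission
  imports Defs "HOL-Computational_Algebra.Polynomial"
begin

text \<open>
  In Fourier space the equation reads \<open>a' = - \<sigma> a - N(a)\<close> with \<open>N(a)(k) = (i k\<^sub>1 / 2) (a * a)(k)\<close> and
  \<open>\<sigma> + C\<^sub>0 \<ge> c J\<^sup>4\<close>, where \<open>J = (1 + |k|\<^sup>2)\<^sup>1\<^sup>/\<^sup>2\<close>.  By Cauchy-Schwarz \<open>|N(a)(k)| \<le> J \<parallel>a\<parallel>\<^sup>2\<close> in the norm of \<open>\<ell>\<^sup>2\<close>,
  Duhamel's integral gains four powers of \<open>J\<close>, and \<open>J\<^sup>-\<^sup>4\<close> is summable over the lattice.  Hence, once \<open>N\<close>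
  is composed with the radial retraction onto a ball of \<open>\<ell>\<^sup>2\<close>, Duhamel's operator is a contraction for
  \<open>sup\<^sub>t exp (- K t) \<parallel>a(t)\<parallel>\<close> with \<open>K\<close> large, and the truncated equation has a global solution.
  The same estimate with weights \<open>J\<^sup>s\<close>, iterated, keeps the solution in \<open>H\<^sup>2\<close> and puts it into \<open>H\<^sup>4\<close> for
  positive times.  Since \<open>N(a)\<close> is orthogonal to \<open>a\<close>, the energy gives \<open>\<parallel>a(t)\<parallel> \<le> exp (C\<^sub>0 T) \<parallel>a(0)\<parallel>\<close>, so
  that on a large enough ball the truncation was never active.
  Conversely, by the lemma of du Bois-Reymond every Fourier mode of a solution in the class satisfies
  Duhamel's formula, and the contraction estimate yields uniqueness.
\<close>

section \<open>Square-summable families over the frequency lattice\<close>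

text \<open>Of the four powers of \<open>J\<close> gained by Duhamel's integral, one repays the
  derivative in \<open>N\<close>, two make the bound square summable over the two-dimensional
  lattice, and the last is traded for an arbitrarily large constant in the exponential weight, so
  that the contraction works on the whole of [0, T] at once. Both properties are therefore proved
  for the truncated solution. The truncation is radial so that it only multiplies the quadratic term
  by a scalar and keeps its orthogonality. A datum in H^2 yields H^4 at positive times only, with
  bounds singular at zero. In the square of the H^4 norm the datum contributes J^4 exp(-2 c J^4 t)
  per mode, whose time integral is bounded uniformly in the mode, and Duhamel's integral contributes
  t^(-1/2); both are integrable. Since the operators are determined only up to null sets, the
  analysis is done on coefficients and carried back by Riesz-Fischer and the uniqueness of
  coefficients.\<close>

text \<open>The bracket \<open>\<langle>k\<rangle>\<close>; it is written \<open>J\<close> below.\<close>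

definition jb :: "int \<times> int \<Rightarrow> real" where
  "jb k = sqrt (1 + (freq_norm k)\<^sup>2)"

lemma freq_norm_eq_norm: "freq_norm k = norm (of_int (fst k) :: real, of_int (snd k) :: real)"
  by (simp add: freq_norm_def norm_Pair)

lemma freq_norm_nonneg [simp]: "0 \<le> freq_norm k"
  by (simp add: freq_norm_eq_norm)

lemma freq_norm_minus [simp]: "freq_norm (- k) = freq_norm k"
  by (simp add: freq_norm_def)

lemma freq_norm_triangle: "freq_norm (k + l) \<le> freq_norm k + freq_norm l"
  unfolding freq_norm_eq_norm
  using norm_triangle_ineq[of "(of_int (fst k) :: real, of_int (snd k) :: real)"
      "(of_int (fst l), of_int (snd l))"] by simp

lemma jb_ge_1: "1 \<le> jb k"
  by (simp add: jb_def)

lemma jb_pos: "0 < jb k"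
  using jb_ge_1[of k] by linarith

lemma jb_nonneg: "0 \<le> jb k"
  using jb_pos[of k] by linarith

lemma jb_minus [simp]: "jb (- k) = jb k"
  by (simp add: jb_def)

lemma jb_sq: "(jb k)\<^sup>2 = 1 + (freq_norm k)\<^sup>2"
  by (simp add: jb_def)

lemma jb_power_even: "jb k ^ (2 * s) = (1 + (freq_norm k)\<^sup>2) ^ s"
  by (simp add: power_mult jb_sq)

lemma freq_norm_le_jb: "freq_norm k \<le> jb k"
  by (rule power2_le_imp_le) (auto simp: jb_sq jb_nonneg)

lemma fst_le_freq_norm: "\<bar>of_int (fst k) :: real\<bar> \<le> freq_norm k"
  by (simp add: freq_norm_def real_le_rsqrt)

lemma snd_le_freq_norm: "\<bar>of_int (snd k) :: real\<bar> \<le> freq_norm k"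
  by (simp add: freq_norm_def real_le_rsqrt)

lemma fst_le_jb: "\<bar>of_int (fst k) :: real\<bar> \<le> jb k"
  using fst_le_freq_norm[of k] freq_norm_le_jb[of k] by linarith

lemma snd_le_jb: "\<bar>of_int (snd k) :: real\<bar> \<le> jb k"
  using snd_le_freq_norm[of k] freq_norm_le_jb[of k] by linarith

lemma jb_triangle: "jb (k + l) \<le> jb k + jb l"
proof (rule power2_le_imp_le)
  have "(freq_norm (k + l))\<^sup>2 \<le> (freq_norm k + freq_norm l)\<^sup>2"
    by (rule power_mono[OF freq_norm_triangle]) simp
  moreover have "freq_norm k * freq_norm l \<le> jb k * jb l"
    by (intro mult_mono freq_norm_le_jb jb_nonneg freq_norm_nonneg)
  ultimately show "(jb (k + l))\<^sup>2 \<le> (jb k + jb l)\<^sup>2"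
    by (simp add: power2_sum jb_sq)
  show "0 \<le> jb k + jb l" by (simp add: jb_nonneg)
qed

text \<open>The larger of the two brackets carries at least half of \<open>jb k\<close>. This
  distributes a Sobolev weight over the factors of a convolution, with the weight on one factor in
  each term.\<close>

lemma jb_power_split: "jb k ^ s \<le> 2 ^ s * (jb l ^ s + jb (k - l) ^ s)"
proof -
  have "jb k \<le> jb l + jb (k - l)" using jb_triangle[of l "k - l"] by simp
  also have "\<dots> \<le> 2 * max (jb l) (jb (k - l))" by simp
  finally have "jb k ^ s \<le> (2 * max (jb l) (jb (k - l))) ^ s"
    by (intro power_mono jb_nonneg)
  also have "\<dots> = 2 ^ s * max (jb l) (jb (k - l)) ^ s" by (simp add: power_mult_distrib)
  also have "max (jb l) (jb (k - l)) ^ s \<le> jb l ^ s + jb (k - l) ^ s"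
    by (cases "jb l \<le> jb (k - l)") (simp_all add: jb_nonneg max_def)
  finally show ?thesis by simp
qed

section \<open>Summability of negative powers of the bracket\<close>

lemma summable_on_int_inverse_square: "(\<lambda>n::int. 1 / (1 + (of_int n)\<^sup>2 :: real)) summable_on UNIV"
proof -
  have s: "summable (\<lambda>n::nat. 1 / (1 + (real n)\<^sup>2))"
  proof (rule summable_comparison_test_ev[OF _ inverse_power_summable[of 2]])
    show "\<forall>\<^sub>F n in sequentially. norm (1 / (1 + (real n)\<^sup>2)) \<le> inverse ((real n)\<^sup>2)"
      using eventually_gt_at_top[of 0]
    proof eventually_elim
      case (elim n)
      then show ?case by (simp add: divide_simps abs_if)
    qed
  qed simp
  have n: "(\<lambda>n::nat. 1 / (1 + (real n)\<^sup>2)) summable_on UNIV"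
    by (rule summable_nonneg_imp_summable_on[OF s]) simp
  have 1: "(\<lambda>n::int. 1 / (1 + (of_int n)\<^sup>2 :: real)) summable_on (range int)"
    using n by (subst summable_on_reindex) (auto simp: o_def)
  have 2: "(\<lambda>n::int. 1 / (1 + (of_int n)\<^sup>2 :: real)) summable_on (range (\<lambda>n. - int n))"
    using n by (subst summable_on_reindex) (auto simp: o_def inj_on_def)
  have "UNIV = range int \<union> range (\<lambda>n. - int n)"
  proof -
    have "x \<in> range int \<union> range (\<lambda>n. - int n)" for x :: int
    proof (cases "x \<ge> 0")
      case True then have "x = int (nat x)" by simp
      then show ?thesis by blast
    next
      case False then have "x = - int (nat (- x))" by simp
      then show ?thesis by blast
    qed
    then show ?thesis by blast
  qed
  with summable_on_union[OF 1 2] show ?thesis by simp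
qed

text \<open>Since (1 + a) (1 + b) \<le> (1 + a + b)^2 for nonnegative a and b, the series over the
  lattice is dominated by a product of two one-dimensional series.\<close>

lemma summable_on_jb: "(\<lambda>k. 1 / jb k ^ 4) summable_on UNIV"
proof -
  let ?g = "\<lambda>n::int. 1 / (1 + (of_int n)\<^sup>2 :: real)"
  have gpos: "0 \<le> ?g n" for n by simp
  have "(\<lambda>k. norm (?g (fst k) * ?g (snd k))) summable_on (UNIV \<times> UNIV)"
    unfolding Infinite_Sum.abs_summable_on_Sigma_iff
  proof (intro conjI ballI)
    fix x :: int
    show "(\<lambda>y. norm (?g (fst (x, y)) * ?g (snd (x, y)))) summable_on UNIV"
      using summable_on_cmult_right[OF summable_on_int_inverse_square, of "?g x"]
      by (simp only: abs_mult real_norm_def abs_of_nonneg[OF gpos] fst_conv snd_conv)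
    have "(\<lambda>x. ?g x * infsum ?g UNIV) summable_on UNIV"
      by (rule summable_on_cmult_left[OF summable_on_int_inverse_square])
    moreover have "0 \<le> infsum ?g UNIV" by (rule infsum_nonneg) simp
    ultimately show "(\<lambda>x. norm (\<Sum>\<^sub>\<infinity>y\<in>UNIV. norm (?g (fst (x, y)) * ?g (snd (x, y))))) summable_on UNIV"
      by (simp only: real_norm_def abs_of_nonneg[OF gpos] fst_conv snd_conv
          infsum_cmult_right' abs_mult abs_of_nonneg)
  qed
  then have s: "(\<lambda>k. ?g (fst k) * ?g (snd k)) summable_on UNIV"
    by (simp only: abs_mult real_norm_def abs_of_nonneg[OF gpos] UNIV_Times_UNIV)
  show ?thesis
  proof (rule summable_on_comparison_test[OF s])
    fix k :: "int \<times> int"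
    have "jb k ^ 4 = ((jb k)\<^sup>2)\<^sup>2" by simp
    also have "\<dots> = (1 + (of_int (fst k))\<^sup>2 + (of_int (snd k))\<^sup>2)\<^sup>2"
      by (simp add: jb_sq freq_norm_def)
    finally have j: "jb k ^ 4 = (1 + (of_int (fst k))\<^sup>2 + (of_int (snd k))\<^sup>2)\<^sup>2" .
    have aux: "(1 + x) * (1 + y) \<le> (1 + x + y)\<^sup>2" if "0 \<le> x" "0 \<le> y" for x y :: real
    proof -
      have "0 \<le> x * y" "0 \<le> x\<^sup>2" "0 \<le> y\<^sup>2" using that by simp_all
      then show ?thesis using that by (simp add: power2_eq_square algebra_simps)
    qed
    have "(1 + (of_int (fst k))\<^sup>2) * (1 + (of_int (snd k))\<^sup>2) \<le> jb k ^ 4"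
      unfolding j by (rule aux) simp_all
    then show "1 / jb k ^ 4 \<le> ?g (fst k) * ?g (snd k)"
      by (simp add: frac_le add_pos_nonneg)
  qed (simp add: jb_nonneg)
qed

definition jsum :: real where "jsum = (\<Sum>\<^sub>\<infinity>k. 1 / jb k ^ 4)"

lemma jsum_nonneg: "0 \<le> jsum"
  unfolding jsum_def by (rule infsum_nonneg) (simp add: jb_nonneg)

lemma sum_jb_le: "finite F \<Longrightarrow> (\<Sum>k\<in>F. 1 / jb k ^ 4) \<le> jsum"
  unfolding jsum_def by (rule finite_sum_le_infsum[OF summable_on_jb]) (auto simp: jb_nonneg)

text \<open>\<open>l2bd f B\<close> says that the norm of \<open>f\<close> in \<open>\<ell>\<^sup>2\<close> is at most \<open>B\<close>, summability included.\<close>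

definition l2bd :: "('i \<Rightarrow> complex) \<Rightarrow> real \<Rightarrow> bool" where
  "l2bd f B \<longleftrightarrow> 0 \<le> B \<and> (\<forall>F. finite F \<longrightarrow> L2_set (\<lambda>k. cmod (f k)) F \<le> B)"

lemma l2bd_nonneg: "l2bd f B \<Longrightarrow> 0 \<le> B"
  by (simp add: l2bd_def)

lemma l2bd_summable: "l2bd f B \<Longrightarrow> (\<lambda>k. (cmod (f k))\<^sup>2) summable_on UNIV"
proof (rule nonneg_bdd_above_summable_on)
  assume f: "l2bd f B"
  have "(\<Sum>k\<in>F. (cmod (f k))\<^sup>2) \<le> B\<^sup>2" if "finite F" for F
    using f that by (auto simp: l2bd_def L2_set_def intro: real_sqrt_le_iff[THEN iffD1] sqrt_le_D)
  then show "bdd_above (sum (\<lambda>k. (cmod (f k))\<^sup>2) ` {F. F \<subseteq> UNIV \<and> finite F})"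
    by (auto simp: bdd_above_def)
qed simp

lemma l2bd_infsum: "l2bd f B \<Longrightarrow> (\<Sum>\<^sub>\<infinity>k. (cmod (f k))\<^sup>2) \<le> B\<^sup>2"
proof (rule infsum_le_finite_sums)
  assume f: "l2bd f B"
  show "(\<lambda>k. (cmod (f k))\<^sup>2) summable_on UNIV" by (rule l2bd_summable[OF f])
  show "(\<Sum>k\<in>F. (cmod (f k))\<^sup>2) \<le> B\<^sup>2" if "finite F" for F
    using f that by (auto simp: l2bd_def L2_set_def intro: sqrt_le_D)
qed

lemma l2bdI:
  assumes "(\<lambda>k. (cmod (f k))\<^sup>2) summable_on UNIV" "(\<Sum>\<^sub>\<infinity>k. (cmod (f k))\<^sup>2) \<le> B\<^sup>2" "0 \<le> B"
  shows "l2bd f B"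
  unfolding l2bd_def
proof (intro conjI allI impI)
  fix F :: "'a set" assume F: "finite F"
  have "(\<Sum>k\<in>F. (cmod (f k))\<^sup>2) \<le> (\<Sum>\<^sub>\<infinity>k. (cmod (f k))\<^sup>2)"
    by (rule finite_sum_le_infsum[OF assms(1) F]) auto
  with assms show "L2_set (\<lambda>k. cmod (f k)) F \<le> B"
    by (auto simp: L2_set_def intro!: real_le_lsqrt sum_nonneg)
qed fact

lemma l2bd_finite_sums:
  assumes "\<And>F. finite F \<Longrightarrow> (\<Sum>k\<in>F. (cmod (f k))\<^sup>2) \<le> B\<^sup>2" "0 \<le> B"
  shows "l2bd f B"
  using assms by (auto simp: l2bd_def L2_set_def intro!: real_le_lsqrt sum_nonneg)

lemma l2bd_sqrt_infsum:
  "(\<lambda>k. (cmod (f k))\<^sup>2) summable_on UNIV \<Longrightarrow> l2bd f (sqrt (\<Sum>\<^sub>\<infinity>k. (cmod (f k))\<^sup>2))"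
  by (rule l2bdI) (simp_all add: infsum_nonneg)

lemma l2bd_mono:
  assumes "l2bd g A" "\<And>k. cmod (f k) \<le> cmod (g k)" "A \<le> B"
  shows "l2bd f B"
  unfolding l2bd_def
proof (intro conjI allI impI)
  show "0 \<le> B" using assms l2bd_nonneg by fastforce
  fix F :: "'a set" assume F: "finite F"
  have "L2_set (\<lambda>k. cmod (f k)) F \<le> L2_set (\<lambda>k. cmod (g k)) F"
    by (rule L2_set_mono) (use assms in auto)
  also have "\<dots> \<le> A" using assms F by (auto simp: l2bd_def)
  finally show "L2_set (\<lambda>k. cmod (f k)) F \<le> B" using assms by simp
qed

lemma l2bd_add: "l2bd f A \<Longrightarrow> l2bd g B \<Longrightarrow> l2bd (\<lambda>k. f k + g k) (A + B)"
  unfolding l2bd_def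
proof (intro conjI allI impI)
  fix F :: "'a set"
  assume F: "finite F" and *: "0 \<le> A \<and> (\<forall>F. finite F \<longrightarrow> L2_set (\<lambda>k. cmod (f k)) F \<le> A)"
    "0 \<le> B \<and> (\<forall>F. finite F \<longrightarrow> L2_set (\<lambda>k. cmod (g k)) F \<le> B)"
  have "L2_set (\<lambda>k. cmod (f k + g k)) F \<le> L2_set (\<lambda>k. cmod (f k) + cmod (g k)) F"
    by (rule L2_set_mono) (auto simp: norm_triangle_ineq)
  also have "\<dots> \<le> L2_set (\<lambda>k. cmod (f k)) F + L2_set (\<lambda>k. cmod (g k)) F"
    by (rule L2_set_triangle_ineq)
  finally show "L2_set (\<lambda>k. cmod (f k + g k)) F \<le> A + B" using * F by force
qed auto

lemma l2bd_cmult: "l2bd f A \<Longrightarrow> l2bd (\<lambda>k. c * f k) (cmod c * A)"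
  unfolding l2bd_def norm_mult by (auto simp: mult_left_mono simp flip: L2_set_right_distrib)

lemma l2bd_minus: "l2bd f A \<Longrightarrow> l2bd (\<lambda>k. - f k) A"
  by (rule l2bd_mono) auto

lemma l2bd_diff: "l2bd f A \<Longrightarrow> l2bd g B \<Longrightarrow> l2bd (\<lambda>k. f k - g k) (A + B)"
  using l2bd_add[OF _ l2bd_minus] by fastforce

lemma l2bd_zero: "0 \<le> B \<Longrightarrow> l2bd (\<lambda>k. 0) B"
  by (simp add: l2bd_def L2_set_def)

lemma l2bd_component: "l2bd f B \<Longrightarrow> cmod (f k) \<le> B"
  unfolding l2bd_def by (drule conjunct2, drule spec[of _ "{k}"]) simp

lemma l2bd_reindex:
  assumes "l2bd f B" "inj h"
  shows "l2bd (\<lambda>k. f (h k)) B"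
proof (rule l2bd_finite_sums)
  fix F :: "'b set" assume F: "finite F"
  have "(\<Sum>k\<in>F. (cmod (f (h k)))\<^sup>2) = (\<Sum>k\<in>h ` F. (cmod (f k))\<^sup>2)"
    using assms(2) by (subst sum.reindex) (auto intro: inj_on_subset)
  also have "\<dots> \<le> B\<^sup>2"
    using assms(1) F by (auto simp: l2bd_def L2_set_def intro: sqrt_le_D)
  finally show "(\<Sum>k\<in>F. (cmod (f (h k)))\<^sup>2) \<le> B\<^sup>2" .
qed (use assms l2bd_nonneg in auto)

text \<open>Two powers of decay give square summability because the square is the summable J^-4.
  Norm bounds for Duhamel's integral are obtained in this way from pointwise ones, at the price of
  two derivatives.\<close>

lemma l2bd_decay:
  assumes "\<And>k. cmod (f k) \<le> C / jb k ^ 2" "0 \<le> C"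
  shows "l2bd f (C * sqrt jsum)"
proof (rule l2bd_finite_sums)
  fix F :: "(int \<times> int) set" assume F: "finite F"
  have "(\<Sum>k\<in>F. (cmod (f k))\<^sup>2) \<le> (\<Sum>k\<in>F. C\<^sup>2 * (1 / jb k ^ 4))"
  proof (rule sum_mono)
    fix k
    have "(cmod (f k))\<^sup>2 \<le> (C / jb k ^ 2)\<^sup>2" by (rule power_mono[OF assms(1)]) simp
    then show "(cmod (f k))\<^sup>2 \<le> C\<^sup>2 * (1 / jb k ^ 4)" by (simp add: power_divide)
  qed
  also have "\<dots> \<le> C\<^sup>2 * jsum"
    unfolding sum_distrib_left[symmetric] by (intro mult_left_mono sum_jb_le F) simp
  finally show "(\<Sum>k\<in>F. (cmod (f k))\<^sup>2) \<le> (C * sqrt jsum)\<^sup>2"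
    by (simp add: power_mult_distrib jsum_nonneg)
qed (use assms jsum_nonneg in auto)

lemma l2bd_prod_sum:
  assumes "l2bd f A" "l2bd g B" "finite F"
  shows "(\<Sum>k\<in>F. cmod (f k * g k)) \<le> A * B"
proof -
  have "(\<Sum>k\<in>F. cmod (f k * g k)) \<le> L2_set (\<lambda>k. cmod (f k)) F * L2_set (\<lambda>k. cmod (g k)) F"
    using L2_set_mult_ineq[of "\<lambda>k. cmod (f k)" "\<lambda>k. cmod (g k)" F] by (simp add: norm_mult)
  also have "\<dots> \<le> A * B"
    using assms by (intro mult_mono) (auto simp: l2bd_def)
  finally show ?thesis .
qed

lemma l2bd_prod_abs_summable:
  assumes "l2bd f A" "l2bd g B"
  shows "(\<lambda>k. cmod (f k * g k)) summable_on UNIV"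
  by (rule nonneg_bdd_above_summable_on) (use l2bd_prod_sum[OF assms] in \<open>auto simp: bdd_above_def\<close>)

lemma l2bd_prod_summable:
  assumes "l2bd f A" "l2bd g B"
  shows "(\<lambda>k. f k * g k) summable_on UNIV"
  by (rule abs_summable_summable[OF l2bd_prod_abs_summable[OF assms]])

lemma l2bd_prod_infsum_abs:
  assumes "l2bd f A" "l2bd g B"
  shows "(\<Sum>\<^sub>\<infinity>k. cmod (f k * g k)) \<le> A * B"
  by (rule infsum_le_finite_sums[OF l2bd_prod_abs_summable[OF assms] l2bd_prod_sum[OF assms]])

lemma l2bd_prod_infsum:
  assumes "l2bd f A" "l2bd g B"
  shows "cmod (\<Sum>\<^sub>\<infinity>k. f k * g k) \<le> A * B"
  using norm_infsum_bound[OF l2bd_prod_abs_summable[OF assms]] l2bd_prod_infsum_abs[OF assms]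
  by simp

section \<open>Convolution of square-summable families\<close>

definition conv :: "(int \<times> int \<Rightarrow> complex) \<Rightarrow> (int \<times> int \<Rightarrow> complex) \<Rightarrow> int \<times> int \<Rightarrow> complex" where
  "conv f g k = (\<Sum>\<^sub>\<infinity>l. f l * g (k - l))"

lemma inj_diff_left: "inj (\<lambda>l. k - l :: 'a::ab_group_add)"
  by (auto simp: inj_def)

lemma conv_summable:
  fixes f g :: "'a::ab_group_add \<Rightarrow> complex"
  assumes "l2bd f A" "l2bd g B"
  shows "(\<lambda>l. f l * g (k - l)) summable_on UNIV"
  using l2bd_prod_summable[OF assms(1) l2bd_reindex[OF assms(2) inj_diff_left]] .

lemma conv_abs_summable:
  fixes f g :: "'a::ab_group_add \<Rightarrow> complex"
  assumes "l2bd f A" "l2bd g B"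
  shows "(\<lambda>l. cmod (f l * g (k - l))) summable_on UNIV"
  using l2bd_prod_abs_summable[OF assms(1) l2bd_reindex[OF assms(2) inj_diff_left]] .

lemma conv_infsum_abs:
  fixes f g :: "'a::ab_group_add \<Rightarrow> complex"
  assumes "l2bd f A" "l2bd g B"
  shows "(\<Sum>\<^sub>\<infinity>l. cmod (f l * g (k - l))) \<le> A * B"
  using l2bd_prod_infsum_abs[OF assms(1) l2bd_reindex[OF assms(2) inj_diff_left]] .

lemma conv_bound:
  assumes "l2bd f A" "l2bd g B"
  shows "cmod (conv f g k) \<le> A * B"
  unfolding conv_def
  using l2bd_prod_infsum[OF assms(1) l2bd_reindex[OF assms(2) inj_diff_left]] .

lemma conv_commute: "conv f g k = conv g f k"
  unfolding conv_def
  by (rule infsum_reindex_bij_witness[of _ "\<lambda>l. k - l" "\<lambda>l. k - l"]) (auto simp: mult.commute)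

lemma infsum_diff:
  fixes f g :: "'a \<Rightarrow> 'b::{topological_ab_group_add, t2_space}"
  assumes "f summable_on S" "g summable_on S"
  shows "(\<Sum>\<^sub>\<infinity>k\<in>S. f k - g k) = infsum f S - infsum g S"
  using infsum_add[OF assms(1) summable_on_uminus[THEN iffD2, OF assms(2)]]
  by (simp add: infsum_uminus)

lemma conv_diff:
  assumes "l2bd f A" "l2bd f' A'" "l2bd g B" "l2bd g' B'"
  shows "conv f g k - conv f' g' k = conv (\<lambda>k. f k - f' k) g k + conv f' (\<lambda>k. g k - g' k) k"
proof -
  have "conv (\<lambda>k. f k - f' k) g k = conv f g k - conv f' g k"
    unfolding conv_def
    by (subst infsum_diff[symmetric])
      (use conv_summable[OF assms(1,3)] conv_summable[OF assms(2,3)] in \<open>auto simp: algebra_simps\<close>)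
  moreover have "conv f' (\<lambda>k. g k - g' k) k = conv f' g k - conv f' g' k"
    unfolding conv_def
    by (subst infsum_diff[symmetric])
      (use conv_summable[OF assms(2,3)] conv_summable[OF assms(2,4)] in \<open>auto simp: algebra_simps\<close>)
  ultimately show ?thesis by simp
qed

text \<open>Bilinearity moves the difference into one factor at a time, so the quadratic map is
  Lipschitz on bounded sets with a constant given by the two radii.\<close>

lemma conv_diff_bound:
  assumes "l2bd f A" "l2bd g A'" "l2bd (\<lambda>k. f k - g k) B"
  shows "cmod (conv f f k - conv g g k) \<le> B * (A + A')"
proof -
  have "cmod (conv f f k - conv g g k)
      \<le> cmod (conv (\<lambda>k. f k - g k) f k) + cmod (conv g (\<lambda>k. f k - g k) k)"
    unfolding conv_diff[OF assms(1,2,1,2)] by (rule norm_triangle_ineq)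
  also have "\<dots> \<le> B * A + A' * B"
    by (intro add_mono conv_bound assms)
  finally show ?thesis by (simp add: algebra_simps)
qed

lemma conv_scale: "conv (\<lambda>k. c * f k) (\<lambda>k. c * f k) k = c\<^sup>2 * conv f f k"
  unfolding conv_def by (subst infsum_cmult_right'[symmetric]) (simp add: power2_eq_square mult_ac)

text \<open>In each term one factor carries the weight and the other only its plain norm, so the
  bound is linear in the weighted norms and can be iterated. It is pointwise in \<open>k\<close>:
  Cauchy-Schwarz controls every single coefficient, and square summability has to come from
  Duhamel's integral.\<close>

lemma conv_tame:
  assumes "l2bd (\<lambda>k. of_real (jb k ^ s) * f k) A" "l2bd (\<lambda>k. of_real (jb k ^ s) * g k) A'" "l2bd f B" "l2bd g B'"
  shows "jb k ^ s * cmod (conv f g k) \<le> 2 ^ s * (A * B' + B * A')"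
proof -
  let ?f = "\<lambda>k. complex_of_real (jb k ^ s) * f k" and ?g = "\<lambda>k. complex_of_real (jb k ^ s) * g k"
  have sf: "(\<lambda>l. cmod (?f l * g (k - l))) summable_on UNIV"
    by (rule conv_abs_summable[OF _ assms(4)]) (use assms(1) in simp)
  have sg: "(\<lambda>l. cmod (f l * ?g (k - l))) summable_on UNIV"
    by (rule conv_abs_summable[OF assms(3)]) (use assms(2) in simp)
  have s0: "(\<lambda>l. cmod (f l * g (k - l))) summable_on UNIV"
    by (rule conv_abs_summable[OF assms(3,4)])
  have "jb k ^ s * cmod (conv f g k) \<le> jb k ^ s * (\<Sum>\<^sub>\<infinity>l. cmod (f l * g (k - l)))"
    unfolding conv_def by (intro mult_left_mono norm_infsum_bound s0) (simp add: jb_nonneg)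
  also have "\<dots> = (\<Sum>\<^sub>\<infinity>l. jb k ^ s * cmod (f l * g (k - l)))"
    by (rule infsum_cmult_right'[symmetric])
  also have "\<dots> \<le> (\<Sum>\<^sub>\<infinity>l. 2 ^ s * (cmod (?f l * g (k - l)) + cmod (f l * ?g (k - l))))"
  proof (rule infsum_mono)
    show "(\<lambda>l. jb k ^ s * cmod (f l * g (k - l))) summable_on UNIV"
      by (rule summable_on_cmult_right[OF s0])
    show "(\<lambda>l. 2 ^ s * (cmod (?f l * g (k - l)) + cmod (f l * ?g (k - l)))) summable_on UNIV"
      by (intro summable_on_cmult_right summable_on_add sf sg)
    fix l
    have "jb k ^ s * cmod (f l * g (k - l)) \<le> 2 ^ s * (jb l ^ s + jb (k - l) ^ s) * cmod (f l * g (k - l))"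
      by (rule mult_right_mono[OF jb_power_split]) simp
    then show "jb k ^ s * cmod (f l * g (k - l))
        \<le> 2 ^ s * (cmod (?f l * g (k - l)) + cmod (f l * ?g (k - l)))"
      by (simp add: norm_mult norm_power jb_nonneg algebra_simps)
  qed
  also have "\<dots> = 2 ^ s * ((\<Sum>\<^sub>\<infinity>l. cmod (?f l * g (k - l))) + (\<Sum>\<^sub>\<infinity>l. cmod (f l * ?g (k - l))))"
    by (simp only: infsum_cmult_right' infsum_add[OF sf sg])
  also have "\<dots> \<le> 2 ^ s * (A * B' + B * A')"
    by (intro mult_left_mono add_mono conv_infsum_abs) (use assms in auto)
  finally show ?thesis .
qed

section \<open>The square-summable families as a Banach space\<close>

typedef l2 = "{f :: int \<times> int \<Rightarrow> complex. (\<lambda>k. (cmod (f k))\<^sup>2) summable_on UNIV}"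
  morphisms cf Abs_l2
  by (rule exI[of _ "\<lambda>_. 0"]) simp

lemma cf_summable: "(\<lambda>k. (cmod (cf a k))\<^sup>2) summable_on UNIV"
  using cf[of a] by simp

lemma cf_Abs_l2: "l2bd f B \<Longrightarrow> cf (Abs_l2 f) = f"
  by (rule Abs_l2_inverse) (simp add: l2bd_summable)

lemma l2_eqI: "(\<And>k. cf a k = cf b k) \<Longrightarrow> a = b"
  using cf_inject[of a b] by blast

text \<open>A type of its own gives access to Banach's fixed point theorem and to the type of
  bounded continuous functions. The norm comes with the vector operations and before the normed
  structure, so that \<open>l2bd_cf\<close> and the rules for \<open>cf\<close> are at hand for the
  triangle inequality.\<close>

instantiation l2 :: "{real_vector, norm}"
begin

definition zero_l2 :: l2 where "0 = Abs_l2 (\<lambda>k. 0)"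
definition plus_l2 :: "l2 \<Rightarrow> l2 \<Rightarrow> l2" where "a + b = Abs_l2 (\<lambda>k. cf a k + cf b k)"
definition minus_l2 :: "l2 \<Rightarrow> l2 \<Rightarrow> l2" where "a - b = Abs_l2 (\<lambda>k. cf a k - cf b k)"
definition uminus_l2 :: "l2 \<Rightarrow> l2" where "- a = Abs_l2 (\<lambda>k. - cf a k)"
definition scaleR_l2 :: "real \<Rightarrow> l2 \<Rightarrow> l2" where "scaleR r a = Abs_l2 (\<lambda>k. of_real r * cf a k)"
definition norm_l2 :: "l2 \<Rightarrow> real" where "norm a = sqrt (\<Sum>\<^sub>\<infinity>k. (cmod (cf a k))\<^sup>2)"
lemma l2bd_cf: "l2bd (cf a) (norm a)"
  unfolding norm_l2_def by (rule l2bd_sqrt_infsum[OF cf_summable])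

lemma cf_0 [simp]: "cf 0 k = 0"
  unfolding zero_l2_def by (subst cf_Abs_l2[OF l2bd_zero[of 0]]) auto
lemma cf_add [simp]: "cf (a + b) k = cf a k + cf b k"
  unfolding plus_l2_def by (subst cf_Abs_l2[OF l2bd_add[OF l2bd_cf l2bd_cf]]) auto
lemma cf_diff [simp]: "cf (a - b) k = cf a k - cf b k"
  unfolding minus_l2_def by (subst cf_Abs_l2[OF l2bd_diff[OF l2bd_cf l2bd_cf]]) auto
lemma cf_minus [simp]: "cf (- a) k = - cf a k"
  unfolding uminus_l2_def by (subst cf_Abs_l2[OF l2bd_minus[OF l2bd_cf]]) auto
lemma cf_scaleR [simp]: "cf (r *\<^sub>R a) k = of_real r * cf a k"
  unfolding scaleR_l2_def by (subst cf_Abs_l2[OF l2bd_cmult[OF l2bd_cf]]) auto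

lemma norm_l2_le: "l2bd (cf a) B \<Longrightarrow> norm a \<le> B"
  unfolding norm_l2_def using l2bd_infsum[of "cf a" B] l2bd_nonneg[of "cf a" B]
  by (intro real_le_lsqrt) (auto intro: infsum_nonneg)

lemma cmod_cf_le: "cmod (cf a k) \<le> norm a"
  by (rule l2bd_component[OF l2bd_cf])

instance
  by standard (auto intro!: l2_eqI simp: algebra_simps)

end

instantiation l2 :: real_normed_vector
begin

definition dist_l2 :: "l2 \<Rightarrow> l2 \<Rightarrow> real" where "dist (a::l2) b = norm (a - b)"
definition sgn_l2 :: "l2 \<Rightarrow> l2" where "sgn (a::l2) = a /\<^sub>R norm a"
definition uniformity_l2 :: "(l2 \<times> l2) filter" where
  "uniformity_l2 = (INF e\<in>{0 <..}. principal {(x, y). dist (x::l2) y < e})"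
definition open_l2 :: "l2 set \<Rightarrow> bool" where
  "open_l2 U \<longleftrightarrow> (\<forall>x\<in>U. \<forall>\<^sub>F (x', y) in uniformity. x' = x \<longrightarrow> y \<in> U)"

instance
proof
  fix a b :: l2 and r :: real
  show "norm (a + b) \<le> norm a + norm b"
  proof (rule norm_l2_le)
    show "l2bd (cf (a + b)) (norm a + norm b)"
      by (rule l2bd_mono[OF l2bd_add[OF l2bd_cf l2bd_cf]]) auto
  qed
  show "norm (r *\<^sub>R a) = \<bar>r\<bar> * norm a"
    by (simp add: norm_l2_def norm_mult power_mult_distrib infsum_cmult_right' real_sqrt_mult)
  show "norm a = 0 \<longleftrightarrow> a = 0"
  proof
    assume "norm a = 0"
    then have "cmod (cf a k) \<le> 0" for k using cmod_cf_le[of a k] by simp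
    then show "a = 0" by (intro l2_eqI) simp
  qed (simp add: norm_l2_def)
qed (simp_all add: dist_l2_def sgn_l2_def uniformity_l2_def open_l2_def)

end

lemma l2_exists: "l2bd f B \<Longrightarrow> \<exists>a. cf a = f \<and> norm a \<le> B"
  by (metis cf_Abs_l2 norm_l2_le)

text \<open>The bound involves finite sums only, and these pass to the limit: Fatou's lemma for
  counting measure.\<close>

lemma l2bd_tendsto:
  assumes "\<And>n. l2bd (g n) B" "\<And>k. (\<lambda>n. g n k) \<longlonglongrightarrow> f k"
  shows "l2bd f B"
proof (rule l2bd_finite_sums)
  show "0 \<le> B" using assms(1) l2bd_nonneg by blast
  fix F :: "'a set" assume F: "finite F"
  have "(\<lambda>n. \<Sum>k\<in>F. (cmod (g n k))\<^sup>2) \<longlonglongrightarrow> (\<Sum>k\<in>F. (cmod (f k))\<^sup>2)"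
    by (intro tendsto_intros assms)
  moreover have "(\<Sum>k\<in>F. (cmod (g n k))\<^sup>2) \<le> B\<^sup>2" for n
    using assms(1)[of n] F by (auto simp: l2bd_def L2_set_def intro: sqrt_le_D)
  ultimately show "(\<Sum>k\<in>F. (cmod (f k))\<^sup>2) \<le> B\<^sup>2"
    by (intro LIMSEQ_le_const2) auto
qed

text \<open>The limit is taken coordinate by coordinate. Letting one index of the Cauchy bound tend
  to infinity with \<open>l2bd_tendsto\<close> yields both that the limit is square summable and
  that convergence holds in norm.\<close>

instance l2 :: banach
proof
  fix X :: "nat \<Rightarrow> l2" assume X: "Cauchy X"
  have "Cauchy (\<lambda>n. cf (X n) k)" for k
  proof (rule metric_CauchyI)
    fix e :: real assume "e > 0"
    then obtain M where M: "\<And>m n. m \<ge> M \<Longrightarrow> n \<ge> M \<Longrightarrow> dist (X m) (X n) < e"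
      using X by (metis metric_CauchyD)
    show "\<exists>M. \<forall>m\<ge>M. \<forall>n\<ge>M. dist (cf (X m) k) (cf (X n) k) < e"
    proof (intro exI allI impI)
      fix m n assume "m \<ge> M" "n \<ge> M"
      then have "norm (X m - X n) < e" using M by (simp add: dist_norm)
      then show "dist (cf (X m) k) (cf (X n) k) < e"
        using cmod_cf_le[of "X m - X n" k] by (simp add: dist_norm)
    qed
  qed
  then have "\<exists>l. (\<lambda>n. cf (X n) k) \<longlonglongrightarrow> l" for k
    by (simp add: Cauchy_convergent_iff convergent_def)
  then obtain f where f: "\<And>k. (\<lambda>n. cf (X n) k) \<longlonglongrightarrow> f k" by metis
  have bd: "l2bd (\<lambda>k. f k - cf (X m) k) e"
    if M: "\<And>m n. m \<ge> M \<Longrightarrow> n \<ge> M \<Longrightarrow> norm (X m - X n) < e" and m: "m \<ge> M" for M m e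
  proof (rule l2bd_tendsto[of "\<lambda>n k. cf (X (n + M)) k - cf (X m) k"])
    fix n
    show "l2bd (\<lambda>k. cf (X (n + M)) k - cf (X m) k) e"
      by (rule l2bd_mono[OF l2bd_cf[of "X (n + M) - X m"]])
        (use M[of "n + M" m] m in \<open>auto simp: less_imp_le\<close>)
  next
    fix k
    show "(\<lambda>n. cf (X (n + M)) k - cf (X m) k) \<longlonglongrightarrow> f k - cf (X m) k"
      by (intro tendsto_intros LIMSEQ_ignore_initial_segment f)
  qed
  have C: "\<exists>M. \<forall>m\<ge>M. \<forall>n\<ge>M. norm (X m - X n) < e" if "e > 0" for e
    using X that unfolding Cauchy_def dist_norm by blast
  from C[of 1] obtain M where M: "\<And>m n. m \<ge> M \<Longrightarrow> n \<ge> M \<Longrightarrow> norm (X m - X n) < 1" by auto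
  have "l2bd (\<lambda>k. (f k - cf (X M) k) + cf (X M) k) (1 + norm (X M))"
    by (intro l2bd_add bd[OF M] l2bd_cf) auto
  then obtain a where a: "cf a = f" using l2_exists by fastforce
  have "X \<longlonglongrightarrow> a"
  proof (rule metric_LIMSEQ_I)
    fix e :: real assume "e > 0"
    then obtain M where M: "\<And>m n. m \<ge> M \<Longrightarrow> n \<ge> M \<Longrightarrow> norm (X m - X n) < e / 2"
      using C[of "e / 2"] by auto
    show "\<exists>M. \<forall>n\<ge>M. dist (X n) a < e"
    proof (intro exI allI impI)
      fix n assume "n \<ge> M"
      have "l2bd (cf (a - X n)) (e / 2)"
        by (rule l2bd_mono[OF bd[OF M \<open>n \<ge> M\<close>]]) (auto simp: a)
      then have "norm (a - X n) \<le> e / 2" by (rule norm_l2_le)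
      then show "dist (X n) a < e" using \<open>e > 0\<close> by (simp add: dist_norm norm_minus_commute)
    qed
  qed
  then show "convergent X" by (auto simp: convergent_def)
qed

section \<open>Fourier series on the torus\<close>

definition cell :: "(real \<times> real) set" where
  "cell = {0..2 * pi} \<times> {0..2 * pi}"

lemma cell_cbox: "cell = cbox (0, 0) (2 * pi, 2 * pi)"
  by (auto simp: cell_def cbox_Pair_eq)

lemma torus_cell: "torus = lebesgue_on cell"
  by (simp add: torus_def cell_def)

lemma cell_lmeasurable: "cell \<in> lmeasurable"
  by (simp add: cell_cbox)

lemma cell_sets [measurable, simp]: "cell \<in> sets lebesgue"
  by (simp add: cell_cbox)

lemma space_torus [simp]: "space torus = cell"
  by (simp add: torus_cell)

lemma finite_measure_torus: "finite_measure torus"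
  unfolding torus_cell by (rule finite_measure_lebesgue_on[OF cell_lmeasurable])

interpretation torus: finite_measure torus
  by (rule finite_measure_torus)

lemma measure_torus: "measure torus (space torus) = (2 * pi)\<^sup>2"
proof -
  have "measure torus cell = measure lebesgue cell"
    unfolding torus_cell by (simp add: measure_restrict_space)
  also have "\<dots> = (2 * pi)\<^sup>2"
    by (simp add: cell_cbox content_Pair power2_eq_square)
  finally show ?thesis by simp
qed

lemma continuous_measurable_torus:
  fixes f :: "real \<times> real \<Rightarrow> 'a::real_normed_vector"
  assumes "continuous_on UNIV f"
  shows "f \<in> borel_measurable torus"
  unfolding torus_cell
  by (intro measurable_restrict_space1 borel_measurable_continuous_onI assms measurable_completion)
     (use assms in \<open>simp add: borel_measurable_continuous_onI\<close>)

lemma continuous_integrable_torus: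
  fixes f :: "real \<times> real \<Rightarrow> 'a::{banach, second_countable_topology}"
  assumes "continuous_on UNIV f"
  shows "integrable torus f"
proof -
  have "compact (f ` cell)"
    unfolding cell_cbox
    by (rule compact_continuous_image[OF _ compact_cbox]) (rule continuous_on_subset[OF assms], simp)
  then obtain B where "\<And>p. p \<in> cell \<Longrightarrow> norm (f p) \<le> B"
    by (metis bounded_iff compact_imp_bounded imageI)
  then show ?thesis
    by (intro torus.integrable_const_bound[of _ B] continuous_measurable_torus assms AE_I2) simp
qed

section \<open>Characters and Fourier coefficients of complex functions\<close>

definition ex :: "int \<times> int \<Rightarrow> real \<times> real \<Rightarrow> complex" where
  "ex k p = cis (of_int (fst k) * fst p + of_int (snd k) * snd p)"

lemma ex_add: "ex (k + l) p = ex k p * ex l p"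
  by (simp add: ex_def cis_mult algebra_simps)

lemma ex_zero [simp]: "ex 0 p = 1"
  by (simp add: ex_def)

lemma ex_minus: "ex (- k) p = cnj (ex k p)"
  by (simp add: ex_def cis_cnj)

lemma norm_ex [simp]: "cmod (ex k p) = 1"
  by (simp add: ex_def)

lemma continuous_ex [continuous_intros]: "continuous_on S (ex k)"
  unfolding ex_def cis_conv_exp by (intro continuous_intros)

lemma measurable_ex [measurable]: "ex k \<in> borel_measurable torus"
  by (rule continuous_measurable_torus) (rule continuous_ex)

lemma integral_cis_period:
  assumes "n \<noteq> (0::int)"
  shows "integral {0..2 * pi} (\<lambda>y. cis (of_int n * y)) = 0"
proof -
  define F where "F y = exp (\<i> * of_int n * of_real y) / (\<i> * of_int n)" for y :: real
  have "(F has_vector_derivative cis (of_int n * y)) (at y within {0..2 * pi})" for y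
  proof -
    have "((\<lambda>z. exp (\<i> * of_int n * z) / (\<i> * of_int n)) has_field_derivative
        exp (\<i> * of_int n * of_real y)) (at (of_real y))"
      using assms by (auto intro!: derivative_eq_intros)
    then have "(F has_vector_derivative exp (\<i> * of_int n * of_real y)) (at y within {0..2 * pi})"
      unfolding F_def[abs_def] by (rule has_vector_derivative_real_field[THEN has_vector_derivative_at_within])
    then show ?thesis by (simp add: cis_conv_exp mult.assoc)
  qed
  then have "((\<lambda>y. cis (of_int n * y)) has_integral F (2 * pi) - F 0) {0..2 * pi}"
    by (intro fundamental_theorem_of_calculus) auto
  moreover have "exp (\<i> * of_int n * of_real (2 * pi)) = 1"
    using exp_integer_2pi[of "of_int n"] by (simp add: mult_ac)
  then have "F (2 * pi) = F 0" by (simp add: F_def)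
  ultimately show ?thesis by (simp add: integral_unique)
qed

lemma integral_ex: "(\<integral>p. ex k p \<partial>torus) = (if k = 0 then of_real ((2 * pi)\<^sup>2) else 0)"
proof (cases "k = 0")
  case True
  then show ?thesis using measure_torus by (simp add: scaleR_conv_of_real)
next
  case False
  have "(\<integral>p. ex k p \<partial>torus) = integral cell (ex k)"
    unfolding torus_cell
    by (rule lebesgue_integral_eq_integral)
      (use continuous_integrable_torus[OF continuous_ex] in \<open>auto simp: torus_cell\<close>)
  also have "\<dots> = integral (cbox 0 (2 * pi)) (\<lambda>x. integral (cbox 0 (2 * pi)) (\<lambda>y. ex k (x, y)))"
    unfolding cell_cbox by (rule integral_prod_continuous[OF continuous_ex])
  also have "\<dots> = integral {0..2 * pi} (\<lambda>x. cis (of_int (fst k) * x) *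
      integral {0..2 * pi} (\<lambda>y. cis (of_int (snd k) * y)))"
    by (simp add: ex_def integral_mult_right flip: cis_mult)
  also have "\<dots> = integral {0..2 * pi} (\<lambda>x. cis (of_int (fst k) * x)) *
      integral {0..2 * pi} (\<lambda>y. cis (of_int (snd k) * y))"
    by (simp add: integral_mult_left)
  also have "\<dots> = 0"
    using False integral_cis_period[of "fst k"] integral_cis_period[of "snd k"]
    by (cases k) (auto simp: zero_prod_def)
  finally show ?thesis using False by simp
qed

text \<open>The coefficient for complex functions. Multiplying a real function by a character leaves
  the domain of \<open>fourier_coeff\<close>, whereas here it is a mere shift of the index.\<close>

definition fcc :: "(real \<times> real \<Rightarrow> complex) \<Rightarrow> int \<times> int \<Rightarrow> complex" where
  "fcc f k = (\<integral>p. ex (- k) p * f p \<partial>torus) / of_real ((2 * pi)\<^sup>2)"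

lemma fourier_coeff_fcc: "fourier_coeff u k = fcc (\<lambda>p. of_real (u p)) k"
proof -
  have "exp (- \<i> * of_int (fst k) * of_real (fst p) - \<i> * of_int (snd k) * of_real (snd p)) = ex (- k) p"
    for p :: "real \<times> real"
    by (simp add: ex_def cis_conv_exp algebra_simps)
  then show ?thesis unfolding fourier_coeff_def fcc_def by simp
qed

lemma integrable_ex_mult:
  assumes "integrable torus f"
  shows "integrable torus (\<lambda>p. ex k p * f p)"
  by (rule Bochner_Integration.integrable_bound[OF assms])
    (use assms in \<open>auto simp: norm_mult intro!: borel_measurable_times\<close>)

lemma fcc_add:
  assumes "integrable torus f" "integrable torus g"
  shows "fcc (\<lambda>p. f p + g p) k = fcc f k + fcc g k"
  using integrable_ex_mult[OF assms(1), of "- k"] integrable_ex_mult[OF assms(2), of "- k"]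
  by (simp add: fcc_def distrib_left add_divide_distrib)

lemma fcc_cmult: "fcc (\<lambda>p. c * f p) k = c * fcc f k"
  unfolding fcc_def by (subst mult.left_commute) simp

lemma fcc_ex_mult: "fcc (\<lambda>p. ex l p * f p) k = fcc f (k - l)"
  unfolding fcc_def mult.assoc[symmetric] ex_add[symmetric] by simp

lemma fcc_cnj: "fcc (\<lambda>p. cnj (f p)) k = cnj (fcc f (- k))"
proof -
  have "(\<integral>p. ex (- k) p * cnj (f p) \<partial>torus) = (\<integral>p. cnj (ex k p * f p) \<partial>torus)"
    by (simp add: ex_minus)
  also have "\<dots> = cnj (\<integral>p. ex k p * f p \<partial>torus)"
    by (rule Bochner_Integration.integral_cnj)
  finally show ?thesis by (simp add: fcc_def)
qed

lemma fcc_ex: "fcc (ex l) k = (if k = l then 1 else 0)"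
  using integral_ex[of "l - k"] by (simp add: fcc_def flip: ex_add)

text \<open>The reality condition on the frequency side. It has to be secured whenever a family is
  turned back into a function, because functions here are real-valued.\<close>

definition herm :: "(int \<times> int \<Rightarrow> complex) \<Rightarrow> bool" where
  "herm f \<longleftrightarrow> (\<forall>k. f (- k) = cnj (f k))"

lemma herm_fourier_coeff: "herm (fourier_coeff u)"
  unfolding herm_def fourier_coeff_fcc
proof
  fix k show "fcc (\<lambda>p. of_real (u p)) (- k) = cnj (fcc (\<lambda>p. of_real (u p)) k)"
    using fcc_cnj[of "\<lambda>p. of_real (u p)" "- k"] by simp
qed

lemma fourier_coeff_add:
  assumes "integrable torus u" "integrable torus v"
  shows "fourier_coeff (\<lambda>p. u p + v p) k = fourier_coeff u k + fourier_coeff v k"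
  using fcc_add[OF assms[THEN integrable_of_real]] by (simp add: fourier_coeff_fcc)

lemma fourier_coeff_cmult: "fourier_coeff (\<lambda>p. c * u p) k = of_real c * fourier_coeff u k"
  using fcc_cmult[of "of_real c" "\<lambda>p. of_real (u p)"] by (simp add: fourier_coeff_fcc)

lemma fourier_coeff_diff:
  assumes "integrable torus u" "integrable torus v"
  shows "fourier_coeff (\<lambda>p. u p - v p) k = fourier_coeff u k - fourier_coeff v k"
  using fourier_coeff_add[OF assms(1) integrable_mult_right[OF assms(2), of "-1"]]
    fourier_coeff_cmult[of "-1" v] by simp

lemma fourier_coeff_cong_AE:
  assumes "u \<in> borel_measurable torus" "v \<in> borel_measurable torus" "AE p in torus. u p = v p"
  shows "fourier_coeff u k = fourier_coeff v k"
  unfolding fourier_coeff_fcc fcc_def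
  by (intro arg_cong2[where f = "(/)"] integral_cong_AE refl)
    (use assms in \<open>auto intro!: borel_measurable_times\<close>)

subsection \<open>Uniqueness of Fourier coefficients\<close>

text \<open>The torus as a compact subset of C^2, to which the Stone-Weierstrass theorem for real
  polynomials applies. Polynomials in these coordinates are trigonometric polynomials in
  \<open>p\<close>.\<close>

definition circ :: "real \<times> real \<Rightarrow> complex \<times> complex" where
  "circ p = (cis (fst p), cis (snd p))"

lemma continuous_circ: "continuous_on S circ"
  unfolding circ_def cis_conv_exp by (intro continuous_intros)

lemma circ_inj:
  assumes "p \<in> {0..<2 * pi} \<times> {0..<2 * pi}" "q \<in> {0..<2 * pi} \<times> {0..<2 * pi}" "circ p = circ q"
  shows "p = q"
proof -
  have *: "x = y" if "cis x = cis y" "x \<in> {0..<2 * pi}" "y \<in> {0..<2 * pi}" for x y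
  proof -
    have "cos x = cos y" "sin x = sin y"
      using that(1) by (auto simp: complex_eq_iff)
    then obtain n :: int where n: "x = y + 2 * pi * n" by (metis sin_cos_eq_iff)
    have "\<bar>2 * pi * n\<bar> < 2 * pi" using n that(2,3) by auto
    then have "2 * pi * \<bar>real_of_int n\<bar> < 2 * pi * 1" by (simp add: abs_mult)
    then have "\<bar>real_of_int n\<bar> < 1" using pi_gt_zero by (simp only: mult_less_cancel_left_pos)
    then have "n = 0" by linarith
    then show ?thesis using n by simp
  qed
  show ?thesis using assms *[of "fst p" "fst q"] *[of "snd p" "snd q"]
    by (auto simp: circ_def prod_eq_iff)
qed

text \<open>The class of \<open>w\<close> such that \<open>u w\<close> has vanishing coefficients is stable under multiplication
  by every polynomial in the coordinates of the two circles.\<close>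

definition orth :: "(real \<times> real \<Rightarrow> real) \<Rightarrow> (real \<times> real \<Rightarrow> complex) \<Rightarrow> bool" where
  "orth u w \<longleftrightarrow> continuous_on UNIV w \<and> (\<forall>k. (\<integral>p. ex k p * (w p * of_real (u p)) \<partial>torus) = 0)"

lemma integrable_cont_mult:
  assumes "integrable torus u" "continuous_on UNIV w"
  shows "integrable torus (\<lambda>p. w p * complex_of_real (u p))"
proof -
  have "compact (w ` cell)"
    unfolding cell_cbox
    by (rule compact_continuous_image[OF _ compact_cbox]) (rule continuous_on_subset[OF assms(2)], simp)
  then obtain B where B: "\<And>p. p \<in> cell \<Longrightarrow> norm (w p) \<le> B"
    by (metis bounded_iff compact_imp_bounded imageI)
  show ?thesis
  proof (rule Bochner_Integration.integrable_bound[OF integrable_mult_right[OF integrable_of_real[OF assms(1)], of "of_real B"]])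
    show "(\<lambda>p. w p * complex_of_real (u p)) \<in> borel_measurable torus"
      using assms continuous_measurable_torus[OF assms(2)] by (auto intro!: borel_measurable_times)
    show "AE p in torus. norm (w p * complex_of_real (u p)) \<le> norm (of_real B * complex_of_real (u p))"
    proof (rule AE_I2)
      fix p assume "p \<in> space torus"
      then have "cmod (w p) \<le> \<bar>B\<bar>" using B[of p] by simp
      then show "norm (w p * complex_of_real (u p)) \<le> norm (of_real B * complex_of_real (u p))"
        by (simp add: norm_mult mult_right_mono)
    qed
  qed
qed

lemma orth_add:
  assumes u: "integrable torus u" and "orth u w" "orth u w'"
  shows "orth u (\<lambda>p. w p + w' p)"
proof -
  have c: "continuous_on UNIV w" "continuous_on UNIV w'" using assms by (auto simp: orth_def)
  show ?thesis
    using assms(2,3) integrable_ex_mult[OF integrable_cont_mult[OF u c(1)]]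
      integrable_ex_mult[OF integrable_cont_mult[OF u c(2)]]
    by (auto simp: orth_def distrib_left distrib_right intro!: continuous_intros)
qed

lemma orth_cmult:
  assumes "orth u w" shows "orth u (\<lambda>p. c * w p)"
proof -
  have "(\<integral>p. ex k p * (c * w p * of_real (u p)) \<partial>torus) = c * (\<integral>p. ex k p * (w p * of_real (u p)) \<partial>torus)"
    for k by (subst Bochner_Integration.integral_mult_right_zero[symmetric]) (simp add: mult_ac)
  then show ?thesis using assms by (auto simp: orth_def intro!: continuous_intros)
qed

lemma orth_ex:
  assumes "orth u w" shows "orth u (\<lambda>p. ex l p * w p)"
proof -
  have "(\<integral>p. ex k p * (ex l p * w p * of_real (u p)) \<partial>torus) = (\<integral>p. ex (k + l) p * (w p * of_real (u p)) \<partial>torus)"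
    for k by (simp add: ex_add mult_ac)
  then show ?thesis using assms by (simp add: orth_def continuous_intros del: split_paired_All)
qed

lemma orth_poly:
  assumes u: "integrable torus u" and g: "real_polynomial_function g"
  shows "orth u w \<Longrightarrow> orth u (\<lambda>p. of_real (g (circ p)) * w p)"
  using g
proof (induction arbitrary: w rule: real_polynomial_function.induct)
  case (linear f)
  define a b c d where "a = f (1, 0)" and "b = f (\<i>, 0)" and "c = f (0, 1)" and "d = f (0, \<i>)"
  interpret f: bounded_linear f by fact
  have f: "f z = Re (fst z) * a + Im (fst z) * b + Re (snd z) * c + Im (snd z) * d" for z
  proof -
    have "z = Re (fst z) *\<^sub>R (1, 0) + Im (fst z) *\<^sub>R (\<i>, 0) + Re (snd z) *\<^sub>R (0, 1) + Im (snd z) *\<^sub>R (0, \<i>)"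
      by (auto simp: prod_eq_iff complex_eq_iff)
    then have "f z = f (Re (fst z) *\<^sub>R (1, 0) + Im (fst z) *\<^sub>R (\<i>, 0) + Re (snd z) *\<^sub>R (0, 1) + Im (snd z) *\<^sub>R (0, \<i>))"
      by simp
    then show ?thesis by (simp only: f.add f.scaleR a_def b_def c_def d_def real_scaleR_def)
  qed
  \<comment> \<open>By Euler's formulas a real linear functional of the two points on the circles is
    a combination of four characters, and \<open>orth\<close> is stable under multiplication by
    characters.\<close>
  have "complex_of_real (f (circ p)) = (a / 2 - \<i> * b / 2) * ex (1, 0) p + (a / 2 + \<i> * b / 2) * ex (-1, 0) p
      + (c / 2 - \<i> * d / 2) * ex (0, 1) p + (c / 2 + \<i> * d / 2) * ex (0, -1) p" for p
    by (simp add: f circ_def ex_def complex_eq_iff)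
  note * = this
  have "(\<lambda>p. of_real (f (circ p)) * w p) = (\<lambda>p. (a / 2 - \<i> * b / 2) * (ex (1, 0) p * w p)
      + (a / 2 + \<i> * b / 2) * (ex (-1, 0) p * w p)
      + (c / 2 - \<i> * d / 2) * (ex (0, 1) p * w p) + (c / 2 + \<i> * d / 2) * (ex (0, -1) p * w p))"
    by (rule ext, subst *) (simp only: distrib_right mult.assoc)
  then show ?case
    by (simp only:) (intro orth_add[OF u] orth_cmult orth_ex linear.prems)
next
  case (const c)
  then show ?case by (intro orth_cmult)
next
  case (add f g)
  then show ?case using orth_add[OF u add.IH(1)[OF add.prems] add.IH(2)[OF add.prems]]
    by (simp add: algebra_simps)
next
  case (mult f g)
  then show ?case using mult.IH(1)[OF mult.IH(2)[OF mult.prems]]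
    by (simp add: algebra_simps)
qed

text \<open>For a polynomial in place of \<open>F\<close> the integral vanishes by
  \<open>orth_poly\<close> with \<open>w\<close> constantly one. Uniform approximation of
  \<open>F\<close> on the product of circles costs at most e times the L^1 norm of
  \<open>u\<close>.\<close>

lemma integral_circ_zero:
  assumes u: "integrable torus u" and z: "\<And>k. fourier_coeff u k = 0"
    and F: "continuous_on UNIV (F :: complex \<times> complex \<Rightarrow> real)"
  shows "(\<integral>p. F (circ p) * u p \<partial>torus) = 0"
proof -
  let ?S = "sphere (0::complex) 1 \<times> sphere (0::complex) 1"
  have S: "compact ?S" by (intro compact_Times compact_sphere)
  have circS: "circ p \<in> ?S" for p by (simp add: circ_def)
  have o1: "orth u (\<lambda>p. 1)"
    using z[of "- k" for k] by (auto simp: orth_def fourier_coeff_fcc fcc_def)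
  have iF: "integrable torus (\<lambda>p. complex_of_real (F (circ p)) * of_real (u p))"
    by (intro integrable_cont_mult[OF u] continuous_intros continuous_on_compose2[OF F continuous_circ]) auto
  then have iF': "integrable torus (\<lambda>p. F (circ p) * u p)"
    using integrable_Re[OF iF] by simp
  have "\<bar>\<integral>p. F (circ p) * u p \<partial>torus\<bar> \<le> e * (\<integral>p. \<bar>u p\<bar> \<partial>torus)" if e: "e > 0" for e
  proof -
    obtain g where g: "real_polynomial_function g" "\<And>x. x \<in> ?S \<Longrightarrow> \<bar>F x - g x\<bar> < e"
      using Stone_Weierstrass_real_polynomial_function[OF S continuous_on_subset[OF F] e] by (metis subset_UNIV)
    have o: "orth u (\<lambda>p. of_real (g (circ p)) * 1)" by (rule orth_poly[OF u g(1) o1])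
    then have ig: "integrable torus (\<lambda>p. complex_of_real (g (circ p)) * of_real (u p))"
      by (intro integrable_cont_mult[OF u]) (simp add: orth_def)
    then have ig': "integrable torus (\<lambda>p. g (circ p) * u p)" using integrable_Re[OF ig] by simp
    have "(\<integral>p. complex_of_real (g (circ p) * u p) \<partial>torus) = 0"
      using o[unfolded orth_def, THEN conjunct2, rule_format, of 0] by simp
    then have 0: "(\<integral>p. g (circ p) * u p \<partial>torus) = 0" by (metis integral_complex_of_real of_real_eq_0_iff)
    have "\<bar>\<integral>p. F (circ p) * u p \<partial>torus\<bar> = \<bar>\<integral>p. (F (circ p) * u p - g (circ p) * u p) \<partial>torus\<bar>"
      using 0 iF' ig' by simp
    also have "\<dots> \<le> (\<integral>p. \<bar>F (circ p) * u p - g (circ p) * u p\<bar> \<partial>torus)"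
      by (rule integral_abs_bound)
    also have "\<dots> \<le> (\<integral>p. e * \<bar>u p\<bar> \<partial>torus)"
    proof (rule integral_mono)
      show "integrable torus (\<lambda>p. \<bar>F (circ p) * u p - g (circ p) * u p\<bar>)"
        using iF' ig' by (intro integrable_abs Bochner_Integration.integrable_diff)
      show "integrable torus (\<lambda>p. e * \<bar>u p\<bar>)" using u by (intro integrable_mult_right integrable_abs)
      fix p
      have "\<bar>F (circ p) * u p - g (circ p) * u p\<bar> = \<bar>F (circ p) - g (circ p)\<bar> * \<bar>u p\<bar>"
        by (simp add: abs_mult flip: left_diff_distrib)
      also have "\<dots> \<le> e * \<bar>u p\<bar>"
        by (rule mult_right_mono) (use g(2)[OF circS, of p] in auto)
      finally show "\<bar>F (circ p) * u p - g (circ p) * u p\<bar> \<le> e * \<bar>u p\<bar>" .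
    qed
    finally show ?thesis by simp
  qed
  note bd = this
  show ?thesis
  proof (rule ccontr)
    assume n: "(\<integral>p. F (circ p) * u p \<partial>torus) \<noteq> 0"
    define I where "I = (\<integral>p. \<bar>u p\<bar> \<partial>torus)"
    have "I \<ge> 0" by (simp add: I_def)
    \<comment> \<open>Chosen so that the bound just proved would read e * 2 (I + 1) \<le> e * I; the
      summand 1 covers the case \<open>I = 0\<close>.\<close>
    define e where "e = \<bar>\<integral>p. F (circ p) * u p \<partial>torus\<bar> / (2 * (I + 1))"
    have "e > 0" using n \<open>I \<ge> 0\<close> by (simp add: e_def)
    from bd[OF this] have "e * (2 * (I + 1)) \<le> e * I" using \<open>I \<ge> 0\<close> by (simp add: e_def I_def)
    then show False using \<open>e > 0\<close> \<open>I \<ge> 0\<close> by (simp add: algebra_simps add_pos_nonneg leD)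
      (smt (verit, best) mult_nonneg_nonneg)
  qed
qed

text \<open>\<open>circ\<close> identifies opposite edges of the closed cell. Separation of points
  is available on the half-open cell only, which still has full measure.\<close>

lemma AE_torus_half_open: "AE p in torus. p \<in> {0..<2 * pi} \<times> {0..<2 * pi}"
proof -
  have n: "negligible (cbox (0, 0) (2 * pi, 2 * pi) - box (0, 0) (2 * pi, 2 * pi))"
    for a b :: "real \<times> real"
    using negligible_frontier_interval by blast
  have "cell - box (0, 0) (2 * pi, 2 * pi) \<in> null_sets (lebesgue_on cell)"
    using n by (auto simp: cell_cbox null_sets_restrict_space negligible_iff_null_sets)
  moreover have "box (0, 0) (2 * pi, 2 * pi) \<subseteq> {0..<2 * pi} \<times> {0..<2 * pi}"
    by (auto simp: mem_box Basis_prod_def)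
  ultimately show ?thesis
    unfolding torus_cell by (intro AE_I'[of "cell - box (0, 0) (2 * pi, 2 * pi)"]) auto
qed

text \<open>Cut-offs of the distance to the image of \<open>K\<close> are continuous on C^2 and tend
  to the indicator of \<open>K\<close>: the image is closed because \<open>K\<close> is compact, and
  points outside \<open>K\<close> are kept away from it by injectivity of \<open>circ\<close> on the
  half-open cell. Dominated convergence concludes.\<close>

lemma integral_compact_zero:
  assumes u: "integrable torus u" and z: "\<And>k. fourier_coeff u k = 0"
    and K: "compact K" "K \<subseteq> {0..<2 * pi} \<times> {0..<2 * pi}"
  shows "(\<integral>p. indicator K p * u p \<partial>torus) = 0"
proof (cases "K = {}")
  case False
  let ?C = "circ ` K"
  have C: "closed ?C" "?C \<noteq> {}"
    using K(1) False by (auto intro!: compact_imp_closed compact_continuous_image continuous_circ)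
  define F where "F n z = max 0 (1 - real n * infdist z ?C)" for n z
  have cF: "continuous_on UNIV (F n)" for n
    unfolding F_def by (intro continuous_intros continuous_on_infdist)
  have zero: "(\<integral>p. F n (circ p) * u p \<partial>torus) = 0" for n
    by (rule integral_circ_zero[OF u z cF])
  have lim: "(\<lambda>n. F n (circ p)) \<longlonglongrightarrow> indicator K p"
    if p: "p \<in> {0..<2 * pi} \<times> {0..<2 * pi}" for p
  proof (cases "p \<in> K")
    case True
    then have "F n (circ p) = 1" for n by (simp add: F_def)
    then show ?thesis using True by simp
  next
    case False
    have "circ p \<notin> ?C"
      using False circ_inj[OF p] K(2) by blast
    then have pos: "infdist (circ p) ?C > 0"
      using C by (simp add: infdist_pos_not_in_closed)
    then obtain N where N: "1 < real N * infdist (circ p) ?C" by (metis reals_Archimedean3)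
    have "\<forall>\<^sub>F n in sequentially. F n (circ p) = 0"
      using eventually_ge_at_top[of N]
    proof eventually_elim
      case (elim n)
      have "real N * infdist (circ p) ?C \<le> real n * infdist (circ p) ?C"
        by (rule mult_right_mono) (use elim pos in auto)
      then show ?case using N by (simp add: F_def)
    qed
    then show ?thesis using False by (simp add: tendsto_eventually)
  qed
  have "(\<lambda>n. \<integral>p. F n (circ p) * u p \<partial>torus) \<longlonglongrightarrow> (\<integral>p. indicator K p * u p \<partial>torus)"
  proof (rule integral_dominated_convergence[where w = "\<lambda>p. \<bar>u p\<bar>"])
    have "K \<inter> cell \<in> sets lebesgue" using K(1) by (intro sets.Int cell_sets) (auto intro!: sets_completionI_sets borel_compact)
    then have "K \<inter> cell \<in> sets torus" by (simp add: torus_cell sets_restrict_space_iff)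
    then have "indicator (K \<inter> cell) \<in> borel_measurable torus" by (rule borel_measurable_indicator)
    then have "(indicator K :: _ \<Rightarrow> real) \<in> borel_measurable torus"
      by (rule measurable_cong[THEN iffD1, rotated]) (auto simp: indicator_def)
    then show "(\<lambda>p. indicator K p * u p) \<in> borel_measurable torus" using u by (intro borel_measurable_times) auto
    show "(\<lambda>p. F n (circ p) * u p) \<in> borel_measurable torus" for n
      by (intro borel_measurable_times borel_measurable_integrable[OF u] continuous_measurable_torus)
        (rule continuous_on_compose2[OF cF continuous_circ], simp)
    show "integrable torus (\<lambda>p. \<bar>u p\<bar>)" using u by (rule integrable_abs)
    show "AE p in torus. (\<lambda>n. F n (circ p) * u p) \<longlonglongrightarrow> indicator K p * u p"
      using AE_torus_half_open by eventually_elim (intro tendsto_intros lim)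
    have "0 \<le> F n z" "F n z \<le> 1" for n z by (auto simp: F_def infdist_nonneg)
    then show "AE p in torus. norm (F n (circ p) * u p) \<le> \<bar>u p\<bar>" for n
      by (intro AE_I2) (simp add: abs_mult mult_left_le_one_le)
  qed
  then show ?thesis using zero by (simp add: LIMSEQ_const_iff)
qed simp

text \<open>By inner regularity the set where \<open>u\<close> is positive is exhausted by closed
  subsets up to small measure. On such a subset \<open>u\<close> is positive with integral zero, so
  the subset is null. Applying this to a difference and to its negative gives uniqueness of
  coefficients.\<close>

lemma AE_nonpos_of_coeff_zero:
  assumes u: "integrable torus u" and z: "\<And>k. fourier_coeff u k = 0"
  shows "AE p in torus. u p \<le> 0"
proof -
  let ?Q = "{0..<2 * pi} \<times> {0..<2 * pi} :: (real \<times> real) set"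
  define P where "P = {p \<in> cell. u p > 0} \<inter> ?Q"
  have "{p \<in> space torus. u p > 0} \<in> sets torus" using u by (intro borel_measurable_less) auto
  then have "{p \<in> cell. u p > 0} \<in> sets lebesgue" by (simp add: torus_cell sets_restrict_space_iff)
  moreover have "?Q \<in> sets lebesgue"
    by (intro sets_completionI_sets) (auto intro!: borel_Times)
  ultimately have P: "P \<in> sets lebesgue" unfolding P_def by (rule sets.Int)
  have "emeasure lebesgue P \<le> e" if e: "e > 0" for e
  proof (cases "e = \<infinity>")
    case False
    then obtain r where r: "e = ennreal r" "0 < r" using e by (cases e) auto
    from sets_lebesgue_inner_closed[OF P this(2)] obtain T where T: "closed T" "T \<subseteq> P"
      "P - T \<in> lmeasurable" "emeasure lebesgue (P - T) < ennreal r" by blast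
    have TQ: "T \<subseteq> ?Q" "T \<subseteq> cell" using T(2) by (auto simp: P_def)
    have cT: "compact T"
      using T(1) TQ(2) bounded_subset[OF bounded_cbox] by (auto simp: compact_eq_bounded_closed cell_cbox)
    have TS: "T \<in> sets lebesgue" using T(1) by (simp add: borel_closed)
    then have Tt: "T \<in> sets torus" using TQ(2) by (simp add: torus_cell sets_restrict_space_iff)
    have "(\<integral>p. indicator T p * u p \<partial>torus) = 0"
      by (rule integral_compact_zero[OF u z cT TQ(1)])
    moreover have "integrable torus (\<lambda>p. indicator T p * u p)"
      using integrable_mult_indicator[OF Tt u] by simp
    moreover have "AE p in torus. 0 \<le> indicator T p * u p"
      by (rule AE_I2) (use T(2) in \<open>auto simp: indicator_def P_def\<close>)
    ultimately have "AE p in torus. indicator T p * u p = 0"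
      using integral_nonneg_eq_0_iff_AE by blast
    then have "AE p in torus. p \<notin> T"
    proof eventually_elim
      case (elim p) then show ?case using T(2) by (auto simp: indicator_def P_def split: if_splits)
    qed
    then have "T \<in> null_sets torus" using Tt by (simp add: AE_iff_null_sets)
    then have "T \<in> null_sets lebesgue" using TQ(2) TS
      by (simp add: torus_cell null_sets_restrict_space)
    then have "emeasure lebesgue T = 0" by (rule null_setsD1)
    moreover have "emeasure lebesgue P \<le> emeasure lebesgue T + emeasure lebesgue (P - T)"
      using emeasure_subadditive[of T lebesgue "P - T"] TS T(2,3) P
      by (simp add: Un_absorb1)
    ultimately show ?thesis using T(4) r by simp
  qed simp
  then have "emeasure lebesgue P \<le> 0" by (rule ennreal_le_epsilon) simp
  then have "P \<in> null_sets lebesgue" using P by auto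
  then have "P \<in> null_sets torus" by (auto simp: torus_cell null_sets_restrict_space P_def)
  then have "AE p in torus. p \<notin> P" by (rule AE_not_in)
  with AE_torus_half_open AE_space[of torus] show ?thesis
    by eventually_elim (auto simp: P_def not_less)
qed

lemma fourier_coeff_unique:
  assumes "integrable torus u" "integrable torus v" "\<And>k. fourier_coeff u k = fourier_coeff v k"
  shows "AE p in torus. u p = v p"
proof -
  have i: "integrable torus (\<lambda>p. u p - v p)" "integrable torus (\<lambda>p. v p - u p)" using assms by auto
  have "AE p in torus. u p - v p \<le> 0"
    by (rule AE_nonpos_of_coeff_zero[OF i(1)]) (simp add: fourier_coeff_diff assms)
  moreover have "AE p in torus. v p - u p \<le> 0"
    by (rule AE_nonpos_of_coeff_zero[OF i(2)]) (simp add: fourier_coeff_diff assms)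
  ultimately show ?thesis by eventually_elim simp
qed

subsection \<open>Parseval and Riesz-Fischer\<close>

lemma L2_measurable: "u \<in> L2_space \<Longrightarrow> u \<in> borel_measurable torus"
  by (simp add: L2_space_def)

lemma L2_sq_integrable: "u \<in> L2_space \<Longrightarrow> integrable torus (\<lambda>p. (u p)\<^sup>2)"
  by (simp add: L2_space_def)

lemma L2_mult_integrable:
  assumes "u \<in> L2_space" "v \<in> L2_space"
  shows "integrable torus (\<lambda>p. u p * v p)"
proof (rule Bochner_Integration.integrable_bound)
  show "integrable torus (\<lambda>p. (u p)\<^sup>2 + (v p)\<^sup>2)"
    using assms by (intro Bochner_Integration.integrable_add L2_sq_integrable)
  show "(\<lambda>p. u p * v p) \<in> borel_measurable torus"
    using assms[THEN L2_measurable] by (intro borel_measurable_times)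
  have "\<bar>a * b\<bar> \<le> a\<^sup>2 + b\<^sup>2" for a b :: real
  proof -
    have "0 \<le> (\<bar>a\<bar> - \<bar>b\<bar>)\<^sup>2" by simp
    then have "2 * (\<bar>a\<bar> * \<bar>b\<bar>) \<le> a\<^sup>2 + b\<^sup>2" by (simp add: power2_diff)
    moreover have "0 \<le> \<bar>a\<bar> * \<bar>b\<bar>" by simp
    ultimately show ?thesis unfolding abs_mult by linarith
  qed
  then show "AE p in torus. norm (u p * v p) \<le> norm ((u p)\<^sup>2 + (v p)\<^sup>2)"
    by (intro AE_I2) (metis abs_of_nonneg add_nonneg_nonneg real_norm_def zero_le_power2)
qed

lemma continuous_L2: "continuous_on UNIV u \<Longrightarrow> u \<in> L2_space"
  unfolding L2_space_def
  by (auto intro!: continuous_measurable_torus continuous_integrable_torus continuous_intros)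

lemma L2_integrable: "u \<in> L2_space \<Longrightarrow> integrable torus u"
  using L2_mult_integrable[OF _ continuous_L2[of "\<lambda>_. 1"]] by simp

lemma L2_cmult: "u \<in> L2_space \<Longrightarrow> (\<lambda>p. c * u p) \<in> L2_space"
  by (auto simp: L2_space_def power_mult_distrib intro!: borel_measurable_times)

lemma L2_add:
  assumes "u \<in> L2_space" "v \<in> L2_space"
  shows "(\<lambda>p. u p + v p) \<in> L2_space"
  using assms L2_mult_integrable[OF assms]
  by (auto simp: L2_space_def power2_sum mult.assoc intro!: borel_measurable_add)

lemma L2_minus: "u \<in> L2_space \<Longrightarrow> (\<lambda>p. - u p) \<in> L2_space"
  using L2_cmult[of u "-1"] by simp

lemma L2_diff: "u \<in> L2_space \<Longrightarrow> v \<in> L2_space \<Longrightarrow> (\<lambda>p. u p - v p) \<in> L2_space"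
  using L2_add[OF _ L2_minus, of u v] by simp

lemma integrable_ex_sum: "integrable torus (\<lambda>p. \<Sum>k\<in>F. c k * ex k p)"
  by (rule continuous_integrable_torus) (intro continuous_intros)

lemma fcc_sum_ex:
  assumes "finite F"
  shows "fcc (\<lambda>p. \<Sum>k\<in>F. c k * ex k p) l = (if l \<in> F then c l else 0)"
  using assms
proof (induction F)
  case (insert k F)
  have "fcc (\<lambda>p. \<Sum>k\<in>insert k F. c k * ex k p) l
      = fcc (\<lambda>p. c k * ex k p + (\<Sum>k\<in>F. c k * ex k p)) l"
    using insert.hyps by simp
  also have "\<dots> = c k * fcc (ex k) l + fcc (\<lambda>p. \<Sum>k\<in>F. c k * ex k p) l"
    by (subst fcc_add) (auto simp: fcc_cmult intro!: continuous_integrable_torus continuous_intros)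
  finally show ?case using insert by (auto simp: fcc_ex)
qed (simp add: fcc_def)

lemma integral_mult_sum_ex:
  assumes "integrable torus f" "finite F"
  shows "(\<integral>p. f p * cnj (\<Sum>k\<in>F. c k * ex k p) \<partial>torus) = of_real ((2 * pi)\<^sup>2) * (\<Sum>k\<in>F. cnj (c k) * fcc f k)"
proof -
  have "(\<integral>p. f p * cnj (\<Sum>k\<in>F. c k * ex k p) \<partial>torus) = (\<integral>p. (\<Sum>k\<in>F. cnj (c k) * (ex (- k) p * f p)) \<partial>torus)"
    by (rule Bochner_Integration.integral_cong) (auto simp: sum_distrib_left ex_minus mult_ac)
  also have "\<dots> = (\<Sum>k\<in>F. (\<integral>p. cnj (c k) * (ex (- k) p * f p) \<partial>torus))"
    by (rule Bochner_Integration.integral_sum) (intro integrable_mult_right integrable_ex_mult assms)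
  also have "\<dots> = (\<Sum>k\<in>F. of_real ((2 * pi)\<^sup>2) * (cnj (c k) * fcc f k))"
    by (simp add: fcc_def)
  finally show ?thesis by (simp add: sum_distrib_left)
qed

lemma integral_norm_sum_ex:
  assumes "finite F"
  shows "(\<integral>p. (cmod (\<Sum>k\<in>F. c k * ex k p))\<^sup>2 \<partial>torus) = (2 * pi)\<^sup>2 * (\<Sum>k\<in>F. (cmod (c k))\<^sup>2)"
proof -
  have "complex_of_real (\<integral>p. (cmod (\<Sum>k\<in>F. c k * ex k p))\<^sup>2 \<partial>torus)
      = (\<integral>p. (\<Sum>k\<in>F. c k * ex k p) * cnj (\<Sum>k\<in>F. c k * ex k p) \<partial>torus)"
    by (simp only: complex_norm_square[symmetric] integral_complex_of_real)
  also have "\<dots> = of_real ((2 * pi)\<^sup>2) * (\<Sum>k\<in>F. cnj (c k) * c k)"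
    using fcc_sum_ex[OF assms, of c]
    by (subst integral_mult_sum_ex[OF integrable_ex_sum assms]) simp
  also have "(\<Sum>k\<in>F. cnj (c k) * c k) = of_real (\<Sum>k\<in>F. (cmod (c k))\<^sup>2)"
    unfolding of_real_sum complex_norm_square by (simp only: mult.commute)
  finally show ?thesis by (simp only: of_real_mult[symmetric] of_real_eq_iff)
qed

text \<open>The mean square of the distance between \<open>u\<close> and its partial Fourier sum is
  nonnegative; expanding it gives the inequality.\<close>

lemma bessel:
  assumes u: "u \<in> L2_space" and F: "finite F"
  shows "(2 * pi)\<^sup>2 * (\<Sum>k\<in>F. (cmod (fourier_coeff u k))\<^sup>2) \<le> (\<integral>p. (u p)\<^sup>2 \<partial>torus)"
proof -
  define S where "S p = (\<Sum>k\<in>F. fourier_coeff u k * ex k p)" for p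
  have cS: "continuous_on UNIV S" unfolding S_def by (intro continuous_intros)
  define A where "A = (\<Sum>k\<in>F. (cmod (fourier_coeff u k))\<^sup>2)"
  have iu: "integrable torus (\<lambda>p. complex_of_real (u p))" by (rule integrable_of_real[OF L2_integrable[OF u]])
  have iuS: "integrable torus (\<lambda>p. of_real (u p) * cnj (S p))"
    using integrable_cont_mult[OF L2_integrable[OF u], of "\<lambda>p. cnj (S p)"] cS
    by (simp add: mult.commute continuous_on_cnj)
  have 1: "(\<integral>p. of_real (u p) * cnj (S p) \<partial>torus) = of_real ((2 * pi)\<^sup>2 * A)"
  proof -
    have "(\<integral>p. of_real (u p) * cnj (S p) \<partial>torus)
        = of_real ((2 * pi)\<^sup>2) * (\<Sum>k\<in>F. cnj (fourier_coeff u k) * fourier_coeff u k)"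
      unfolding S_def integral_mult_sum_ex[OF iu F] by (simp add: fourier_coeff_fcc)
    also have "(\<Sum>k\<in>F. cnj (fourier_coeff u k) * fourier_coeff u k) = of_real A"
      unfolding A_def of_real_sum complex_norm_square by (simp only: mult.commute)
    finally show ?thesis by simp
  qed
  have "0 \<le> (\<integral>p. (cmod (of_real (u p) - S p))\<^sup>2 \<partial>torus)" by simp
  also have "(\<lambda>p. (cmod (of_real (u p) - S p))\<^sup>2)
      = (\<lambda>p. (u p)\<^sup>2 - 2 * Re (of_real (u p) * cnj (S p)) + (cmod (S p))\<^sup>2)"
    by (rule ext) (simp add: cmod_power2 power2_diff algebra_simps)
  also have "(\<integral>p. (u p)\<^sup>2 - 2 * Re (of_real (u p) * cnj (S p)) + (cmod (S p))\<^sup>2 \<partial>torus)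
      = (\<integral>p. (u p)\<^sup>2 \<partial>torus) - 2 * (\<integral>p. Re (of_real (u p) * cnj (S p)) \<partial>torus) + (\<integral>p. (cmod (S p))\<^sup>2 \<partial>torus)"
  proof -
    have "integrable torus (\<lambda>p. (cmod (S p))\<^sup>2)"
      by (intro continuous_integrable_torus continuous_intros cS)
    then show ?thesis using integrable_Re[OF iuS] L2_sq_integrable[OF u] by simp
  qed
  also have "(\<integral>p. Re (of_real (u p) * cnj (S p)) \<partial>torus) = (2 * pi)\<^sup>2 * A"
    using integral_Re[OF iuS] 1 by simp
  also have "(\<integral>p. (cmod (S p))\<^sup>2 \<partial>torus) = (2 * pi)\<^sup>2 * A"
    unfolding S_def A_def by (rule integral_norm_sum_ex[OF F])
  finally show ?thesis by (simp add: A_def)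
qed

text \<open>The series is cut into finite blocks of rapidly decreasing mass, so that the L^1 norms
  of the blocks are summable and the block series converges absolutely almost everywhere.
  Coefficients pass to the sum by integration term by term, and the L^2 bound passes from the
  partial sums, which are trigonometric polynomials, by Fatou's lemma.\<close>

lemma riesz_fischer_aux:
  assumes c: "(\<lambda>k. (cmod (c k))\<^sup>2) summable_on UNIV"
  shows "\<exists>f. integrable torus f \<and> (\<forall>k. fcc f k = c k) \<and> integrable torus (\<lambda>p. (cmod (f p))\<^sup>2) \<and>
    (\<integral>p. (cmod (f p))\<^sup>2 \<partial>torus) \<le> (2 * pi)\<^sup>2 * (\<Sum>\<^sub>\<infinity>k. (cmod (c k))\<^sup>2)"
proof -
  let ?s = "\<lambda>k. (cmod (c k))\<^sup>2"
  define Z where "Z = infsum ?s UNIV"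
  have "\<exists>B. finite B \<and> (\<forall>F. finite F \<and> B \<subseteq> F \<longrightarrow> Z - sum ?s F < 1 / 4 ^ j)" for j :: nat
  proof -
    have "(sum ?s \<longlongrightarrow> Z) (finite_subsets_at_top UNIV)"
      using has_sum_infsum[OF c] by (simp add: has_sum_def Z_def)
    then have "\<forall>\<^sub>F F in finite_subsets_at_top UNIV. dist (sum ?s F) Z < 1 / 4 ^ j"
      by (rule tendstoD) simp
    then obtain B where "finite B" "\<And>F. finite F \<Longrightarrow> B \<subseteq> F \<Longrightarrow> dist (sum ?s F) Z < 1 / 4 ^ j"
      unfolding eventually_finite_subsets_at_top by auto
    then show ?thesis by (intro exI[of _ B]) (force simp: dist_real_def)
  qed
  then obtain B where B: "\<And>j. finite (B j)"
    "\<And>j F. finite F \<Longrightarrow> B j \<subseteq> F \<Longrightarrow> Z - sum ?s F < 1 / 4 ^ j" by metis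
  \<comment> \<open>\<open>B j\<close> leaves a tail below 4^-j; the added square guarantees that
    the union of all \<open>A j\<close> is the whole lattice.\<close>
  define A where "A j = B j \<union> ({- int j..int j} \<times> {- int j..int j})" for j
  define D where "D = disjointed A"
  define d where "d j p = (\<Sum>k\<in>D j. c k * ex k p)" for j p
  have fA: "finite (A j)" for j by (simp add: A_def B)
  have fD: "finite (D j)" for j unfolding D_def by (rule finite_subset[OF disjointed_subset fA])
  have dis: "disjoint_family D" unfolding D_def by (rule disjoint_family_disjointed)
  have cov: "\<exists>j. k \<in> D j" for k :: "int \<times> int"
  proof -
    have "k \<in> A (nat (max \<bar>fst k\<bar> \<bar>snd k\<bar>))" by (cases k) (auto simp: A_def)
    then have "k \<in> (\<Union>j. A j)" by blast
    then show ?thesis using UN_disjointed_eq[of A] by (auto simp: D_def)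
  qed
  \<comment> \<open>The block \<open>Suc j\<close> avoids \<open>A j\<close> and hence
    \<open>B j\<close>, so its mass is part of the tail with index \<open>j\<close>. Block 0 is not
    controlled, which accounts for the shifted indices below.\<close>
  have sD: "sum ?s (D (Suc j)) \<le> 1 / 4 ^ j" for j
  proof -
    let ?U = "\<Union>i<Suc j. A i"
    have fU: "finite ?U" by (simp add: fA)
    have "D (Suc j) \<inter> ?U = {}" by (auto simp: D_def disjointed_def)
    then have "sum ?s (D (Suc j)) + sum ?s ?U = sum ?s (D (Suc j) \<union> ?U)"
      using fD fU by (simp add: sum.union_disjoint)
    also have "\<dots> \<le> Z" unfolding Z_def using fD fU by (intro finite_sum_le_infsum c) auto
    also have "Z < 1 / 4 ^ j + sum ?s ?U" using B(2)[OF fU, of j] by (auto simp: A_def algebra_simps)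
    finally show ?thesis by simp
  qed
  have cd: "continuous_on UNIV (d j)" for j unfolding d_def by (intro continuous_intros)
  have id: "integrable torus (d j)" for j by (rule continuous_integrable_torus[OF cd])
  have nd: "(\<integral>p. norm (d (Suc j) p) \<partial>torus) \<le> (2 * pi)\<^sup>2 * (1 / 2) ^ j" for j
  proof -
    \<comment> \<open>The inequality 2 x \<le> 2^-j + 2^j x^2 converts a mass of order 4^-j into an
      L^1 norm of order 2^-j.\<close>
    have "(\<integral>p. norm (d (Suc j) p) \<partial>torus) \<le> (\<integral>p. (1 / 2 ^ j + 2 ^ j * (norm (d (Suc j) p))\<^sup>2) / 2 \<partial>torus)"
    proof (rule integral_mono)
      show "integrable torus (\<lambda>p. norm (d (Suc j) p))" using id by simp
      show "integrable torus (\<lambda>p. (1 / 2 ^ j + 2 ^ j * (norm (d (Suc j) p))\<^sup>2) / 2)"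
        by (intro continuous_integrable_torus continuous_intros cd) auto
      fix p
      have "0 \<le> (1 - 2 ^ j * norm (d (Suc j) p))\<^sup>2 / 2 ^ j" by simp
      also have "\<dots> = 1 / 2 ^ j - 2 * norm (d (Suc j) p) + 2 ^ j * (norm (d (Suc j) p))\<^sup>2"
        by (simp add: power2_eq_square field_simps)
      finally show "norm (d (Suc j) p) \<le> (1 / 2 ^ j + 2 ^ j * (norm (d (Suc j) p))\<^sup>2) / 2" by simp
    qed
    also have "\<dots> = ((2 * pi)\<^sup>2 * (1 / 2 ^ j) + 2 ^ j * (\<integral>p. (norm (d (Suc j) p))\<^sup>2 \<partial>torus)) / 2"
    proof -
      have "integrable torus (\<lambda>p. (norm (d (Suc j) p))\<^sup>2)"
        by (intro continuous_integrable_torus continuous_intros cd)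
      then show ?thesis using measure_torus by (simp add: integral_add)
    qed
    also have "(\<integral>p. (norm (d (Suc j) p))\<^sup>2 \<partial>torus) = (2 * pi)\<^sup>2 * sum ?s (D (Suc j))"
      unfolding d_def by (rule integral_norm_sum_ex[OF fD])
    also have "((2 * pi)\<^sup>2 * (1 / 2 ^ j) + 2 ^ j * ((2 * pi)\<^sup>2 * sum ?s (D (Suc j)))) / 2
        \<le> ((2 * pi)\<^sup>2 * (1 / 2 ^ j) + 2 ^ j * ((2 * pi)\<^sup>2 * (1 / 4 ^ j))) / 2"
      by (intro divide_right_mono add_left_mono mult_left_mono sD) auto
    also have "\<dots> = (2 * pi)\<^sup>2 * (1 / 2) ^ j"
    proof -
      have "(4::real) ^ j = 2 ^ j * 2 ^ j" by (simp flip: power_mult_distrib)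
      then show ?thesis by (simp add: power_one_over field_simps)
    qed
    finally show ?thesis .
  qed
  have sm: "summable (\<lambda>j. \<integral>p. norm (d j p) \<partial>torus)"
  proof (subst summable_Suc_iff[symmetric], rule summable_comparison_test')
    show "summable (\<lambda>j. (2 * pi)\<^sup>2 * (1 / 2 :: real) ^ j)" by (intro summable_mult summable_geometric) simp
    show "norm (\<integral>p. norm (d (Suc j) p) \<partial>torus) \<le> (2 * pi)\<^sup>2 * (1 / 2) ^ j" if "0 \<le> j" for j
      using nd[of j] by simp
  qed
  have ae: "AE p in torus. summable (\<lambda>j. norm (d j p))"
  proof -
    have "(\<integral>\<^sup>+p. (\<Sum>j. ennreal (norm (d j p))) \<partial>torus) = (\<Sum>j. \<integral>\<^sup>+p. ennreal (norm (d j p)) \<partial>torus)"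
      by (rule nn_integral_suminf) (use continuous_measurable_torus[OF cd] in auto)
    also have "\<dots> = (\<Sum>j. ennreal (\<integral>p. norm (d j p) \<partial>torus))"
      by (intro suminf_cong nn_integral_eq_integral) (use id in auto)
    also have "\<dots> < \<infinity>" using sm by (simp add: suminf_ennreal_eq[OF _ summable_sums] less_top[symmetric])
    finally have "AE p in torus. (\<Sum>j. ennreal (norm (d j p))) \<noteq> \<infinity>"
      by (intro nn_integral_noteq_infinite) (use continuous_measurable_torus[OF cd] in auto)
    then show ?thesis by eventually_elim (auto intro: summable_suminf_not_top)
  qed
  define f where "f p = (\<Sum>j. d j p)" for p
  have if': "integrable torus f" unfolding f_def by (rule integrable_suminf[OF id ae sm])
  have coef: "fcc f k = c k" for k
  proof -
    have id': "integrable torus (\<lambda>p. ex (- k) p * d j p)" for j by (rule integrable_ex_mult[OF id])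
    have "(\<lambda>j. \<integral>p. ex (- k) p * d j p \<partial>torus) sums (\<integral>p. (\<Sum>j. ex (- k) p * d j p) \<partial>torus)"
      by (rule sums_integral[OF id']) (use ae sm in \<open>auto simp: norm_mult\<close>)
    also have "(\<integral>p. (\<Sum>j. ex (- k) p * d j p) \<partial>torus) = (\<integral>p. ex (- k) p * f p \<partial>torus)"
    proof (rule integral_cong_AE)
      show "AE p in torus. (\<Sum>j. ex (- k) p * d j p) = ex (- k) p * f p"
        using ae by eventually_elim (simp add: f_def suminf_mult summable_norm_cancel)
      show "(\<lambda>p. \<Sum>j. ex (- k) p * d j p) \<in> borel_measurable torus"
        using integrable_suminf[OF id'] ae sm by (auto simp: norm_mult)
      show "(\<lambda>p. ex (- k) p * f p) \<in> borel_measurable torus"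
        using integrable_ex_mult[OF if'] by auto
    qed
    finally have "(\<lambda>j. \<integral>p. ex (- k) p * d j p \<partial>torus) sums (\<integral>p. ex (- k) p * f p \<partial>torus)" .
    from sums_divide[OF this, of "of_real ((2 * pi)\<^sup>2)"]
    have s1: "(\<lambda>j. fcc (d j) k) sums fcc f k" by (simp add: fcc_def)
    obtain j where j: "k \<in> D j" using cov by blast
    have "fcc (d i) k = (if i = j then c k else 0)" for i
    proof -
      have "k \<notin> D i" if "i \<noteq> j" using dis j that by (auto simp: disjoint_family_on_def)
      then show ?thesis using j unfolding d_def fcc_sum_ex[OF fD] by auto
    qed
    then have "(\<lambda>j. fcc (d j) k) sums c k" using sums_single[of j "\<lambda>_. c k"] by simp
    with s1 show ?thesis by (rule sums_unique2)
  qed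
  have mf: "f \<in> borel_measurable torus" using if' by auto
  have nn: "(\<integral>\<^sup>+p. ennreal ((cmod (f p))\<^sup>2) \<partial>torus) \<le> ennreal ((2 * pi)\<^sup>2 * Z)"
  proof -
    define S where "S n p = (\<Sum>j<n. d j p)" for n p
    have cS: "continuous_on UNIV (S n)" for n unfolding S_def by (intro continuous_intros cd)
    have mS: "(\<lambda>p. ennreal ((cmod (S n p))\<^sup>2)) \<in> borel_measurable torus" for n
      using continuous_measurable_torus[OF cS] by simp
    have "(\<integral>\<^sup>+p. ennreal ((cmod (f p))\<^sup>2) \<partial>torus) \<le> (\<integral>\<^sup>+p. liminf (\<lambda>n. ennreal ((cmod (S n p))\<^sup>2)) \<partial>torus)"
    proof (rule nn_integral_mono_AE)
      show "AE p in torus. ennreal ((cmod (f p))\<^sup>2) \<le> liminf (\<lambda>n. ennreal ((cmod (S n p))\<^sup>2))"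
        using ae
      proof eventually_elim
        case (elim p)
        then have "(\<lambda>n. S n p) \<longlonglongrightarrow> f p"
          unfolding S_def f_def by (rule summable_LIMSEQ[OF summable_norm_cancel])
        then have "(\<lambda>n. ennreal ((cmod (S n p))\<^sup>2)) \<longlonglongrightarrow> ennreal ((cmod (f p))\<^sup>2)"
          by (intro tendsto_ennrealI tendsto_power tendsto_norm)
        then show ?case using lim_imp_Liminf[OF sequentially_bot] by fastforce
      qed
    qed
    also have "\<dots> \<le> liminf (\<lambda>n. \<integral>\<^sup>+p. ennreal ((cmod (S n p))\<^sup>2) \<partial>torus)"
      by (rule nn_integral_liminf[OF mS])
    also have "\<dots> \<le> ennreal ((2 * pi)\<^sup>2 * Z)"
    proof (rule Liminf_le[OF sequentially_bot], rule always_eventually, rule allI)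
      fix n
      have S: "S n p = (\<Sum>k\<in>(\<Union>j<n. D j). c k * ex k p)" for p
        unfolding S_def d_def using dis fD
        by (subst sum.UNION_disjoint) (auto simp: disjoint_family_on_def)
      have fU: "finite (\<Union>j<n. D j)" using fD by simp
      have "(\<integral>\<^sup>+p. ennreal ((cmod (S n p))\<^sup>2) \<partial>torus) = ennreal (\<integral>p. (cmod (S n p))\<^sup>2 \<partial>torus)"
        by (rule nn_integral_eq_integral) (auto intro!: continuous_integrable_torus continuous_intros cS)
      also have "(\<integral>p. (cmod (S n p))\<^sup>2 \<partial>torus) = (2 * pi)\<^sup>2 * sum ?s (\<Union>j<n. D j)"
        unfolding S by (rule integral_norm_sum_ex[OF fU])
      also have "ennreal \<dots> \<le> ennreal ((2 * pi)\<^sup>2 * Z)"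
        unfolding Z_def by (intro ennreal_leI mult_left_mono finite_sum_le_infsum c fU) auto
      finally show "(\<integral>\<^sup>+p. ennreal ((cmod (S n p))\<^sup>2) \<partial>torus) \<le> ennreal ((2 * pi)\<^sup>2 * Z)" .
    qed
    finally show ?thesis .
  qed
  have i2: "integrable torus (\<lambda>p. (cmod (f p))\<^sup>2)"
    using nn mf by (intro integrableI_bounded) (auto intro: le_less_trans)
  have "(\<integral>p. (cmod (f p))\<^sup>2 \<partial>torus) \<le> (2 * pi)\<^sup>2 * Z"
  proof -
    have "ennreal (\<integral>p. (cmod (f p))\<^sup>2 \<partial>torus) \<le> ennreal ((2 * pi)\<^sup>2 * Z)"
      using nn_integral_eq_integral[OF i2] nn by simp
    moreover have "0 \<le> Z" unfolding Z_def by (rule infsum_nonneg) simp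
    ultimately show ?thesis by (subst (asm) ennreal_le_iff) auto
  qed
  with if' coef i2 show ?thesis unfolding Z_def by blast
qed

lemma hermD: "herm f \<Longrightarrow> f (- k) = cnj (f k)"
  unfolding herm_def by blast

text \<open>Taking the real part averages the family with its reflected conjugate, which leaves a
  Hermitian family unchanged, and does not increase the L^2 norm.\<close>

lemma riesz_fischer:
  assumes c: "(\<lambda>k. (cmod (c k))\<^sup>2) summable_on UNIV" and h: "herm c"
  shows "\<exists>u \<in> L2_space. (\<forall>k. fourier_coeff u k = c k) \<and>
    (\<integral>p. (u p)\<^sup>2 \<partial>torus) \<le> (2 * pi)\<^sup>2 * (\<Sum>\<^sub>\<infinity>k. (cmod (c k))\<^sup>2)"
proof -
  from riesz_fischer_aux[OF c] obtain f where f: "integrable torus f" "\<And>k. fcc f k = c k"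
    "integrable torus (\<lambda>p. (cmod (f p))\<^sup>2)"
    "(\<integral>p. (cmod (f p))\<^sup>2 \<partial>torus) \<le> (2 * pi)\<^sup>2 * (\<Sum>\<^sub>\<infinity>k. (cmod (c k))\<^sup>2)" by blast
  define u where "u p = Re (f p)" for p
  have um: "u \<in> borel_measurable torus" using f(1) integrable_Re unfolding u_def by blast
  have le: "(u p)\<^sup>2 \<le> (cmod (f p))\<^sup>2" for p
    unfolding u_def by (simp add: cmod_power2)
  have iu: "integrable torus (\<lambda>p. (u p)\<^sup>2)"
    by (rule Bochner_Integration.integrable_bound[OF f(3)]) (use um le in auto)
  have "u \<in> L2_space" using um iu by (simp add: L2_space_def)
  moreover have "fourier_coeff u k = c k" for k
  proof -
    have "complex_of_real (u p) = (1 / 2) * (f p + cnj (f p))" for p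
      by (simp add: u_def complex_add_cnj)
    then have "fourier_coeff u k = (1 / 2) * fcc (\<lambda>p. f p + cnj (f p)) k"
      unfolding fourier_coeff_fcc by (simp only: fcc_cmult)
    also have "fcc (\<lambda>p. f p + cnj (f p)) k = c k + cnj (c (- k))"
      using f by (subst fcc_add) (auto simp: fcc_cnj)
    also have "cnj (c (- k)) = c k" using hermD[OF h] by simp
    finally show ?thesis by simp
  qed
  moreover have "(\<integral>p. (u p)\<^sup>2 \<partial>torus) \<le> (2 * pi)\<^sup>2 * (\<Sum>\<^sub>\<infinity>k. (cmod (c k))\<^sup>2)"
    using integral_mono[OF iu f(3)] le f(4) by force
  ultimately show ?thesis by blast
qed

lemma L2_coeff_summable:
  assumes "u \<in> L2_space"
  shows "(\<lambda>k. (cmod (fourier_coeff u k))\<^sup>2) summable_on UNIV"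
proof (rule nonneg_bdd_above_summable_on)
  have "(\<Sum>k\<in>F. (cmod (fourier_coeff u k))\<^sup>2) \<le> (\<integral>p. (u p)\<^sup>2 \<partial>torus) / (2 * pi)\<^sup>2" if "finite F" for F
    using bessel[OF assms that] by (simp add: field_simps)
  then show "bdd_above (sum (\<lambda>k. (cmod (fourier_coeff u k))\<^sup>2) ` {F. F \<subseteq> UNIV \<and> finite F})"
    by (auto simp: bdd_above_def)
qed simp

text \<open>One inequality is Bessel's. For the other, Riesz-Fischer supplies a function with the
  same coefficients and the right bound, and uniqueness of coefficients identifies it with
  \<open>u\<close>.\<close>

lemma parseval:
  assumes u: "u \<in> L2_space"
  shows "(\<integral>p. (u p)\<^sup>2 \<partial>torus) = (2 * pi)\<^sup>2 * (\<Sum>\<^sub>\<infinity>k. (cmod (fourier_coeff u k))\<^sup>2)"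
proof (rule antisym)
  from riesz_fischer[OF L2_coeff_summable[OF u] herm_fourier_coeff] obtain v where
    v: "v \<in> L2_space" "\<And>k. fourier_coeff v k = fourier_coeff u k"
    "(\<integral>p. (v p)\<^sup>2 \<partial>torus) \<le> (2 * pi)\<^sup>2 * (\<Sum>\<^sub>\<infinity>k. (cmod (fourier_coeff u k))\<^sup>2)" by blast
  have "AE p in torus. v p = u p"
    by (rule fourier_coeff_unique[OF L2_integrable[OF v(1)] L2_integrable[OF u] v(2)])
  then have "(\<integral>p. (u p)\<^sup>2 \<partial>torus) = (\<integral>p. (v p)\<^sup>2 \<partial>torus)"
    using L2_measurable[OF u] L2_measurable[OF v(1)] by (intro integral_cong_AE) auto
  then show "(\<integral>p. (u p)\<^sup>2 \<partial>torus) \<le> (2 * pi)\<^sup>2 * (\<Sum>\<^sub>\<infinity>k. (cmod (fourier_coeff u k))\<^sup>2)"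
    using v(3) by simp
  have "(\<Sum>\<^sub>\<infinity>k. (cmod (fourier_coeff u k))\<^sup>2) \<le> (\<integral>p. (u p)\<^sup>2 \<partial>torus) / (2 * pi)\<^sup>2"
    by (rule infsum_le_finite_sums[OF L2_coeff_summable[OF u]])
      (use bessel[OF u] in \<open>simp add: field_simps\<close>)
  then show "(2 * pi)\<^sup>2 * (\<Sum>\<^sub>\<infinity>k. (cmod (fourier_coeff u k))\<^sup>2) \<le> (\<integral>p. (u p)\<^sup>2 \<partial>torus)"
    by (simp add: field_simps)
qed

lemma l2bd_fourier_coeff:
  assumes "u \<in> L2_space" shows "l2bd (fourier_coeff u) (L2_norm u / (2 * pi))"
proof (rule l2bdI[OF L2_coeff_summable[OF assms]])
  have "(L2_norm u)\<^sup>2 = (2 * pi)\<^sup>2 * (\<Sum>\<^sub>\<infinity>k. (cmod (fourier_coeff u k))\<^sup>2)"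
    by (simp only: parseval[OF assms, symmetric]) (simp add: L2_norm_def)
  then show "(\<Sum>\<^sub>\<infinity>k. (cmod (fourier_coeff u k))\<^sup>2) \<le> (L2_norm u / (2 * pi))\<^sup>2"
    by (simp add: power_divide power_mult_distrib)
  show "0 \<le> L2_norm u / (2 * pi)" by (simp add: L2_norm_def)
qed

lemma L2_norm_parseval:
  "u \<in> L2_space \<Longrightarrow> L2_norm u = 2 * pi * sqrt (\<Sum>\<^sub>\<infinity>k. (cmod (fourier_coeff u k))\<^sup>2)"
  by (simp add: L2_norm_def parseval real_sqrt_mult)

lemma herm_flip_infsum:
  assumes "herm f" "herm g"
  shows "cnj (\<Sum>\<^sub>\<infinity>k. f k * g (- k)) = (\<Sum>\<^sub>\<infinity>k. f k * g (- k))"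
proof -
  have "cnj (\<Sum>\<^sub>\<infinity>k. f k * g (- k)) = (\<Sum>\<^sub>\<infinity>k. f (- k) * g k)"
    using assms[THEN hermD] by (simp flip: infsum_cnj)
  also have "\<dots> = (\<Sum>\<^sub>\<infinity>k. f k * g (- k))"
    by (rule infsum_reindex_bij_witness[of _ uminus uminus]) auto
  finally show ?thesis .
qed

text \<open>Polarisation. The reflection \<open>- k\<close> replaces the conjugate, which keeps the
  pairing bilinear; \<open>herm_flip_infsum\<close> shows that the sum is real, so comparing real
  parts is enough.\<close>

lemma parseval_inner:
  assumes u: "u \<in> L2_space" and v: "v \<in> L2_space"
  shows "complex_of_real (\<integral>p. u p * v p \<partial>torus)
    = of_real ((2 * pi)\<^sup>2) * (\<Sum>\<^sub>\<infinity>k. fourier_coeff u k * fourier_coeff v (- k))"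
proof -
  let ?f = "fourier_coeff u" and ?g = "fourier_coeff v"
  have lf: "l2bd ?f (L2_norm u / (2 * pi))" and lg: "l2bd ?g (L2_norm v / (2 * pi))"
    by (auto intro: l2bd_fourier_coeff u v)
  have lg': "l2bd (\<lambda>k. ?g (- k)) (L2_norm v / (2 * pi))"
    by (rule l2bd_reindex[OF lg]) (simp add: inj_def)
  have sm: "(\<lambda>k. ?f k * ?g (- k)) summable_on UNIV" by (rule l2bd_prod_summable[OF lf lg'])
  have p: "(\<integral>p. (u p + v p)\<^sup>2 \<partial>torus) = (2 * pi)\<^sup>2 * (\<Sum>\<^sub>\<infinity>k. (cmod (?f k + ?g k))\<^sup>2)"
    by (simp add: parseval[OF L2_add[OF u v]] fourier_coeff_add L2_integrable u v)
  have m: "(\<integral>p. (u p - v p)\<^sup>2 \<partial>torus) = (2 * pi)\<^sup>2 * (\<Sum>\<^sub>\<infinity>k. (cmod (?f k - ?g k))\<^sup>2)"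
    by (simp add: parseval[OF L2_diff[OF u v]] fourier_coeff_diff L2_integrable u v)
  have "4 * (\<integral>p. u p * v p \<partial>torus) = (\<integral>p. 4 * (u p * v p) \<partial>torus)" by simp
  also have "\<dots> = (\<integral>p. (u p + v p)\<^sup>2 - (u p - v p)\<^sup>2 \<partial>torus)"
    by (rule Bochner_Integration.integral_cong) (auto simp: power2_sum power2_diff)
  also have "\<dots> = (\<integral>p. (u p + v p)\<^sup>2 \<partial>torus) - (\<integral>p. (u p - v p)\<^sup>2 \<partial>torus)"
    by (intro Bochner_Integration.integral_diff L2_sq_integrable L2_add L2_diff u v)
  also have "\<dots> = (2 * pi)\<^sup>2 * ((\<Sum>\<^sub>\<infinity>k. (cmod (?f k + ?g k))\<^sup>2) - (\<Sum>\<^sub>\<infinity>k. (cmod (?f k - ?g k))\<^sup>2))"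
    unfolding p m by (simp add: algebra_simps)
  also have "(\<Sum>\<^sub>\<infinity>k. (cmod (?f k + ?g k))\<^sup>2) - (\<Sum>\<^sub>\<infinity>k. (cmod (?f k - ?g k))\<^sup>2)
      = (\<Sum>\<^sub>\<infinity>k. (cmod (?f k + ?g k))\<^sup>2 - (cmod (?f k - ?g k))\<^sup>2)"
    by (rule infsum_diff[symmetric])
      (auto intro: l2bd_summable[OF l2bd_add[OF lf lg]] l2bd_summable[OF l2bd_diff[OF lf lg]])
  also have "\<dots> = (\<Sum>\<^sub>\<infinity>k. Re (4 * (?f k * ?g (- k))))"
  proof (rule infsum_cong)
    fix k
    have "?g (- k) = cnj (?g k)" by (rule hermD[OF herm_fourier_coeff])
    then show "(cmod (?f k + ?g k))\<^sup>2 - (cmod (?f k - ?g k))\<^sup>2 = Re (4 * (?f k * ?g (- k)))"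
      by (simp add: cmod_power2 power2_sum power2_diff algebra_simps)
  qed
  also have "\<dots> = 4 * Re (\<Sum>\<^sub>\<infinity>k. ?f k * ?g (- k))"
    by (subst infsum_Re) (use summable_on_cmult_right[OF sm, of 4] in \<open>auto simp: infsum_cmult_right'\<close>)
  finally have r: "(\<integral>p. u p * v p \<partial>torus) = (2 * pi)\<^sup>2 * Re (\<Sum>\<^sub>\<infinity>k. ?f k * ?g (- k))" by simp
  have "of_real (Re (\<Sum>\<^sub>\<infinity>k. ?f k * ?g (- k))) = (\<Sum>\<^sub>\<infinity>k. ?f k * ?g (- k))"
    using herm_flip_infsum[OF herm_fourier_coeff herm_fourier_coeff, of u v]
    by (simp add: complex_eq_iff)
  then show ?thesis unfolding r of_real_mult by simp
qed

text \<open>Parseval's identity for \<open>u\<close> with the real functions \<open>v cos (k p)\<close> and \<open>v sin (k p)\<close> gives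
  the two parts of the coefficient of \<open>u v\<close>.\<close>

lemma fourier_coeff_mult:
  assumes u: "u \<in> L2_space" and v: "v \<in> L2_space"
  shows "fourier_coeff (\<lambda>p. u p * v p) k = conv (fourier_coeff u) (fourier_coeff v) k"
proof -
  let ?f = "fourier_coeff u" and ?g = "fourier_coeff v"
  define c s where "c p = Re (ex k p)" and "s p = Im (ex k p)" for p
  have cc: "continuous_on UNIV c" "continuous_on UNIV s"
    unfolding c_def s_def by (intro continuous_intros)+
  have bd: "\<bar>c p\<bar> \<le> 1" "\<bar>s p\<bar> \<le> 1" for p
    using abs_Re_le_cmod[of "ex k p"] abs_Im_le_cmod[of "ex k p"] by (simp_all add: c_def s_def)
  have L: "(\<lambda>p. w p * v p) \<in> L2_space" if "continuous_on UNIV w" "\<And>p. \<bar>w p\<bar> \<le> 1" for w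
  proof -
    have m: "(\<lambda>p. w p * v p) \<in> borel_measurable torus"
      using continuous_measurable_torus[OF that(1)] L2_measurable[OF v] by (rule borel_measurable_times)
    have "integrable torus (\<lambda>p. (w p * v p)\<^sup>2)"
    proof (rule Bochner_Integration.integrable_bound[OF L2_sq_integrable[OF v]])
      show "(\<lambda>p. (w p * v p)\<^sup>2) \<in> borel_measurable torus" using m by simp
      have "(w p)\<^sup>2 \<le> 1" for p using that(2)[of p] by (simp add: abs_square_le_1)
      then show "AE p in torus. norm ((w p * v p)\<^sup>2) \<le> norm ((v p)\<^sup>2)"
        by (intro AE_I2) (simp add: power_mult_distrib mult_left_le_one_le)
    qed
    with m show ?thesis by (simp add: L2_space_def)
  qed
  have Lc: "(\<lambda>p. c p * v p) \<in> L2_space" and Ls: "(\<lambda>p. s p * v p) \<in> L2_space"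
    using L cc bd by auto
  have iv: "integrable torus (\<lambda>p. complex_of_real (v p))" by (rule integrable_of_real[OF L2_integrable[OF v]])
  have gc: "fourier_coeff (\<lambda>p. c p * v p) l = (1 / 2) * (?g (l - k) + ?g (l + k))" for l
  proof -
    have "complex_of_real (c p * v p) = (1 / 2) * (ex k p * of_real (v p) + ex (- k) p * of_real (v p))" for p
      by (simp add: c_def ex_minus complex_eq_iff)
    then show ?thesis unfolding fourier_coeff_fcc
      by (simp only: fcc_cmult fcc_add[OF integrable_ex_mult[OF iv] integrable_ex_mult[OF iv]] fcc_ex_mult) simp
  qed
  have gs: "fourier_coeff (\<lambda>p. s p * v p) l = (- \<i> / 2) * (?g (l - k) + (-1) * ?g (l + k))" for l
  proof -
    have "complex_of_real (s p * v p) = (- \<i> / 2) * (ex k p * of_real (v p) + (-1) * (ex (- k) p * of_real (v p)))" for p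
      by (simp add: s_def ex_minus complex_eq_iff)
    then show ?thesis unfolding fourier_coeff_fcc
      by (simp only: fcc_cmult fcc_add[OF integrable_ex_mult[OF iv] integrable_mult_right[OF integrable_ex_mult[OF iv]]] fcc_ex_mult) simp
  qed
  have iuc: "integrable torus (\<lambda>p. u p * (c p * v p))" and ius: "integrable torus (\<lambda>p. u p * (s p * v p))"
    by (intro L2_mult_integrable u Lc Ls)+
  have "fourier_coeff (\<lambda>p. u p * v p) k * of_real ((2 * pi)\<^sup>2)
      = (\<integral>p. ex (- k) p * of_real (u p * v p) \<partial>torus)"
    by (simp add: fourier_coeff_fcc fcc_def)
  also have "\<dots> = (\<integral>p. of_real (u p * (c p * v p)) + (- \<i>) * of_real (u p * (s p * v p)) \<partial>torus)"
    by (rule Bochner_Integration.integral_cong) (auto simp: c_def s_def ex_minus complex_eq_iff)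
  also have "\<dots> = (\<integral>p. of_real (u p * (c p * v p)) \<partial>torus) + (- \<i>) * (\<integral>p. of_real (u p * (s p * v p)) \<partial>torus)"
    using iuc[THEN integrable_of_real] ius[THEN integrable_of_real]
    by (subst Bochner_Integration.integral_add) (auto simp del: of_real_mult)
  also have "\<dots> = of_real (\<integral>p. u p * (c p * v p) \<partial>torus) + (- \<i>) * of_real (\<integral>p. u p * (s p * v p) \<partial>torus)"
    by (simp only: integral_complex_of_real)
  also have "\<dots> = of_real ((2 * pi)\<^sup>2) * ((\<Sum>\<^sub>\<infinity>l. ?f l * fourier_coeff (\<lambda>p. c p * v p) (- l))
      + (- \<i>) * (\<Sum>\<^sub>\<infinity>l. ?f l * fourier_coeff (\<lambda>p. s p * v p) (- l)))"
    unfolding parseval_inner[OF u Lc] parseval_inner[OF u Ls] by (simp only: distrib_left mult.left_commute)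
  also have "(\<Sum>\<^sub>\<infinity>l. ?f l * fourier_coeff (\<lambda>p. c p * v p) (- l))
      + (- \<i>) * (\<Sum>\<^sub>\<infinity>l. ?f l * fourier_coeff (\<lambda>p. s p * v p) (- l)) = conv ?f ?g k"
  proof -
    have lm: "l2bd (\<lambda>l. h (- l)) B" if "l2bd h B" for h :: "int \<times> int \<Rightarrow> complex" and B
      by (rule l2bd_reindex[OF that]) (simp add: inj_def)
    have s1: "(\<lambda>l. ?f l * fourier_coeff (\<lambda>p. c p * v p) (- l)) summable_on UNIV"
      by (rule l2bd_prod_summable[OF l2bd_fourier_coeff[OF u] lm[OF l2bd_fourier_coeff[OF Lc]]])
    have s2: "(\<lambda>l. (- \<i>) * (?f l * fourier_coeff (\<lambda>p. s p * v p) (- l))) summable_on UNIV"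
      by (intro summable_on_cmult_right l2bd_prod_summable[OF l2bd_fourier_coeff[OF u] lm[OF l2bd_fourier_coeff[OF Ls]]])
    have "(\<Sum>\<^sub>\<infinity>l. ?f l * fourier_coeff (\<lambda>p. c p * v p) (- l))
      + (- \<i>) * (\<Sum>\<^sub>\<infinity>l. ?f l * fourier_coeff (\<lambda>p. s p * v p) (- l))
      = (\<Sum>\<^sub>\<infinity>l. ?f l * fourier_coeff (\<lambda>p. c p * v p) (- l) + (- \<i>) * (?f l * fourier_coeff (\<lambda>p. s p * v p) (- l)))"
      by (simp only: infsum_add[OF s1 s2] infsum_cmult_right')
    also have "\<dots> = conv ?f ?g k"
      unfolding conv_def
    proof (rule infsum_cong)
      fix l
      have [simp]: "- l - k = - k - l" "- l + k = k - l" by simp_all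
      show "?f l * fourier_coeff (\<lambda>p. c p * v p) (- l) + (- \<i>) * (?f l * fourier_coeff (\<lambda>p. s p * v p) (- l))
          = ?f l * ?g (k - l)"
        unfolding gc gs by (simp add: algebra_simps)
    qed
    finally show ?thesis .
  qed
  finally show ?thesis by simp
qed

section \<open>The mild form of the equation in Fourier space\<close>

subsection \<open>The nonlinearity\<close>

definition nl :: "(int \<times> int \<Rightarrow> complex) \<Rightarrow> int \<times> int \<Rightarrow> complex" where
  "nl f k = \<i> / 2 * of_int (fst k) * conv f f k"

lemma cmod_nl_le: "cmod (nl f k) \<le> jb k * cmod (conv f f k)"
proof -
  have "cmod (nl f k) = \<bar>of_int (fst k)\<bar> / 2 * cmod (conv f f k)"
    by (simp add: nl_def norm_mult)
  also have "\<dots> \<le> jb k * cmod (conv f f k)"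
    using fst_le_jb[of k] by (intro mult_right_mono) auto
  finally show ?thesis .
qed

lemma nl_bound: "l2bd f A \<Longrightarrow> cmod (nl f k) \<le> jb k * A\<^sup>2"
  using order_trans[OF cmod_nl_le mult_left_mono[OF conv_bound[of f A f A]]]
  by (simp add: jb_nonneg power2_eq_square)

lemma nl_diff_bound:
  assumes "l2bd f A" "l2bd g A'" "l2bd (\<lambda>k. f k - g k) B"
  shows "cmod (nl f k - nl g k) \<le> jb k * (B * (A + A'))"
proof -
  have eq: "nl f k - nl g k = \<i> / 2 * of_int (fst k) * (conv f f k - conv g g k)"
    by (simp add: nl_def algebra_simps)
  have "cmod (nl f k - nl g k) = \<bar>of_int (fst k)\<bar> / 2 * cmod (conv f f k - conv g g k)"
    unfolding eq by (simp add: norm_mult)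
  also have "\<dots> \<le> jb k * (B * (A + A'))"
    using fst_le_jb[of k] by (intro mult_mono conv_diff_bound assms) (auto simp: jb_nonneg)
  finally show ?thesis .
qed

lemma nl_tame:
  assumes "l2bd (\<lambda>k. of_real (jb k ^ s) * f k) A" "l2bd f B"
  shows "jb k ^ s * cmod (nl f k) \<le> jb k * (2 ^ s * (2 * A * B))"
proof -
  have "jb k ^ s * cmod (nl f k) \<le> jb k ^ s * (jb k * cmod (conv f f k))"
    by (intro mult_left_mono cmod_nl_le) (simp add: jb_nonneg)
  also have "\<dots> = jb k * (jb k ^ s * cmod (conv f f k))" by simp
  also have "\<dots> \<le> jb k * (2 ^ s * (A * B + B * A))"
    by (intro mult_left_mono conv_tame assms jb_nonneg)
  finally show ?thesis by (simp add: algebra_simps)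
qed

lemma nl_scale: "nl (\<lambda>k. c * f k) k = c\<^sup>2 * nl f k"
  by (simp add: nl_def conv_scale)

lemma conv_flip: "conv (\<lambda>k. cnj (f (- k))) (\<lambda>k. cnj (f (- k))) k = cnj (conv f f (- k))"
proof -
  have "conv (\<lambda>k. cnj (f (- k))) (\<lambda>k. cnj (f (- k))) k = (\<Sum>\<^sub>\<infinity>l. cnj (f l * f (- k - l)))"
    unfolding conv_def
    by (rule infsum_reindex_bij_witness[of _ uminus uminus]) (auto simp: algebra_simps)
  then show ?thesis by (simp only: conv_def infsum_cnj)
qed

lemma nl_flip: "nl (\<lambda>k. cnj (f (- k))) k = cnj (nl f (- k))"
  by (simp add: nl_def conv_flip)

lemma nl_herm: "herm f \<Longrightarrow> nl f (- k) = cnj (nl f k)"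
  using nl_flip[of f "- k"] hermD[of f] by simp

text \<open>Over the triples \<open>p + q + r = 0\<close> the sum of \<open>p\<^sub>1 f p f q f r\<close> is symmetrised to
  \<open>(p\<^sub>1 + q\<^sub>1 + r\<^sub>1) / 3\<close>, which vanishes; this is the conservation of energy.\<close>

lemma nl_orthogonal:
  assumes h: "herm f" and f2: "l2bd (\<lambda>k. of_real ((jb k)\<^sup>2) * f k) A"
  shows "(\<Sum>\<^sub>\<infinity>k. cnj (f k) * nl f k) = 0"
proof -
  have f0: "l2bd f A"
  proof (rule l2bd_mono[OF f2])
    fix k
    have "1 * cmod (f k) \<le> (jb k)\<^sup>2 * cmod (f k)"
      using jb_ge_1[of k] by (intro mult_right_mono) (auto simp: one_le_power)
    then show "cmod (f k) \<le> cmod (of_real ((jb k)\<^sup>2) * f k)" by (simp add: norm_mult norm_power)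
  qed simp
  define a where "a k = complex_of_real (cmod (f k))" for k
  have a0: "l2bd a A" by (rule l2bd_mono[OF f0]) (simp_all add: a_def)
  have a2: "l2bd (\<lambda>k. of_real ((jb k)\<^sup>2) * a k) A"
    by (rule l2bd_mono[OF f2]) (simp_all add: a_def norm_mult)
  \<comment> \<open>The three frequencies \<open>- k\<close>, \<open>l\<close> and
    \<open>k - l\<close> add up to zero, and \<open>- k\<close> is the distinguished one.\<close>
  define t where "t kl = of_int (fst (fst kl)) * (f (- fst kl) * (f (snd kl) * f (fst kl - snd kl)))"
    for kl :: "(int \<times> int) \<times> (int \<times> int)"
  have inner: "(\<lambda>l. cmod (t (k, l))) summable_on UNIV" for k
    using summable_on_cmult_right[OF conv_abs_summable[OF f0 f0, of k], of "cmod (of_int (fst k) * f (- k))"]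
    by (simp add: t_def norm_mult mult_ac)
  \<comment> \<open>The constant is \<open>conv_tame\<close> with \<open>s = 2\<close>, that is 2^2
    (A A + A A). The weight J^2 goes to the factor f(-k) and absorbs the derivative; the remaining
    J^-2 makes the outer sum converge.\<close>
  have innersum: "(\<Sum>\<^sub>\<infinity>l. cmod (t (k, l))) \<le> cmod (jb k ^ 2 * f (- k) * (8 * A\<^sup>2 / (jb k)\<^sup>2))" for k
  proof -
    have "(\<Sum>\<^sub>\<infinity>l. cmod (t (k, l))) = cmod (of_int (fst k) * f (- k)) * (\<Sum>\<^sub>\<infinity>l. cmod (f l * f (k - l)))"
      by (simp add: t_def norm_mult mult.assoc infsum_cmult_right')
    also have "(\<Sum>\<^sub>\<infinity>l. cmod (f l * f (k - l))) = cmod (conv a a k)"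
    proof -
      have "conv a a k = of_real (\<Sum>\<^sub>\<infinity>l. cmod (f l * f (k - l)))"
        unfolding conv_def a_def of_real_mult[symmetric] norm_mult[symmetric]
        by (rule infsumI[OF has_sum_of_real[OF has_sum_infsum[OF conv_abs_summable[OF f0 f0]]]])
      then show ?thesis by (simp add: infsum_nonneg)
    qed
    also have "cmod (of_int (fst k) * f (- k)) * cmod (conv a a k)
        \<le> (jb k ^ 2 * cmod (f (- k))) * (8 * A\<^sup>2 / (jb k)\<^sup>2)"
    proof (rule mult_mono)
      have "\<bar>of_int (fst k)\<bar> \<le> jb k ^ 2"
        using fst_le_jb[of k] self_le_power[OF jb_ge_1, of 2 k] by simp
      then show "cmod (of_int (fst k) * f (- k)) \<le> jb k ^ 2 * cmod (f (- k))"
        by (simp add: norm_mult mult_right_mono)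
      show "cmod (conv a a k) \<le> 8 * A\<^sup>2 / (jb k)\<^sup>2"
        using conv_tame[OF a2 a2 a0 a0, of k] jb_pos[of k]
        by (simp add: field_simps power2_eq_square)
    qed (auto simp: jb_nonneg)
    finally show ?thesis using jb_pos[of k] by (simp add: norm_mult norm_power norm_divide jb_nonneg abs_of_nonneg)
  qed
  have bdd: "l2bd (\<lambda>k. of_real (8 * A\<^sup>2) / (of_real (jb k))\<^sup>2) (8 * A\<^sup>2 * sqrt jsum)"
    by (rule l2bd_decay) (auto simp: norm_divide norm_power jb_nonneg norm_mult)
  have outer: "(\<lambda>k. \<Sum>\<^sub>\<infinity>l. cmod (t (k, l))) summable_on UNIV"
  proof (rule summable_on_comparison_test)
    have "l2bd (\<lambda>k. of_real ((jb (- k))\<^sup>2) * f (- k)) A"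
      by (rule l2bd_reindex[OF f2]) (simp add: inj_def)
    from l2bd_prod_abs_summable[OF this bdd]
    show "(\<lambda>k. cmod (jb k ^ 2 * f (- k) * (8 * A\<^sup>2 / (jb k)\<^sup>2))) summable_on UNIV"
      by simp
    show "(\<Sum>\<^sub>\<infinity>l. cmod (t (k, l))) \<le> cmod (jb k ^ 2 * f (- k) * (8 * A\<^sup>2 / (jb k)\<^sup>2))" for k
      by (rule innersum)
  qed (simp add: infsum_nonneg)
  have "(\<lambda>kl. cmod (t kl)) summable_on (UNIV \<times> UNIV)"
    unfolding Infinite_Sum.abs_summable_on_Sigma_iff
    using inner outer by (auto simp: infsum_nonneg abs_of_nonneg)
  then have st: "t summable_on UNIV" by (simp add: abs_summable_summable)
  \<comment> \<open>The two bijections let each of the other frequencies take the distinguished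
    place. The product of the three coefficients is unchanged while the prefactors become the first
    components of \<open>- l\<close> and \<open>l - k\<close>, which cancel that of
    \<open>k\<close>.\<close>
  have r1: "(\<lambda>kl. t (- snd kl, - fst kl)) summable_on UNIV"
    "(\<Sum>\<^sub>\<infinity>kl. t (- snd kl, - fst kl)) = infsum t UNIV"
  proof -
    have b: "bij_betw (\<lambda>kl. (- snd kl, - fst kl)) UNIV (UNIV :: ((int \<times> int) \<times> (int \<times> int)) set)"
      by (rule bij_betwI[of _ _ _ "\<lambda>kl. (- snd kl, - fst kl)"]) auto
    show "(\<lambda>kl. t (- snd kl, - fst kl)) summable_on UNIV"
      using summable_on_reindex_bij_betw[OF b, of t] st by simp
    show "(\<Sum>\<^sub>\<infinity>kl. t (- snd kl, - fst kl)) = infsum t UNIV"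
      using infsum_reindex_bij_betw[OF b, of t] by simp
  qed
  have r2: "(\<lambda>kl. t (snd kl - fst kl, snd kl)) summable_on UNIV"
    "(\<Sum>\<^sub>\<infinity>kl. t (snd kl - fst kl, snd kl)) = infsum t UNIV"
  proof -
    have b: "bij_betw (\<lambda>kl. (snd kl - fst kl, snd kl)) UNIV (UNIV :: ((int \<times> int) \<times> (int \<times> int)) set)"
      by (rule bij_betwI[of _ _ _ "\<lambda>kl. (snd kl - fst kl, snd kl)"]) auto
    show "(\<lambda>kl. t (snd kl - fst kl, snd kl)) summable_on UNIV"
      using summable_on_reindex_bij_betw[OF b, of t] st by simp
    show "(\<Sum>\<^sub>\<infinity>kl. t (snd kl - fst kl, snd kl)) = infsum t UNIV"
      using infsum_reindex_bij_betw[OF b, of t] by simp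
  qed
  have "3 * infsum t UNIV = (\<Sum>\<^sub>\<infinity>kl. t kl + t (- snd kl, - fst kl) + t (snd kl - fst kl, snd kl))"
    by (simp only: infsum_add[OF summable_on_add[OF st r1(1)] r2(1)] infsum_add[OF st r1(1)] r1(2) r2(2))
      simp
  also have "\<dots> = 0"
  proof (rule infsum_0)
    fix kl :: "(int \<times> int) \<times> (int \<times> int)"
    obtain k l where kl: "kl = (k, l)" by (cases kl)
    have [simp]: "- (l - k) = k - l" "- l - - k = k - l" "l - k - l = - k" by simp_all
    show "t kl + t (- snd kl, - fst kl) + t (snd kl - fst kl, snd kl) = 0"
      unfolding kl t_def by (simp add: algebra_simps)
  qed
  finally have S0: "infsum t UNIV = 0" by simp
  have "(\<Sum>\<^sub>\<infinity>k. cnj (f k) * nl f k) = (\<Sum>\<^sub>\<infinity>k. \<i> / 2 * (\<Sum>\<^sub>\<infinity>l. t (k, l)))"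
  proof (rule infsum_cong)
    fix k
    have "(\<Sum>\<^sub>\<infinity>l. t (k, l)) = of_int (fst k) * (f (- k) * conv f f k)"
      by (simp add: t_def conv_def infsum_cmult_right')
    then show "cnj (f k) * nl f k = \<i> / 2 * (\<Sum>\<^sub>\<infinity>l. t (k, l))"
      using hermD[OF h, of k] by (simp add: nl_def)
  qed
  also have "\<dots> = \<i> / 2 * infsum t UNIV"
    using infsum_Sigma_banach[of t UNIV "\<lambda>_. UNIV"] st
    by (simp only: infsum_cmult_right' UNIV_Times_UNIV)
  finally show ?thesis using S0 by simp
qed

subsection \<open>Continuity of families with a summable majorant\<close>

lemma continuous_on_infsum:
  fixes g :: "'i \<Rightarrow> 'a::topological_space \<Rightarrow> 'b::banach"
  assumes "\<And>k. continuous_on S (g k)" "\<And>k t. t \<in> S \<Longrightarrow> norm (g k t) \<le> D k" "D summable_on UNIV"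
  shows "continuous_on S (\<lambda>t. \<Sum>\<^sub>\<infinity>k. g k t)"
proof (rule uniform_limit_theorem[OF _ Weierstrass_m_test_general[of UNIV S g D]])
  show "\<forall>\<^sub>F n in finite_subsets_at_top UNIV. continuous_on S (\<lambda>t. \<Sum>x\<in>n. g x t)"
    by (intro always_eventually allI continuous_intros assms)
qed (use assms in auto)

lemma square_le_sum_squares: "(cmod (a - b))\<^sup>2 \<le> 2 * (cmod a)\<^sup>2 + 2 * (cmod b)\<^sup>2"
proof -
  have "(cmod (a - b))\<^sup>2 \<le> (cmod a + cmod b)\<^sup>2"
    by (intro power_mono norm_triangle_ineq4) simp
  moreover have "0 \<le> (cmod a - cmod b)\<^sup>2" by simp
  ultimately show ?thesis by (simp add: power2_sum power2_diff)
qed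

text \<open>Continuity of each coordinate becomes continuity in norm once a single summable majorant
  of the squares serves all times.\<close>

lemma infsum_square_tendsto:
  fixes g :: "'a::metric_space \<Rightarrow> 'i \<Rightarrow> complex"
  assumes "\<And>k. continuous_on S (\<lambda>t. g t k)" "\<And>k t. t \<in> S \<Longrightarrow> (cmod (g t k))\<^sup>2 \<le> D k"
    "D summable_on UNIV" "t0 \<in> S"
  shows "((\<lambda>t. \<Sum>\<^sub>\<infinity>k. (cmod (g t k - g t0 k))\<^sup>2) \<longlongrightarrow> 0) (at t0 within S)"
proof -
  have "continuous_on S (\<lambda>t. \<Sum>\<^sub>\<infinity>k. (cmod (g t k - g t0 k))\<^sup>2)"
  proof (rule continuous_on_infsum[where D = "\<lambda>k. 4 * D k"])
    show "continuous_on S (\<lambda>t. (cmod (g t k - g t0 k))\<^sup>2)" for k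
      by (intro continuous_intros assms)
    show "norm ((cmod (g t k - g t0 k))\<^sup>2) \<le> 4 * D k" if "t \<in> S" for k t
      using square_le_sum_squares[of "g t k" "g t0 k"] assms(2)[OF that, of k] assms(2)[OF assms(4), of k]
      by simp
  qed (intro summable_on_cmult_right assms)
  then have "((\<lambda>t. \<Sum>\<^sub>\<infinity>k. (cmod (g t k - g t0 k))\<^sup>2) \<longlongrightarrow> (\<Sum>\<^sub>\<infinity>k. (cmod (g t0 k - g t0 k))\<^sup>2)) (at t0 within S)"
    using assms(4) by (auto simp: continuous_on_def)
  then show ?thesis by simp
qed

lemma continuous_on_l2I:
  fixes x :: "'a::metric_space \<Rightarrow> l2"
  assumes "\<And>k. continuous_on S (\<lambda>t. cf (x t) k)" "\<And>k t. t \<in> S \<Longrightarrow> (cmod (cf (x t) k))\<^sup>2 \<le> D k"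
    "D summable_on UNIV"
  shows "continuous_on S x"
  unfolding continuous_on_def
proof
  fix t0 assume t0: "t0 \<in> S"
  have "((\<lambda>t. norm (x t - x t0)) \<longlongrightarrow> sqrt 0) (at t0 within S)"
    unfolding norm_l2_def cf_diff
    by (rule tendsto_real_sqrt[OF infsum_square_tendsto[OF assms t0]])
  then show "(x \<longlongrightarrow> x t0) (at t0 within S)"
    by (simp add: Lim_null[of x] tendsto_norm_zero_iff)
qed

lemma continuous_on_cf: "continuous_on S x \<Longrightarrow> continuous_on S (\<lambda>t. cf (x t) k)"
proof -
  have "bounded_linear (\<lambda>x. cf x k)"
    by (rule bounded_linear_intro[of _ 1]) (auto simp: scaleR_conv_of_real cmod_cf_le)
  then show "continuous_on S x \<Longrightarrow> continuous_on S (\<lambda>t. cf (x t) k)"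
    by (rule bounded_linear.continuous_on)
qed

subsection \<open>Duhamel integrals\<close>

lemma exp_integral_le:
  assumes ab: "a \<le> b" and g: "continuous_on {a..b} g" and m: "0 < m"
    and G: "\<And>s. s \<in> {a..b} \<Longrightarrow> cmod (g s) \<le> G * exp (m * s)"
  shows "cmod (integral {a..b} g) \<le> G * exp (m * b) / m"
proof -
  have "0 \<le> G * exp (m * a)" using order_trans[OF norm_ge_zero G[of a]] ab by simp
  then have G0: "0 \<le> G" by (simp add: zero_le_mult_iff)
  have "((\<lambda>s. G * exp (m * s)) has_integral G * exp (m * b) / m - G * exp (m * a) / m) {a..b}"
    using m by (intro fundamental_theorem_of_calculus ab)
      (auto intro!: derivative_eq_intros simp: has_real_derivative_iff_has_vector_derivative[symmetric])
  then have i: "(\<lambda>s. G * exp (m * s)) integrable_on {a..b}"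
    "integral {a..b} (\<lambda>s. G * exp (m * s)) = G * exp (m * b) / m - G * exp (m * a) / m"
    by (auto simp: has_integral_iff)
  have "cmod (integral {a..b} g) \<le> integral {a..b} (\<lambda>s. G * exp (m * s))"
    by (rule integral_norm_bound_integral[OF integrable_continuous_real[OF g] i(1) G])
  also have "\<dots> \<le> G * exp (m * b) / m" using i(2) G0 m by simp
  finally show ?thesis .
qed

text \<open>The integral of exp(- \<sigma> (t - s)) g(s), with the factor in t pulled out: it is
  then an exponential times an antiderivative, and the product rule gives its derivative.\<close>

definition duh :: "real \<Rightarrow> (real \<Rightarrow> complex) \<Rightarrow> real \<Rightarrow> complex" where
  "duh \<sigma> g t = of_real (exp (- \<sigma> * t)) * integral {0..t} (\<lambda>s. of_real (exp (\<sigma> * s)) * g s)"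

text \<open>The growth allowance \<open>K\<close> makes the rate \<open>\<sigma> + K\<close>
  positive even where \<sigma> is negative, so the integral is dominated by its right end. If the
  segment ends before t, the gap survives as exponential decay; with b = t there is none, and only
  the division by the rate is gained.\<close>

lemma duh_segment:
  assumes ab: "a \<le> b" and g: "continuous_on {a..b} g" and m: "0 < \<sigma> + K"
    and G: "\<And>s. s \<in> {a..b} \<Longrightarrow> cmod (g s) \<le> G * exp (K * s)"
  shows "cmod (of_real (exp (- \<sigma> * t)) * integral {a..b} (\<lambda>s. of_real (exp (\<sigma> * s)) * g s))
    \<le> G * exp (K * t) * exp (- (\<sigma> + K) * (t - b)) / (\<sigma> + K)"
proof -
  have "cmod (integral {a..b} (\<lambda>s. of_real (exp (\<sigma> * s)) * g s)) \<le> G * exp ((\<sigma> + K) * b) / (\<sigma> + K)"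
  proof (rule exp_integral_le[OF ab _ m])
    show "continuous_on {a..b} (\<lambda>s. of_real (exp (\<sigma> * s)) * g s)" by (intro continuous_intros g)
    fix s assume s: "s \<in> {a..b}"
    have "cmod (of_real (exp (\<sigma> * s)) * g s) \<le> exp (\<sigma> * s) * (G * exp (K * s))"
      by (simp add: norm_mult G[OF s])
    also have "\<dots> = G * exp ((\<sigma> + K) * s)" by (simp add: exp_add distrib_right)
    finally show "cmod (of_real (exp (\<sigma> * s)) * g s) \<le> G * exp ((\<sigma> + K) * s)" .
  qed
  then have "cmod (of_real (exp (- \<sigma> * t)) * integral {a..b} (\<lambda>s. of_real (exp (\<sigma> * s)) * g s))
      \<le> exp (- \<sigma> * t) * (G * exp ((\<sigma> + K) * b) / (\<sigma> + K))"
    unfolding norm_mult norm_of_real abs_exp_cancel by (rule mult_left_mono) simp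
  also have "\<dots> = G * (exp (- \<sigma> * t) * exp ((\<sigma> + K) * b)) / (\<sigma> + K)" by simp
  also have "exp (- \<sigma> * t) * exp ((\<sigma> + K) * b) = exp (K * t) * exp (- (\<sigma> + K) * (t - b))"
    by (simp add: algebra_simps flip: exp_add)
  finally show ?thesis by simp
qed

lemma duh_bound:
  assumes "0 \<le> t" "continuous_on {0..t} g" "0 < \<sigma> + K"
    "\<And>s. s \<in> {0..t} \<Longrightarrow> cmod (g s) \<le> G * exp (K * s)"
  shows "cmod (duh \<sigma> g t) \<le> G * exp (K * t) / (\<sigma> + K)"
  using duh_segment[OF assms, of t] by (simp add: duh_def)

lemma duh_diff:
  assumes "continuous_on {0..t} g" "continuous_on {0..t} h"
  shows "duh \<sigma> g t - duh \<sigma> h t = duh \<sigma> (\<lambda>s. g s - h s) t"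
proof -
  have "(\<lambda>s. of_real (exp (\<sigma> * s)) * g s) integrable_on {0..t}"
    "(\<lambda>s. of_real (exp (\<sigma> * s)) * h s) integrable_on {0..t}"
    by (intro integrable_continuous_real continuous_intros assms)+
  then have "integral {0..t} (\<lambda>s. of_real (exp (\<sigma> * s)) * (g s - h s))
      = integral {0..t} (\<lambda>s. of_real (exp (\<sigma> * s)) * g s) - integral {0..t} (\<lambda>s. of_real (exp (\<sigma> * s)) * h s)"
    by (simp add: right_diff_distrib integral_diff)
  then show ?thesis by (simp add: duh_def right_diff_distrib)
qed

lemma duh_has_derivative:
  assumes g: "continuous_on {0..T} g" and t: "t \<in> {0..T}"
  shows "(duh \<sigma> g has_vector_derivative (g t - of_real \<sigma> * duh \<sigma> g t)) (at t within {0..T})"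
proof -
  have c: "continuous_on {0..T} (\<lambda>s. complex_of_real (exp (\<sigma> * s)) * g s)" by (intro continuous_intros g)
  have e: "((\<lambda>t. complex_of_real (exp (- \<sigma> * t))) has_vector_derivative of_real (- \<sigma> * exp (- \<sigma> * t))) (at t within {0..T})"
    by (rule has_vector_derivative_of_real) (auto intro!: derivative_eq_intros)
  from has_vector_derivative_mult[OF e integral_has_vector_derivative[OF c t]]
  have "(duh \<sigma> g has_vector_derivative of_real (exp (- \<sigma> * t)) * (of_real (exp (\<sigma> * t)) * g t)
      + of_real (- \<sigma> * exp (- \<sigma> * t)) * integral {0..t} (\<lambda>s. of_real (exp (\<sigma> * s)) * g s)) (at t within {0..T})"
    by (simp add: duh_def[abs_def])
  moreover have "complex_of_real (exp (- \<sigma> * t)) * of_real (exp (\<sigma> * t)) = 1"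
    by (simp flip: of_real_mult exp_add)
  then have "of_real (exp (- \<sigma> * t)) * (of_real (exp (\<sigma> * t)) * g t) = g t"
    by (simp only: mult.assoc[symmetric]) simp
  ultimately show ?thesis
    by (simp only: duh_def of_real_mult of_real_minus mult.assoc mult_minus_left diff_conv_add_uminus)
qed

lemma duh_continuous: "continuous_on {0..T} g \<Longrightarrow> continuous_on {0..T} (duh \<sigma> g)"
  unfolding continuous_on_eq_continuous_within
  using duh_has_derivative[unfolded continuous_on_eq_continuous_within] has_vector_derivative_continuous
  by blast

lemma duh_split:
  assumes "continuous_on {0..t} g" "0 \<le> b" "b \<le> t"
  shows "duh \<sigma> g t = of_real (exp (- \<sigma> * t)) * integral {0..b} (\<lambda>s. of_real (exp (\<sigma> * s)) * g s)
    + of_real (exp (- \<sigma> * t)) * integral {b..t} (\<lambda>s. of_real (exp (\<sigma> * s)) * g s)"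
proof -
  have "(\<lambda>s. complex_of_real (exp (\<sigma> * s)) * g s) integrable_on {0..t}"
    by (intro integrable_continuous_real continuous_intros assms)
  from Henstock_Kurzweil_Integration.integral_combine[OF assms(2,3) this] show ?thesis
    by (simp add: duh_def flip: distrib_left)
qed

lemma duh_flip: "cnj (duh \<sigma> g t) = duh \<sigma> (\<lambda>s. cnj (g s)) t"
  unfolding duh_def by (simp add: integral_cnj)

subsection \<open>The symbol of the linear part\<close>

text \<open>\<open>sg\<close> may be negative at low frequencies, where the linear flow grows;
  \<open>C0\<close> bounds the growth rate and \<open>c\<close> measures the dissipation. The upper
  bound makes \<open>sg\<close> times an H^4 family square summable, as the time derivative
  requires, and evenness keeps the flow real.\<close>

locale symbol =
  fixes sg :: "int \<times> int \<Rightarrow> real" and c C0 C1 T :: real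
  assumes c_pos: "0 < c" and C0_nonneg: "0 \<le> C0" and T_pos: "0 < T"
    and sg_minus: "\<And>k. sg (- k) = sg k"
    and sg_lower: "\<And>k. c * jb k ^ 4 \<le> sg k + C0"
    and sg_upper: "\<And>k. \<bar>sg k\<bar> \<le> C1 * jb k ^ 4"
begin

lemma sg_C0_pos: "0 < sg k + C0"
  using sg_lower[of k] c_pos jb_pos[of k] by (auto intro: less_le_trans[OF _ sg_lower])

lemma exp_sg_le: "0 \<le> t \<Longrightarrow> t \<le> T \<Longrightarrow> exp (- sg k * t) \<le> exp (C0 * T) * exp (- c * jb k ^ 4 * t)"
proof -
  assume t: "0 \<le> t" "t \<le> T"
  have "- sg k * t \<le> (C0 - c * jb k ^ 4) * t"
    using sg_lower[of k] t by (intro mult_right_mono) auto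
  also have "\<dots> \<le> C0 * T + - c * jb k ^ 4 * t"
    using t C0_nonneg by (simp add: algebra_simps mult_left_mono)
  finally show ?thesis by (simp flip: exp_add)
qed

lemma exp_sg_le': "0 \<le> t \<Longrightarrow> t \<le> T \<Longrightarrow> exp (- sg k * t) \<le> exp (C0 * T)"
proof -
  assume t: "0 \<le> t" "t \<le> T"
  have "exp (- c * jb k ^ 4 * t) \<le> 1" using t c_pos jb_nonneg[of k] by simp
  then have "exp (C0 * T) * exp (- c * jb k ^ 4 * t) \<le> exp (C0 * T)" by (simp add: mult_left_le)
  with exp_sg_le[OF t] show ?thesis by (rule order_trans)
qed

text \<open>The growth rate K for which \<open>sg k + K\<close> is at least M J^3. Dividing by it
  beats the derivative in the nonlinearity and leaves J^-2 together with the factor 1 / M, which is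
  as small as desired.\<close>

definition shift :: "real \<Rightarrow> real" where
  "shift M = C0 + M ^ 4 / c ^ 3"

lemma shift_nonneg: "0 < M \<Longrightarrow> 0 \<le> shift M"
  using C0_nonneg c_pos by (simp add: shift_def)

text \<open>If \<open>c J\<close> does not exceed \<open>M\<close>, then \<open>M J\<^sup>3\<close> is at most the constant \<open>M\<^sup>4 / c\<^sup>3\<close>.\<close>

lemma shift_lower: "0 < M \<Longrightarrow> M * jb k ^ 3 \<le> sg k + shift M"
proof -
  assume M: "0 < M"
  have "M * jb k ^ 3 \<le> c * jb k ^ 4 + M ^ 4 / c ^ 3"
  proof (cases "M \<le> c * jb k")
    case True
    then have "M * jb k ^ 3 \<le> (c * jb k) * jb k ^ 3"
      by (intro mult_right_mono) (simp_all add: jb_nonneg)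
    also have "\<dots> = c * jb k ^ 4" by (simp add: power_numeral_reduce)
    finally show ?thesis using M c_pos by (simp add: add_increasing2)
  next
    case False
    then have "jb k \<le> M / c" using c_pos by (simp add: field_simps)
    then have "M * jb k ^ 3 \<le> M * (M / c) ^ 3"
      using M by (intro mult_left_mono power_mono) (auto simp: jb_nonneg)
    also have "\<dots> = M ^ 4 / c ^ 3" by (simp add: power_divide power_numeral_reduce)
    finally show ?thesis using c_pos jb_nonneg[of k] by (simp add: add_increasing)
  qed
  then show ?thesis using sg_lower[of k] by (simp add: shift_def)
qed

lemma shift_pos: "0 < M \<Longrightarrow> 0 < sg k + shift M"
  using shift_lower[of M k] jb_pos[of k] by (auto intro: less_le_trans[OF _ shift_lower])

lemma duh_shift_bound:
  assumes "0 \<le> t" "continuous_on {0..t} g" "0 < M" "0 \<le> G"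
    "\<And>s. s \<in> {0..t} \<Longrightarrow> cmod (g s) \<le> jb k * G * exp (shift M * s)"
  shows "cmod (duh (sg k) g t) \<le> (G * exp (shift M * t) / M) / (jb k)\<^sup>2"
proof -
  have "cmod (duh (sg k) g t) \<le> jb k * G * exp (shift M * t) / (sg k + shift M)"
    by (rule duh_bound[OF assms(1,2) shift_pos[OF assms(3)] assms(5)])
  also have "\<dots> \<le> jb k * G * exp (shift M * t) / (M * jb k ^ 3)"
    using shift_lower[OF assms(3), of k] assms(3,4) jb_pos[of k]
    by (intro divide_left_mono mult_pos_pos shift_pos) (auto simp: jb_nonneg)
  also have "\<dots> = (G * exp (shift M * t) / M) / (jb k)\<^sup>2"
    using jb_pos[of k] assms(3) by (simp add: field_simps power_numeral_reduce)
  finally show ?thesis .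
qed

text \<open>With the fixed rate \<open>C0\<close> all four powers are gained but no small factor.
  This form serves regularity, \<open>duh_shift_bound\<close> serves contraction.\<close>

lemma duh_C0_bound:
  assumes "0 \<le> t" "t \<le> T" "continuous_on {0..t} g" "\<And>s. s \<in> {0..t} \<Longrightarrow> cmod (g s) \<le> G"
  shows "cmod (duh (sg k) g t) \<le> (G * exp (C0 * T) / c) / jb k ^ 4"
proof -
  have G: "0 \<le> G" using order_trans[OF norm_ge_zero assms(4)[of 0]] assms(1) by simp
  have "cmod (duh (sg k) g t) \<le> G * exp (C0 * t) / (sg k + C0)"
  proof (rule duh_bound[OF assms(1,3) sg_C0_pos])
    fix s assume s: "s \<in> {0..t}"
    then have "1 \<le> exp (C0 * s)" using C0_nonneg by simp
    then have "G * 1 \<le> G * exp (C0 * s)" using G by (intro mult_left_mono)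
    then show "cmod (g s) \<le> G * exp (C0 * s)" using assms(4)[OF s] by simp
  qed
  also have "\<dots> \<le> G * exp (C0 * T) / (c * jb k ^ 4)"
    using G assms(1,2) C0_nonneg c_pos jb_pos[of k] sg_lower[of k] sg_C0_pos[of k]
    by (intro frac_le mult_left_mono) (auto simp: mult_left_mono)
  finally show ?thesis by simp
qed

text \<open>A difference of mild solutions that is controlled by itself with the loss of one derivative
  vanishes: in the norm \<open>sup\<^sub>t exp (- K t) \<parallel>d t\<parallel>\<close> with \<open>K = shift M\<close> and \<open>M\<close> large, Duhamel's
  operator is a contraction.\<close>

lemma duh_contraction_zero:
  assumes G: "0 \<le> G" and D0: "\<And>t. t \<in> {0..T} \<Longrightarrow> l2bd (d t) D0"
    and h: "\<And>k. continuous_on {0..T} (h k)"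
    and d: "\<And>t k. t \<in> {0..T} \<Longrightarrow> cmod (d t k) \<le> cmod (duh (sg k) (h k) t)"
    and hb: "\<And>t k B. t \<in> {0..T} \<Longrightarrow> l2bd (d t) B \<Longrightarrow> cmod (h k t) \<le> jb k * (G * B)"
    and t: "t \<in> {0..T}"
  shows "d t k = 0"
proof -
  \<comment> \<open>Makes G sqrt(jsum) / M at most 1/2; the summand 1 keeps \<open>M\<close>
    positive when \<open>G\<close> vanishes.\<close>
  define M where "M = 2 * G * sqrt jsum + 1"
  have M: "0 < M" "2 * (G * sqrt jsum) \<le> M"
    using G jsum_nonneg by (auto simp: M_def add_nonneg_pos)
  have step: "l2bd (d t) (D / 2 * exp (shift M * t))"
    if D: "\<And>t. t \<in> {0..T} \<Longrightarrow> l2bd (d t) (D * exp (shift M * t))" and t: "t \<in> {0..T}" for D t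
  proof -
    have "0 \<le> D * exp (shift M * t)" by (rule l2bd_nonneg[OF D[OF t]])
    then have D0: "0 \<le> D" by (simp add: zero_le_mult_iff)
    have "cmod (d t k) \<le> (G * D * exp (shift M * t) / M) / (jb k)\<^sup>2" for k
    proof (rule order_trans[OF d[OF t] duh_shift_bound[OF _ _ M(1)]])
      show "0 \<le> t" using t by simp
      show "continuous_on {0..t} (h k)" by (rule continuous_on_subset[OF h]) (use t in auto)
      show "0 \<le> G * D" using G D0 by simp
      show "cmod (h k s) \<le> jb k * (G * D) * exp (shift M * s)" if "s \<in> {0..t}" for s
      proof -
        have s: "s \<in> {0..T}" using that t by simp
        show ?thesis using hb[OF s D[OF s], of k] by (simp add: mult.assoc)
      qed
    qed
    then have "l2bd (d t) (G * D * exp (shift M * t) / M * sqrt jsum)"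
      by (rule l2bd_decay) (use G D0 M in auto)
    then show ?thesis
    proof (rule l2bd_mono)
      have "G * sqrt jsum / M \<le> 1 / 2" using M by (simp add: field_simps)
      then have "(G * sqrt jsum / M) * (D * exp (shift M * t)) \<le> 1 / 2 * (D * exp (shift M * t))"
        using D0 by (intro mult_right_mono) auto
      then show "G * D * exp (shift M * t) / M * sqrt jsum \<le> D / 2 * exp (shift M * t)"
        by (simp add: mult_ac)
    qed simp
  qed
  \<comment> \<open>One application of Duhamel's formula halves any bound of the form D exp(shift M
    * t), and the a priori bound \<open>D0\<close> starts the iteration. No supremum over time has
    to be formed.\<close>
  have iter: "l2bd (d t) (\<bar>D0\<bar> / 2 ^ n * exp (shift M * t))" if "t \<in> {0..T}" for n t
    using that
  proof (induction n arbitrary: t)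
    case 0
    have "1 \<le> exp (shift M * t)" using 0 shift_nonneg[OF M(1)] by simp
    then have "\<bar>D0\<bar> * 1 \<le> \<bar>D0\<bar> * exp (shift M * t)" by (intro mult_left_mono) auto
    then show ?case by (intro l2bd_mono[OF D0[OF 0]]) auto
  next
    case (Suc n)
    from step[OF Suc.IH Suc.prems] show ?case by (simp add: mult.commute)
  qed
  have "(\<lambda>n. (\<bar>D0\<bar> * exp (shift M * t)) * (1 / 2) ^ n) \<longlonglongrightarrow> (\<bar>D0\<bar> * exp (shift M * t)) * 0"
    by (intro tendsto_intros LIMSEQ_power_zero) simp
  moreover have "cmod (d t k) \<le> (\<bar>D0\<bar> * exp (shift M * t)) * (1 / 2) ^ n" for n
    using l2bd_component[OF iter[OF t, of n], of k] by (simp add: power_one_over mult_ac divide_simps)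
  ultimately have "cmod (d t k) \<le> 0"
    by (intro LIMSEQ_le_const) auto
  then show ?thesis by simp
qed

end

subsection \<open>The truncated equation\<close>

definition rad :: "real \<Rightarrow> l2 \<Rightarrow> l2" where
  "rad R x = (R / max R (norm x)) *\<^sub>R x"

lemma norm_rad_le: "0 < R \<Longrightarrow> norm (rad R x) \<le> R"
  by (simp add: rad_def max_def field_simps)

lemma rad_id: "norm x \<le> R \<Longrightarrow> 0 < R \<Longrightarrow> rad R x = x"
  by (simp add: rad_def max_def)

text \<open>The difference is the rescaled \<open>x - y\<close> plus the change of the scaling
  factor applied to \<open>y\<close>. Each part is at most the norm of \<open>x - y\<close>, hence
  the constant 2.\<close>

lemma rad_lipschitz:
  assumes R: "0 < R" shows "norm (rad R x - rad R y) \<le> 2 * norm (x - y)"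
proof -
  let ?a = "max R (norm x)" and ?b = "max R (norm y)"
  have pos: "0 < ?a" "0 < ?b" using R by auto
  have eq: "rad R x - rad R y = (R / ?a) *\<^sub>R (x - y) + (R / ?a - R / ?b) *\<^sub>R y"
    by (simp add: rad_def algebra_simps)
  have "\<bar>R / ?a\<bar> \<le> 1" using R pos by (simp add: field_simps)
  then have 1: "norm ((R / ?a) *\<^sub>R (x - y)) \<le> norm (x - y)"
    unfolding norm_scaleR using mult_right_mono[of "\<bar>R / ?a\<bar>" 1 "norm (x - y)"] by simp
  have "R / ?a - R / ?b = R / ?a * ((?b - ?a) / ?b)" using pos by (simp add: field_simps)
  then have "norm ((R / ?a - R / ?b) *\<^sub>R y) = \<bar>R / ?a\<bar> * (\<bar>?b - ?a\<bar> * (norm y / ?b))"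
    using pos by (simp add: abs_mult)
  also have "\<dots> \<le> 1 * (norm (x - y) * 1)"
  proof (intro mult_mono)
    have "\<bar>?b - ?a\<bar> \<le> \<bar>norm y - norm x\<bar>" by (auto simp: max_def)
    also have "\<dots> \<le> norm (x - y)" by (metis norm_triangle_ineq3 norm_minus_commute)
    finally show "\<bar>?b - ?a\<bar> \<le> norm (x - y)" .
    show "norm y / ?b \<le> 1" using pos by simp
  qed (use pos \<open>\<bar>R / ?a\<bar> \<le> 1\<close> in auto)
  finally have 2: "norm ((R / ?a - R / ?b) *\<^sub>R y) \<le> norm (x - y)" by simp
  show ?thesis unfolding eq using norm_triangle_ineq[of "(R / ?a) *\<^sub>R (x - y)" "(R / ?a - R / ?b) *\<^sub>R y"] 1 2
    by linarith
qed

definition tnl :: "real \<Rightarrow> int \<times> int \<Rightarrow> l2 \<Rightarrow> complex" where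
  "tnl R k x = nl (cf (rad R x)) k"

lemma tnl_bound: "0 < R \<Longrightarrow> cmod (tnl R k x) \<le> jb k * R\<^sup>2"
  unfolding tnl_def by (rule nl_bound[OF l2bd_mono[OF l2bd_cf]]) (auto simp: norm_rad_le)

lemma tnl_lipschitz:
  assumes R: "0 < R" shows "cmod (tnl R k x - tnl R k y) \<le> jb k * (4 * R * norm (x - y))"
proof -
  have "cmod (tnl R k x - tnl R k y) \<le> jb k * ((2 * norm (x - y)) * (R + R))"
    unfolding tnl_def
  proof (rule nl_diff_bound)
    show "l2bd (cf (rad R x)) R" "l2bd (cf (rad R y)) R"
      by (auto intro!: l2bd_mono[OF l2bd_cf] simp: norm_rad_le R)
    show "l2bd (\<lambda>k. cf (rad R x) k - cf (rad R y) k) (2 * norm (x - y))"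
      by (rule l2bd_mono[OF l2bd_cf[of "rad R x - rad R y"]]) (auto simp: rad_lipschitz R)
  qed
  then show ?thesis by (simp add: mult_ac)
qed

lemma tnl_continuous:
  assumes R: "0 < R" and x: "continuous_on S x" shows "continuous_on S (\<lambda>t. tnl R k (x t))"
proof -
  have "continuous_on UNIV (tnl R k)"
  proof (rule lipschitz_on_continuous_on[OF lipschitz_onI])
    show "dist (tnl R k x) (tnl R k y) \<le> (jb k * (4 * R)) * dist x y" for x y
      using tnl_lipschitz[OF R, of k x y] by (simp add: dist_norm mult.assoc)
  qed (use R in \<open>simp add: jb_nonneg\<close>)
  then show ?thesis by (rule continuous_on_compose2[OF _ x]) auto
qed

context symbol
begin

text \<open>\<open>Abs_l2\<close> is meaningful only for square-summable families; for continuous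
  \<open>x\<close> this is supplied by \<open>tduh_bound\<close>, and \<open>cf_phi\<close> then
  recovers the coefficients.\<close>

definition phi :: "real \<Rightarrow> l2 \<Rightarrow> (real \<Rightarrow> l2) \<Rightarrow> real \<Rightarrow> l2" where
  "phi R a0 x t = Abs_l2 (\<lambda>k. of_real (exp (- sg k * t)) * cf a0 k - duh (sg k) (\<lambda>s. tnl R k (x s)) t)"

context
  fixes R :: real and a0 :: l2
  assumes R: "0 < R"
begin

lemma tduh_bound:
  assumes "continuous_on {0..T} x" "t \<in> {0..T}"
  shows "cmod (duh (sg k) (\<lambda>s. tnl R k (x s)) t) \<le> R\<^sup>2 * exp (shift 1 * T) / (jb k)\<^sup>2"
proof -
  have "cmod (duh (sg k) (\<lambda>s. tnl R k (x s)) t) \<le> R\<^sup>2 * exp (shift 1 * t) / 1 / (jb k)\<^sup>2"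
  proof (rule duh_shift_bound)
    show "continuous_on {0..t} (\<lambda>s. tnl R k (x s))"
      by (rule tnl_continuous[OF R continuous_on_subset[OF assms(1)]]) (use assms in auto)
    fix s assume s: "s \<in> {0..t}"
    have "1 \<le> exp (shift 1 * s)" using s shift_nonneg[of 1] by simp
    then have "jb k * R\<^sup>2 * 1 \<le> jb k * R\<^sup>2 * exp (shift 1 * s)"
      by (intro mult_left_mono) (auto simp: jb_nonneg)
    then show "cmod (tnl R k (x s)) \<le> jb k * R\<^sup>2 * exp (shift 1 * s)"
      using tnl_bound[OF R, of k "x s"] by simp
  qed (use assms in auto)
  also have "\<dots> \<le> R\<^sup>2 * exp (shift 1 * T) / (jb k)\<^sup>2"
    using assms shift_nonneg[of 1] by (intro divide_right_mono) (auto simp: mult_left_mono)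
  finally show ?thesis .
qed

lemma linear_l2bd:
  assumes "t \<in> {0..T}"
  shows "l2bd (\<lambda>k. of_real (exp (- sg k * t)) * cf a0 k) (exp (C0 * T) * norm a0)"
proof (rule l2bd_mono[OF l2bd_cmult[OF l2bd_cf, of "of_real (exp (C0 * T))"]])
  fix k
  show "cmod (of_real (exp (- sg k * t)) * cf a0 k) \<le> cmod (of_real (exp (C0 * T)) * cf a0 k)"
    using exp_sg_le'[of t k] assms by (simp add: norm_mult mult_right_mono)
qed simp

lemma cf_phi:
  assumes "continuous_on {0..T} x" "t \<in> {0..T}"
  shows "cf (phi R a0 x t) k = of_real (exp (- sg k * t)) * cf a0 k - duh (sg k) (\<lambda>s. tnl R k (x s)) t"
proof -
  have "l2bd (\<lambda>k. duh (sg k) (\<lambda>s. tnl R k (x s)) t) (R\<^sup>2 * exp (shift 1 * T) * sqrt jsum)"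
    by (rule l2bd_decay[OF tduh_bound[OF assms]]) simp
  from cf_Abs_l2[OF l2bd_diff[OF linear_l2bd[OF assms(2)] this]] show ?thesis
    unfolding phi_def by simp
qed

lemma continuous_phi:
  assumes x: "continuous_on {0..T} x"
  shows "continuous_on {0..T} (phi R a0 x)"
proof (rule continuous_on_l2I)
  show "continuous_on {0..T} (\<lambda>t. cf (phi R a0 x t) k)" for k
    by (subst continuous_on_cong[OF refl cf_phi[OF x]])
      (auto intro!: continuous_intros duh_continuous tnl_continuous[OF R x])
  \<comment> \<open>The datum dominates the linear part mode by mode, and J^-4 dominates the square
    of the integral part; neither depends on the time.\<close>
  let ?D = "\<lambda>k. 2 * (exp (C0 * T))\<^sup>2 * (cmod (cf a0 k))\<^sup>2 + 2 * (R\<^sup>2 * exp (shift 1 * T))\<^sup>2 * (1 / jb k ^ 4)"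
  show "?D summable_on UNIV"
    by (intro summable_on_add summable_on_cmult_right cf_summable summable_on_jb)
  fix k t assume t: "t \<in> {0..T}"
  have "(cmod (of_real (exp (- sg k * t)) * cf a0 k))\<^sup>2 \<le> (exp (C0 * T) * cmod (cf a0 k))\<^sup>2"
    using exp_sg_le'[of t k] t by (intro power_mono) (auto simp: norm_mult mult_right_mono)
  moreover have "(cmod (duh (sg k) (\<lambda>s. tnl R k (x s)) t))\<^sup>2 \<le> (R\<^sup>2 * exp (shift 1 * T) / (jb k)\<^sup>2)\<^sup>2"
    by (intro power_mono tduh_bound x t) simp
  ultimately show "(cmod (cf (phi R a0 x t) k))\<^sup>2 \<le> ?D k"
    using square_le_sum_squares[of "of_real (exp (- sg k * t)) * cf a0 k" "duh (sg k) (\<lambda>s. tnl R k (x s)) t"]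
    by (simp add: cf_phi[OF x t] power_mult_distrib power_divide)
qed

lemma phi_contraction:
  assumes x: "continuous_on {0..T} x" and y: "continuous_on {0..T} y" and t: "t \<in> {0..T}"
    and M: "0 < M" and D: "0 \<le> D" "\<And>s. s \<in> {0..T} \<Longrightarrow> norm (x s - y s) \<le> D * exp (shift M * s)"
  shows "norm (phi R a0 x t - phi R a0 y t) \<le> 4 * R * D * exp (shift M * t) / M * sqrt jsum"
proof (rule norm_l2_le, rule l2bd_decay)
  show "0 \<le> 4 * R * D * exp (shift M * t) / M" using R D M by simp
  fix k
  have sub: "continuous_on {0..t} x" "continuous_on {0..t} y"
    using t by (auto intro: continuous_on_subset[OF x] continuous_on_subset[OF y])
  have cx: "continuous_on {0..t} (\<lambda>s. tnl R k (x s))" "continuous_on {0..t} (\<lambda>s. tnl R k (y s))"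
    using sub by (auto intro: tnl_continuous[OF R])
  have "cf (phi R a0 x t - phi R a0 y t) k = - duh (sg k) (\<lambda>s. tnl R k (x s) - tnl R k (y s)) t"
    by (simp add: cf_phi[OF x t] cf_phi[OF y t] duh_diff[OF cx, symmetric])
  then have "cmod (cf (phi R a0 x t - phi R a0 y t) k) = cmod (duh (sg k) (\<lambda>s. tnl R k (x s) - tnl R k (y s)) t)"
    by simp
  also have "\<dots> \<le> 4 * R * D * exp (shift M * t) / M / (jb k)\<^sup>2"
  proof (rule duh_shift_bound[OF _ _ M])
    show "continuous_on {0..t} (\<lambda>s. tnl R k (x s) - tnl R k (y s))" by (intro continuous_intros cx)
    fix s assume "s \<in> {0..t}"
    then have s: "s \<in> {0..T}" using t by auto
    have "cmod (tnl R k (x s) - tnl R k (y s)) \<le> jb k * (4 * R * norm (x s - y s))"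
      by (rule tnl_lipschitz[OF R])
    also have "\<dots> \<le> jb k * (4 * R * (D * exp (shift M * s)))"
      using R by (intro mult_left_mono D(2) s) (auto simp: jb_nonneg)
    finally show "cmod (tnl R k (x s) - tnl R k (y s)) \<le> jb k * (4 * R * D) * exp (shift M * s)"
      by (simp add: mult_ac)
  qed (use t R D in auto)
  finally show "cmod (cf (phi R a0 x t - phi R a0 y t) k) \<le> 4 * R * D * exp (shift M * t) / M / (jb k)\<^sup>2" .
qed

text \<open>The weighted supremum norm is realised by the substitution x(s) = exp(K s) b(s) with
  \<open>b\<close> in the complete space of bounded continuous functions, where Banach's theorem
  applies to the plain supremum norm.\<close>

lemma truncated_solution:
  "\<exists>x. continuous_on {0..T} x \<and> (\<forall>t\<in>{0..T}. x t = phi R a0 x t)"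
proof -
  \<comment> \<open>The contraction factor of \<open>phi\<close> is 4 R sqrt(jsum) / M, which this
    choice makes at most 1/2.\<close>
  define M where "M = 8 * R * sqrt jsum + 1"
  have M: "0 < M" "8 * (R * sqrt jsum) \<le> M"
    using R jsum_nonneg by (auto simp: M_def add_nonneg_pos)
  define K where "K = shift M"
  \<comment> \<open>Bounded continuous functions are defined on the whole line. Clamping the time to
    [0, T] extends the operator there and makes its values bounded by compactness.\<close>
  define cl where "cl t = max 0 (min T t)" for t :: real
  have cl: "cl t \<in> {0..T}" for t using T_pos by (auto simp: cl_def)
  have cl_id: "cl t = t" if "t \<in> {0..T}" for t using that by (auto simp: cl_def)
  have ccl: "continuous_on S cl" for S unfolding cl_def by (intro continuous_intros)
  define X where "X b s = exp (K * s) *\<^sub>R apply_bcontfun b s" for b :: "(real, l2) bcontfun" and s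
  have cX: "continuous_on S (X b)" for S b unfolding X_def by (intro continuous_intros) auto
  define H where "H b t = exp (- K * cl t) *\<^sub>R phi R a0 (X b) (cl t)" for b t
  have cH: "continuous_on UNIV (H b)" for b
    unfolding H_def
    by (intro continuous_intros ccl continuous_on_compose2[OF continuous_phi[OF cX] ccl]) (use cl in auto)
  have bH: "bounded (range (H b))" for b
  proof -
    have "H b t = H b (cl t)" for t using cl[of t] cl_id by (simp add: H_def)
    then have "range (H b) \<subseteq> H b ` {0..T}" using cl by blast
    moreover have "compact (H b ` {0..T})"
      by (intro compact_continuous_image compact_Icc continuous_on_subset[OF cH]) auto
    ultimately show ?thesis by (metis bounded_subset compact_imp_bounded)
  qed
  have H: "H b \<in> bcontfun" for b using cH bH by (simp add: bcontfun_def)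
  define Gf where "Gf b = Bcontfun (H b)" for b
  have Gf: "apply_bcontfun (Gf b) = H b" for b unfolding Gf_def by (rule Bcontfun_inverse[OF H])
  have "\<exists>!b. Gf b = b"
  proof (rule banach_fix_type[of "1 / 2"], simp, simp, intro allI)
    fix b b' :: "(real, l2) bcontfun"
    show "dist (Gf b) (Gf b') \<le> 1 / 2 * dist b b'"
    proof (rule dist_bound)
      fix t
      let ?t = "cl t"
      have "norm (X b s - X b' s) \<le> dist b b' * exp (K * s)" for s
        using dist_bounded[of b s b'] unfolding X_def dist_norm
        by (simp flip: scaleR_diff_right add: mult.commute)
      then have "norm (phi R a0 (X b) ?t - phi R a0 (X b') ?t)
          \<le> 4 * R * dist b b' * exp (K * ?t) / M * sqrt jsum"
        unfolding K_def by (intro phi_contraction cX cl M) auto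
      then have "exp (- K * ?t) * norm (phi R a0 (X b) ?t - phi R a0 (X b') ?t)
          \<le> exp (- K * ?t) * (4 * R * dist b b' * exp (K * ?t) / M * sqrt jsum)"
        by (rule mult_left_mono) simp
      also have "\<dots> = (exp (- K * ?t) * exp (K * ?t)) * (4 * R * sqrt jsum / M) * dist b b'"
        by simp
      also have "exp (- K * ?t) * exp (K * ?t) = 1" by (simp flip: exp_add)
      also have "1 * (4 * R * sqrt jsum / M) * dist b b' \<le> 1 / 2 * dist b b'"
        using M by (intro mult_right_mono) (auto simp: field_simps)
      finally show "dist (apply_bcontfun (Gf b) t) (apply_bcontfun (Gf b') t) \<le> 1 / 2 * dist b b'"
        unfolding Gf H_def dist_norm by (simp flip: scaleR_diff_right)
    qed
  qed
  then obtain b where b: "Gf b = b" by blast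
  have "X b t = phi R a0 (X b) t" if t: "t \<in> {0..T}" for t
  proof -
    have "X b t = exp (K * t) *\<^sub>R H b t" using Gf[of b] by (simp add: X_def b)
    then show ?thesis using t by (simp add: H_def cl_id flip: exp_add)
  qed
  then show ?thesis using cX by blast
qed

end

end

subsection \<open>Regularity and energy of mild solutions\<close>

text \<open>The factor \<open>q\<close> is 1 for the original equation; for the truncated one it is the square of
  the factor by which \<open>rad\<close> rescales the solution.\<close>

locale mild_sol = symbol +
  fixes f :: "real \<Rightarrow> int \<times> int \<Rightarrow> complex" and a0 :: "int \<times> int \<Rightarrow> complex"
    and q :: "real \<Rightarrow> real" and A B :: real
  assumes f_eq: "\<And>t k. t \<in> {0..T} \<Longrightarrow>
      f t k = of_real (exp (- sg k * t)) * a0 k - duh (sg k) (\<lambda>s. of_real (q s) * nl (f s) k) t"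
    and q_range: "\<And>t. t \<in> {0..T} \<Longrightarrow> 0 \<le> q t \<and> q t \<le> 1"
    and cont_g: "\<And>k. continuous_on {0..T} (\<lambda>s. of_real (q s) * nl (f s) k)"
    and f_bd: "\<And>t. t \<in> {0..T} \<Longrightarrow> l2bd (f t) A"
    and a0_bd: "l2bd (\<lambda>k. of_real ((jb k)\<^sup>2) * a0 k) B"
    and f_herm: "\<And>t. t \<in> {0..T} \<Longrightarrow> herm (f t)"
begin

abbreviation "g k \<equiv> \<lambda>s. of_real (q s) * nl (f s) k"

lemma A_nonneg: "0 \<le> A"
  using l2bd_nonneg[OF f_bd[of 0]] T_pos by simp

lemma B_nonneg: "0 \<le> B"
  by (rule l2bd_nonneg[OF a0_bd])

lemma cont_g_sub: "0 \<le> a \<Longrightarrow> b \<le> T \<Longrightarrow> continuous_on {a..b} (g k)"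
  by (rule continuous_on_subset[OF cont_g]) auto

lemma cmod_g_le: "t \<in> {0..T} \<Longrightarrow> cmod (g k t) \<le> cmod (nl (f t) k)"
  using q_range[of t] by (simp add: norm_mult mult_left_le_one_le)

lemma f_0: "f 0 k = a0 k"
  using f_eq[of 0 k] T_pos by (simp add: duh_def)

lemma f_deriv:
  assumes t: "t \<in> {0..T}"
  shows "((\<lambda>t. f t k) has_vector_derivative (- of_real (sg k) * f t k - g k t)) (at t within {0..T})"
proof -
  have e: "((\<lambda>t. complex_of_real (exp (- sg k * t))) has_vector_derivative of_real (- sg k * exp (- sg k * t)))
      (at t within {0..T})"
    by (rule has_vector_derivative_of_real) (auto intro!: derivative_eq_intros)
  have "((\<lambda>t. of_real (exp (- sg k * t)) * a0 k - duh (sg k) (g k) t) has_vector_derivative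
      (of_real (- sg k * exp (- sg k * t)) * a0 k - (g k t - of_real (sg k) * duh (sg k) (g k) t)))
      (at t within {0..T})"
    by (intro has_vector_derivative_diff has_vector_derivative_mult_left e duh_has_derivative cont_g t)
  moreover have "of_real (- sg k * exp (- sg k * t)) * a0 k - (g k t - of_real (sg k) * duh (sg k) (g k) t)
      = - of_real (sg k) * f t k - g k t"
    by (simp add: f_eq[OF t] algebra_simps)
  ultimately have "((\<lambda>t. of_real (exp (- sg k * t)) * a0 k - duh (sg k) (g k) t) has_vector_derivative
      (- of_real (sg k) * f t k - g k t)) (at t within {0..T})"
    by (rule has_vector_derivative_eq_rhs)
  then show ?thesis
    by (rule has_vector_derivative_transform[OF t, rotated]) (simp add: f_eq)
qed

lemma f_continuous: "continuous_on {0..T} (\<lambda>t. f t k)"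
  unfolding continuous_on_eq_continuous_within
  using f_deriv has_vector_derivative_continuous by blast

lemma linear_weight:
  assumes t: "t \<in> {0..T}" and j: "j \<le> 2"
  shows "l2bd (\<lambda>k. of_real (jb k ^ j) * (of_real (exp (- sg k * t)) * a0 k)) (exp (C0 * T) * B)"
proof (rule l2bd_mono)
  show "l2bd (\<lambda>k. of_real (exp (C0 * T)) * (of_real ((jb k)\<^sup>2) * a0 k)) (exp (C0 * T) * B)"
    using l2bd_cmult[OF a0_bd, of "of_real (exp (C0 * T))"] by simp
  fix k
  have "jb k ^ j * (exp (- sg k * t) * cmod (a0 k)) \<le> (jb k)\<^sup>2 * (exp (C0 * T) * cmod (a0 k))"
    using t by (intro mult_mono power_increasing j jb_ge_1 exp_sg_le') (auto simp: jb_nonneg)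
  then show "cmod (of_real (jb k ^ j) * (of_real (exp (- sg k * t)) * a0 k))
      \<le> cmod (of_real (exp (C0 * T)) * (of_real ((jb k)\<^sup>2) * a0 k))"
    by (simp add: norm_mult norm_power jb_nonneg mult_ac)
qed simp

lemma g_weight:
  assumes t: "t \<in> {0..T}" and D: "l2bd (\<lambda>k. of_real (jb k ^ j) * f t k) D"
  shows "jb k ^ j * cmod (g k t) \<le> jb k * (2 ^ j * (2 * D * A))"
proof -
  have "jb k ^ j * cmod (g k t) \<le> jb k ^ j * cmod (nl (f t) k)"
    by (intro mult_left_mono cmod_g_le t) (simp add: jb_nonneg)
  also have "\<dots> \<le> jb k * (2 ^ j * (2 * D * A))"
    by (rule nl_tame[OF D f_bd[OF t]])
  finally show ?thesis .
qed

text \<open>A weight J^j on the solution passes to the nonlinearity with the loss of one power;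
  Duhamel's integral gains four.\<close>

lemma duh_weight:
  assumes D: "\<And>t. t \<in> {0..T} \<Longrightarrow> l2bd (\<lambda>k. of_real (jb k ^ j) * f t k) D" and t: "t \<in> {0..T}"
  shows "jb k ^ (j + 3) * cmod (duh (sg k) (g k) t) \<le> 2 ^ j * (2 * D * A) * exp (C0 * T) / c"
proof -
  let ?G = "2 ^ j * (2 * D * A)"
  have "cmod (duh (sg k) (g k) t) \<le> (jb k * ?G / jb k ^ j * exp (C0 * T) / c) / jb k ^ 4"
  proof (rule duh_C0_bound)
    show "cmod (g k s) \<le> jb k * ?G / jb k ^ j" if "s \<in> {0..t}" for s
      using g_weight[OF _ D, of s k] that t jb_pos[of k] by (simp add: field_simps)
  qed (use t in \<open>auto intro!: cont_g_sub\<close>)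
  also have "\<dots> = ?G * exp (C0 * T) / c / jb k ^ (j + 3)"
    using jb_pos[of k] c_pos by (simp add: field_simps power_add power_numeral_reduce)
  finally have "cmod (duh (sg k) (g k) t) \<le> ?G * exp (C0 * T) / c / jb k ^ (j + 3)" .
  then have "cmod (duh (sg k) (g k) t) * jb k ^ (j + 3) \<le> ?G * exp (C0 * T) / c"
    by (subst (asm) pos_le_divide_eq) (simp_all add: jb_pos)
  then show ?thesis by (simp only: mult.commute)
qed

text \<open>Each round gains one derivative: of the net three powers of \<open>duh_weight\<close>,
  two are spent on square summability. The induction ends at two, the regularity of the
  datum.\<close>

lemma f_weight: "j \<le> 2 \<Longrightarrow> \<exists>D. \<forall>t\<in>{0..T}. l2bd (\<lambda>k. of_real (jb k ^ j) * f t k) D"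
proof (induction j)
  case 0
  then show ?case using f_bd by (intro exI[of _ A]) simp
next
  case (Suc j)
  have "\<exists>D. \<forall>t\<in>{0..T}. l2bd (\<lambda>k. of_real (jb k ^ j) * f t k) D"
    by (rule Suc.IH) (use Suc.prems in simp)
  then obtain D where D: "\<And>t. t \<in> {0..T} \<Longrightarrow> l2bd (\<lambda>k. of_real (jb k ^ j) * f t k) D" by blast
  let ?W = "2 ^ j * (2 * D * A) * exp (C0 * T) / c"
  have D0: "0 \<le> D" using l2bd_nonneg[OF D[of 0]] T_pos by simp
  have "l2bd (\<lambda>k. of_real (jb k ^ Suc j) * f t k) (exp (C0 * T) * B + ?W * sqrt jsum)" if t: "t \<in> {0..T}" for t
  proof -
    have "l2bd (\<lambda>k. of_real (jb k ^ Suc j) * duh (sg k) (g k) t) (?W * sqrt jsum)"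
    proof (rule l2bd_decay)
      fix k
      have "cmod (of_real (jb k ^ Suc j) * duh (sg k) (g k) t) * (jb k)\<^sup>2
          = jb k ^ (j + 3) * cmod (duh (sg k) (g k) t)"
        by (simp add: norm_mult norm_power jb_nonneg power_add power_numeral_reduce mult_ac)
      also have "\<dots> \<le> ?W" by (rule duh_weight[OF D t])
      finally show "cmod (of_real (jb k ^ Suc j) * duh (sg k) (g k) t) \<le> ?W / (jb k)\<^sup>2"
        using jb_pos[of k] by (subst pos_le_divide_eq) auto
    qed (use D0 A_nonneg c_pos in simp)
    from l2bd_diff[OF linear_weight[OF t Suc.prems] this] show ?thesis
      by (simp only: f_eq[OF t] right_diff_distrib)
  qed
  then show ?case by blast
qed

lemma duh_decay: "\<exists>W\<ge>0. \<forall>t\<in>{0..T}. \<forall>k. jb k ^ 5 * cmod (duh (sg k) (g k) t) \<le> W"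
proof -
  obtain D where D: "\<And>t. t \<in> {0..T} \<Longrightarrow> l2bd (\<lambda>k. of_real (jb k ^ 2) * f t k) D"
    using f_weight[OF order_refl] by blast
  have "0 \<le> D" using l2bd_nonneg[OF D[of 0]] T_pos by simp
  then have "0 \<le> 2 ^ 2 * (2 * D * A) * exp (C0 * T) / c" using A_nonneg c_pos by simp
  moreover have "\<forall>t\<in>{0..T}. \<forall>k. jb k ^ 5 * cmod (duh (sg k) (g k) t) \<le> 2 ^ 2 * (2 * D * A) * exp (C0 * T) / c"
    using duh_weight[OF D] by simp
  ultimately show ?thesis by blast
qed

text \<open>A majorant for each mode, uniform in time, is stronger than a uniform bound of norms. It
  is what continuity in H^2 and the uniform convergence of the energy flux rest on.\<close>

lemma f_majorant:
  "\<exists>D. D summable_on UNIV \<and> (\<forall>t\<in>{0..T}. \<forall>k. (cmod (of_real ((jb k)\<^sup>2) * f t k))\<^sup>2 \<le> D k)"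
proof -
  obtain W where W: "0 \<le> W" "\<And>t k. t \<in> {0..T} \<Longrightarrow> jb k ^ 5 * cmod (duh (sg k) (g k) t) \<le> W"
    using duh_decay by blast
  let ?D = "\<lambda>k. 2 * ((exp (C0 * T))\<^sup>2 * (cmod (of_real ((jb k)\<^sup>2) * a0 k))\<^sup>2) + 2 * (W\<^sup>2 * (1 / jb k ^ 4))"
  have "?D summable_on UNIV"
    by (intro summable_on_add summable_on_cmult_right l2bd_summable[OF a0_bd] summable_on_jb)
  moreover have "(cmod (of_real ((jb k)\<^sup>2) * f t k))\<^sup>2 \<le> ?D k" if t: "t \<in> {0..T}" for t k
  proof -
    have "cmod (of_real ((jb k)\<^sup>2) * (of_real (exp (- sg k * t)) * a0 k))
        = exp (- sg k * t) * cmod (of_real ((jb k)\<^sup>2) * a0 k)"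
      by (simp add: norm_mult)
    also have "\<dots> \<le> exp (C0 * T) * cmod (of_real ((jb k)\<^sup>2) * a0 k)"
      using t by (intro mult_right_mono exp_sg_le') auto
    finally have "cmod (of_real ((jb k)\<^sup>2) * (of_real (exp (- sg k * t)) * a0 k))
        \<le> exp (C0 * T) * cmod (of_real ((jb k)\<^sup>2) * a0 k)" .
    then have 1: "(cmod (of_real ((jb k)\<^sup>2) * (of_real (exp (- sg k * t)) * a0 k)))\<^sup>2
        \<le> (exp (C0 * T) * cmod (of_real ((jb k)\<^sup>2) * a0 k))\<^sup>2"
      by (rule power_mono) simp
    have "(jb k)\<^sup>2 * cmod (duh (sg k) (g k) t) \<le> W / jb k ^ 3"
      using W(2)[OF t, of k] jb_pos[of k] by (simp add: field_simps power_numeral_reduce)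
    also have "\<dots> \<le> W / (jb k)\<^sup>2"
      using W(1) jb_pos[of k] jb_ge_1[of k] by (intro divide_left_mono power_increasing mult_pos_pos) auto
    finally have "cmod (of_real ((jb k)\<^sup>2) * duh (sg k) (g k) t) \<le> W / (jb k)\<^sup>2"
      by (simp add: norm_mult norm_power)
    then have 2: "(cmod (of_real ((jb k)\<^sup>2) * duh (sg k) (g k) t))\<^sup>2 \<le> (W / (jb k)\<^sup>2)\<^sup>2"
      by (rule power_mono) simp
    have eq: "of_real ((jb k)\<^sup>2) * f t k = of_real ((jb k)\<^sup>2) * (of_real (exp (- sg k * t)) * a0 k)
        - of_real ((jb k)\<^sup>2) * duh (sg k) (g k) t"
      by (simp only: f_eq[OF t] right_diff_distrib)
    show ?thesis unfolding eq
      using square_le_sum_squares[of "of_real ((jb k)\<^sup>2) * (of_real (exp (- sg k * t)) * a0 k)"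
          "of_real ((jb k)\<^sup>2) * duh (sg k) (g k) t"] 1 2
      by (simp only: power_mult_distrib power_divide power_mult[symmetric]) (simp add: power_divide)
  qed
  ultimately show ?thesis by blast
qed

text \<open>The price of one derivative under the semigroup. With y = c J^4 s one has J = (y / (c
  s))^(1/4), so the price is of order s^(-1/4) and its square is integrable at zero.\<close>

definition rho :: "real \<Rightarrow> real" where
  "rho s = (1 / (c * s)) powr (1 / 4)"

lemma rho_nonneg: "0 \<le> rho s"
  by (simp add: rho_def)

lemma rho_antimono: "0 < s \<Longrightarrow> s \<le> t \<Longrightarrow> rho t \<le> rho s"
  unfolding rho_def using c_pos by (intro powr_mono2) (auto intro!: divide_left_mono)

text \<open>Taking fourth powers reduces the claim to y exp(- 4 y) \<le> 1.\<close>

lemma smoothing: "0 < s \<Longrightarrow> jb k * exp (- c * jb k ^ 4 * s) \<le> rho s"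
proof -
  assume s: "0 < s"
  define y where "y = c * jb k ^ 4 * s"
  have y: "0 \<le> y" using s c_pos jb_nonneg[of k] by (simp add: y_def)
  have "y \<le> exp y" using exp_ge_add_one_self[of y] by linarith
  also have "\<dots> \<le> exp (4 * y)" using y by simp
  finally have ye: "y * exp (- (4 * y)) \<le> 1" by (simp add: exp_minus field_simps)
  have "(jb k * exp (- y)) ^ 4 = jb k ^ 4 * exp (- (4 * y))"
    by (simp add: power_mult_distrib flip: exp_of_nat_mult)
  also have "\<dots> = (y * exp (- (4 * y))) / (c * s)" using s c_pos by (simp add: y_def)
  also have "\<dots> \<le> 1 / (c * s)" using ye s c_pos by (intro divide_right_mono) auto
  also have "\<dots> = rho s ^ 4"
  proof -
    have "rho s ^ 4 = rho s powr 4" using s c_pos by (simp add: rho_def powr_numeral)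
    also have "\<dots> = 1 / (c * s)" using s c_pos unfolding rho_def powr_powr by simp
    finally show ?thesis by simp
  qed
  finally have le: "(jb k * exp (- y)) ^ 4 \<le> rho s ^ 4" .
  have "jb k * exp (- y) \<le> rho s"
  proof (rule ccontr)
    assume "\<not> ?thesis"
    then have "rho s ^ 4 < (jb k * exp (- y)) ^ 4"
      by (intro power_strict_mono) (auto simp: rho_nonneg)
    with le show False by simp
  qed
  then show ?thesis by (simp add: y_def)
qed

text \<open>For positive times the solution has a third derivative: the linear part pays
  \<open>rho\<close> for it, and the integral part has it anyway, since \<open>duh_decay\<close>
  leaves J^-2 after the weight J^3. The nonlinearity, one derivative rougher, then carries the
  weight J^2.\<close>

lemma f_weight3:
  "\<exists>H\<ge>0. \<forall>s\<in>{0<..T}. \<forall>k. (jb k)\<^sup>2 * cmod (g k s) \<le> H * (1 + rho s)"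
proof -
  obtain W where W: "0 \<le> W" "\<And>t k. t \<in> {0..T} \<Longrightarrow> jb k ^ 5 * cmod (duh (sg k) (g k) t) \<le> W"
    using duh_decay by blast
  let ?X = "exp (C0 * T) * B" and ?Y = "W * sqrt jsum"
  have XY: "0 \<le> ?X" "0 \<le> ?Y" using B_nonneg W(1) jsum_nonneg by auto
  have "(jb k)\<^sup>2 * cmod (g k s) \<le> 2 ^ 3 * (2 * (?X + ?Y) * A) * (1 + rho s)" if s: "s \<in> {0<..T}" for s k
  proof -
    have t: "s \<in> {0..T}" using s by auto
    have "l2bd (\<lambda>k. of_real (jb k ^ 3) * (of_real (exp (- sg k * s)) * a0 k)) (exp (C0 * T) * rho s * B)"
    proof (rule l2bd_mono)
      show "l2bd (\<lambda>k. of_real (exp (C0 * T) * rho s) * (of_real ((jb k)\<^sup>2) * a0 k)) (exp (C0 * T) * rho s * B)"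
        using l2bd_cmult[OF a0_bd, of "of_real (exp (C0 * T) * rho s)"] by (simp add: norm_mult rho_nonneg)
      fix k
      have "jb k * exp (- sg k * s) \<le> jb k * (exp (C0 * T) * exp (- c * jb k ^ 4 * s))"
        using s by (intro mult_left_mono exp_sg_le jb_nonneg) auto
      also have "\<dots> = exp (C0 * T) * (jb k * exp (- c * jb k ^ 4 * s))" by simp
      also have "\<dots> \<le> exp (C0 * T) * rho s" using s by (intro mult_left_mono smoothing) auto
      finally have "(jb k * exp (- sg k * s)) * ((jb k)\<^sup>2 * cmod (a0 k)) \<le> exp (C0 * T) * rho s * ((jb k)\<^sup>2 * cmod (a0 k))"
        by (intro mult_right_mono) auto
      then show "cmod (of_real (jb k ^ 3) * (of_real (exp (- sg k * s)) * a0 k))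
          \<le> cmod (of_real (exp (C0 * T) * rho s) * (of_real ((jb k)\<^sup>2) * a0 k))"
        by (simp add: norm_mult norm_power rho_nonneg jb_nonneg power_numeral_reduce mult_ac)
    qed simp
    moreover have "l2bd (\<lambda>k. of_real (jb k ^ 3) * duh (sg k) (g k) s) ?Y"
    proof (rule l2bd_decay)
      fix k
      show "cmod (of_real (jb k ^ 3) * duh (sg k) (g k) s) \<le> W / (jb k)\<^sup>2"
        using W(2)[OF t, of k] jb_pos[of k] by (simp add: norm_mult norm_power field_simps power_numeral_reduce)
    qed (rule W(1))
    ultimately have "l2bd (\<lambda>k. of_real (jb k ^ 3) * (of_real (exp (- sg k * s)) * a0 k)
        - of_real (jb k ^ 3) * duh (sg k) (g k) s) (exp (C0 * T) * rho s * B + ?Y)"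
      by (rule l2bd_diff)
    then have "l2bd (\<lambda>k. of_real (jb k ^ 3) * f s k) (exp (C0 * T) * rho s * B + ?Y)"
      by (simp only: f_eq[OF t] right_diff_distrib)
    then have l3: "l2bd (\<lambda>k. of_real (jb k ^ 3) * f s k) ((?X + ?Y) * (1 + rho s))"
    proof (rule l2bd_mono)
      show "exp (C0 * T) * rho s * B + ?Y \<le> (?X + ?Y) * (1 + rho s)"
        using mult_nonneg_nonneg[OF XY(2) rho_nonneg[of s]] XY by (simp add: algebra_simps)
    qed simp
    from g_weight[OF t l3, of k] have "jb k * ((jb k)\<^sup>2 * cmod (g k s))
        \<le> jb k * (2 ^ 3 * (2 * ((?X + ?Y) * (1 + rho s)) * A))"
      by (simp add: power_numeral_reduce mult.assoc)
    then have "(jb k)\<^sup>2 * cmod (g k s) \<le> 2 ^ 3 * (2 * ((?X + ?Y) * (1 + rho s)) * A)"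
      using jb_pos[of k] by (simp only: mult_le_cancel_left_pos)
    then show ?thesis by (simp only: mult_ac)
  qed
  moreover have "0 \<le> 2 ^ 3 * (2 * (?X + ?Y) * A)" using XY A_nonneg by simp
  ultimately show ?thesis by blast
qed

text \<open>On \<open>[0, t/2]\<close> the decay comes from the semigroup, on \<open>[t/2, t]\<close> from the smoothness of the
  solution at positive times.\<close>

lemma duh_decay_smooth:
  "\<exists>E\<ge>0. \<forall>t\<in>{0<..T}. \<forall>k. jb k ^ 6 * cmod (duh (sg k) (g k) t) \<le> E * (1 + rho (t / 2))"
proof -
  obtain D where D: "\<And>t. t \<in> {0..T} \<Longrightarrow> l2bd (\<lambda>k. of_real (jb k ^ 2) * f t k) D"
    using f_weight[OF order_refl] by blast
  have "0 \<le> D" using l2bd_nonneg[OF D[of 0]] T_pos by simp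
  define G where "G = 2 ^ 2 * (2 * D * A)"
  have G: "0 \<le> G" using A_nonneg \<open>0 \<le> D\<close> by (simp add: G_def)
  obtain H where H: "0 \<le> H" "\<And>s k. s \<in> {0<..T} \<Longrightarrow> (jb k)\<^sup>2 * cmod (g k s) \<le> H * (1 + rho s)"
    using f_weight3 by blast
  have aux: "x * e * r + y * r * e = ((x + y) * e) * r" for x y e r :: real
    by (simp add: algebra_simps)
  let ?e = "exp (C0 * T) / c"
  have e: "0 \<le> ?e" using c_pos by simp
  have "jb k ^ 6 * cmod (duh (sg k) (g k) t) \<le> ((G + H) * ?e) * (1 + rho (t / 2))" if t: "t \<in> {0<..T}" for t k
  proof -
    have tT: "0 < t" "t \<le> T" using t by auto
    note jp = jb_pos[of k]
    have expC: "1 \<le> exp (C0 * s)" if "0 \<le> s" for s using that C0_nonneg by simp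
    have expCT: "exp (C0 * t) \<le> exp (C0 * T)" using tT C0_nonneg by (simp add: mult_left_mono)
    let ?I1 = "of_real (exp (- sg k * t)) * integral {0..t / 2} (\<lambda>s. of_real (exp (sg k * s)) * g k s)"
    let ?I2 = "of_real (exp (- sg k * t)) * integral {t / 2..t} (\<lambda>s. of_real (exp (sg k * s)) * g k s)"
    \<comment> \<open>The nonlinearity supplies one negative power of \<open>jb k\<close> and the
      integral four; the missing sixth comes from the exponential decay over the gap of length t /
      2.\<close>
    have "cmod ?I1 \<le> (G / jb k) * exp (C0 * t) * exp (- (sg k + C0) * (t - t / 2)) / (sg k + C0)"
    proof (rule duh_segment)
      fix s assume s: "s \<in> {0..t / 2}"
      have "cmod (g k s) \<le> G / jb k"
        using g_weight[OF _ D, of s k] s tT jp by (simp add: G_def field_simps power2_eq_square)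
      also have "\<dots> \<le> G / jb k * exp (C0 * s)"
        using mult_left_mono[OF expC, of s "G / jb k"] s G jp by simp
      finally show "cmod (g k s) \<le> G / jb k * exp (C0 * s)" .
    qed (use tT sg_C0_pos in \<open>auto intro!: cont_g_sub\<close>)
    also have "\<dots> \<le> (G / jb k) * exp (C0 * T) * exp (- c * jb k ^ 4 * (t / 2)) / (c * jb k ^ 4)"
    proof (intro frac_le mult_mono)
      have "c * jb k ^ 4 * (t / 2) \<le> (sg k + C0) * (t / 2)"
        using tT by (intro mult_right_mono sg_lower) auto
      then show "exp (- (sg k + C0) * (t - t / 2)) \<le> exp (- c * jb k ^ 4 * (t / 2))"
        by (simp add: algebra_simps)
    qed (use G jp c_pos expCT sg_lower in auto)
    finally have "jb k ^ 6 * cmod ?I1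
        \<le> jb k ^ 6 * ((G / jb k) * exp (C0 * T) * exp (- c * jb k ^ 4 * (t / 2)) / (c * jb k ^ 4))"
      by (rule mult_left_mono) (simp add: jb_nonneg)
    also have "\<dots> = G * ?e * (jb k * exp (- c * jb k ^ 4 * (t / 2)))"
      using jp c_pos by (simp add: field_simps power_numeral_reduce)
    also have "\<dots> \<le> G * ?e * rho (t / 2)"
      using tT by (intro mult_left_mono smoothing mult_nonneg_nonneg[OF G e]) auto
    finally have 1: "jb k ^ 6 * cmod ?I1 \<le> G * ?e * rho (t / 2)" .
    let ?h = "H * (1 + rho (t / 2))"
    have h0: "0 \<le> ?h" using H(1) rho_nonneg[of "t / 2"] by simp
    \<comment> \<open>This segment ends at t and leaves no gap. The nonlinearity itself supplies two
      powers here, at a price that is largest at s = t / 2.\<close>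
    have "cmod ?I2 \<le> (?h / (jb k)\<^sup>2) * exp (C0 * t) * exp (- (sg k + C0) * (t - t)) / (sg k + C0)"
    proof (rule duh_segment)
      fix s assume s: "s \<in> {t / 2..t}"
      have "(jb k)\<^sup>2 * cmod (g k s) \<le> H * (1 + rho s)" using s tT by (intro H(2)) auto
      also have "\<dots> \<le> ?h" using s tT H(1) by (intro mult_left_mono add_left_mono rho_antimono) auto
      finally have "cmod (g k s) \<le> ?h / (jb k)\<^sup>2" using jp by (simp add: field_simps)
      also have "\<dots> \<le> ?h / (jb k)\<^sup>2 * exp (C0 * s)"
        using mult_left_mono[OF expC, of s "?h / (jb k)\<^sup>2"] s tT h0 by simp
      finally show "cmod (g k s) \<le> ?h / (jb k)\<^sup>2 * exp (C0 * s)" .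
    qed (use tT sg_C0_pos in \<open>auto intro!: cont_g_sub\<close>)
    also have "\<dots> \<le> (?h / (jb k)\<^sup>2) * exp (C0 * T) * 1 / (c * jb k ^ 4)"
      by (intro frac_le mult_mono) (use H(1) rho_nonneg[of "t / 2"] jp c_pos expCT sg_lower in auto)
    finally have "jb k ^ 6 * cmod ?I2 \<le> jb k ^ 6 * ((?h / (jb k)\<^sup>2) * exp (C0 * T) * 1 / (c * jb k ^ 4))"
      by (rule mult_left_mono) (simp add: jb_nonneg)
    also have "\<dots> = ?h * ?e"
      using jp c_pos by (simp add: field_simps power_numeral_reduce)
    finally have 2: "jb k ^ 6 * cmod ?I2 \<le> ?h * ?e" .
    have "jb k ^ 6 * cmod (duh (sg k) (g k) t) \<le> jb k ^ 6 * (cmod ?I1 + cmod ?I2)"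
      by (subst duh_split[of t _ "t / 2"])
        (use tT in \<open>auto intro!: mult_left_mono norm_triangle_ineq cont_g_sub simp: jb_nonneg\<close>)
    also have "\<dots> \<le> G * ?e * rho (t / 2) + ?h * ?e" using 1 2 by (simp add: distrib_left)
    also have "\<dots> \<le> G * ?e * (1 + rho (t / 2)) + ?h * ?e"
      by (intro add_right_mono mult_left_mono mult_nonneg_nonneg[OF G e]) auto
    also have "\<dots> = ((G + H) * ?e) * (1 + rho (t / 2))" by (rule aux)
    finally show ?thesis .
  qed
  moreover have "0 \<le> (G + H) * ?e" by (intro mult_nonneg_nonneg add_nonneg_nonneg G H(1) e)
  ultimately show ?thesis by blast
qed

lemma energy_derivative:
  assumes t: "t \<in> {0..T}"
  shows "((\<lambda>t. (cmod (f t k))\<^sup>2) has_real_derivative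
      (- 2 * sg k * (cmod (f t k))\<^sup>2 - 2 * Re (cnj (f t k) * g k t))) (at t within {0..T})"
proof -
  have re: "((\<lambda>t. Re (f t k)) has_real_derivative Re (- of_real (sg k) * f t k - g k t)) (at t within {0..T})"
    unfolding has_real_derivative_iff_has_vector_derivative
    using bounded_linear.has_vector_derivative[OF bounded_linear_Re f_deriv[OF t]] by simp
  have im: "((\<lambda>t. Im (f t k)) has_real_derivative Im (- of_real (sg k) * f t k - g k t)) (at t within {0..T})"
    unfolding has_real_derivative_iff_has_vector_derivative
    using bounded_linear.has_vector_derivative[OF bounded_linear_Im f_deriv[OF t]] by simp
  show ?thesis unfolding cmod_power2
    by (rule DERIV_cong[OF DERIV_add[OF DERIV_power[OF re] DERIV_power[OF im]]])
      (simp add: algebra_simps power2_eq_square)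
qed

text \<open>The flux vanishes for the full sum only. Smallness for large finite sets, uniformly in
  time, allows the energy argument to run on finitely many modes, where differentiation of the sum
  is immediate. The uniformity comes from a summable majorant of the flux of each mode.\<close>

lemma energy_flux_small:
  assumes e: "0 < e"
  shows "\<forall>\<^sub>F F in finite_subsets_at_top UNIV. \<forall>t\<in>{0..T}. \<bar>\<Sum>k\<in>F. Re (cnj (f t k) * g k t)\<bar> < e"
proof -
  obtain D where D: "\<And>t. t \<in> {0..T} \<Longrightarrow> l2bd (\<lambda>k. of_real ((jb k)\<^sup>2) * f t k) D"
    using f_weight[OF order_refl] by blast
  obtain M where M: "M summable_on UNIV"
    "\<And>t k. t \<in> {0..T} \<Longrightarrow> (cmod (of_real ((jb k)\<^sup>2) * f t k))\<^sup>2 \<le> M k"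
    using f_majorant by blast
  define G where "G = 2 ^ 2 * (2 * D * A)"
  have "uniform_limit {0..T} (\<lambda>F t. \<Sum>k\<in>F. cnj (f t k) * nl (f t) k) (\<lambda>t. \<Sum>\<^sub>\<infinity>k. cnj (f t k) * nl (f t) k)
      (finite_subsets_at_top UNIV)"
  proof (rule Weierstrass_m_test_general)
    show "(\<lambda>k. M k + G\<^sup>2 * (1 / jb k ^ 4)) summable_on UNIV"
      by (intro summable_on_add summable_on_cmult_right M summable_on_jb)
    fix k t assume t: "t \<in> {0..T}"
    define x where "x = (jb k)\<^sup>2 * cmod (f t k)"
    have nlb: "cmod (nl (f t) k) \<le> G / jb k"
      using nl_tame[OF D[OF t] f_bd[OF t], of k] jb_pos[of k] by (simp add: G_def field_simps power2_eq_square)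
    have G0: "0 \<le> G" using order_trans[OF norm_ge_zero nlb] jb_pos[of k] by (simp add: zero_le_divide_iff)
    have "norm (cnj (f t k) * nl (f t) k) \<le> cmod (f t k) * (G / jb k)"
      unfolding norm_mult complex_mod_cnj by (rule mult_left_mono[OF nlb norm_ge_zero])
    also have "\<dots> = x * (G / jb k ^ 3)" using jb_pos[of k] by (simp add: x_def field_simps power_numeral_reduce)
    also have "\<dots> \<le> x * (G / (jb k)\<^sup>2)"
      using G0 jb_pos[of k] jb_ge_1[of k]
      by (intro mult_left_mono divide_left_mono power_increasing mult_pos_pos) (auto simp: x_def)
    also have "\<dots> \<le> x\<^sup>2 + (G / (jb k)\<^sup>2)\<^sup>2"
    proof -
      have "0 \<le> (x - G / (jb k)\<^sup>2)\<^sup>2" by simp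
      moreover have "0 \<le> x * (G / (jb k)\<^sup>2)" using G0 by (simp add: x_def)
      ultimately show ?thesis by (simp only: power2_diff)
    qed
    also have "\<dots> \<le> M k + G\<^sup>2 * (1 / jb k ^ 4)"
      using M(2)[OF t, of k] by (simp add: x_def norm_mult norm_power power_divide)
    finally show "norm (cnj (f t k) * nl (f t) k) \<le> M k + G\<^sup>2 * (1 / jb k ^ 4)" .
  qed
  from uniform_limitD[OF this e] show ?thesis
  proof eventually_elim
    case (elim F)
    show ?case
    proof
      fix t assume t: "t \<in> {0..T}"
      have "(\<Sum>\<^sub>\<infinity>k. cnj (f t k) * nl (f t) k) = 0" by (rule nl_orthogonal[OF f_herm[OF t] D[OF t]])
      then have b: "cmod (\<Sum>k\<in>F. cnj (f t k) * nl (f t) k) < e" using bspec[OF elim t] by (simp add: dist_norm)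
      have eq: "(\<Sum>k\<in>F. Re (cnj (f t k) * g k t)) = q t * Re (\<Sum>k\<in>F. cnj (f t k) * nl (f t) k)"
        unfolding Re_sum sum_distrib_left by (rule sum.cong) (simp_all add: algebra_simps)
      have "\<bar>\<Sum>k\<in>F. Re (cnj (f t k) * g k t)\<bar> \<le> 1 * cmod (\<Sum>k\<in>F. cnj (f t k) * nl (f t) k)"
        unfolding eq abs_mult using q_range[OF t] by (intro mult_mono abs_Re_le_cmod) auto
      then show "\<bar>\<Sum>k\<in>F. Re (cnj (f t k) * g k t)\<bar> < e" using b by simp
    qed
  qed
qed

text \<open>After multiplication by exp(- 2 C0 t) the linear terms are dissipative, since
  \<open>sg k + C0\<close> is positive, so the energy of finitely many modes can grow only through
  the flux. The given set \<open>F0\<close> is enlarged until the flux is small, and the error e is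
  finally sent to zero.\<close>

lemma energy_bound:
  assumes N: "l2bd a0 N" and t: "t \<in> {0..T}"
  shows "l2bd (f t) (exp (C0 * T) * N)"
proof (rule l2bd_finite_sums)
  show "0 \<le> exp (C0 * T) * N" using l2bd_nonneg[OF N] by simp
  fix F0 :: "(int \<times> int) set" assume F0: "finite F0"
  have key: "exp (- 2 * C0 * t) * (\<Sum>k\<in>F0. (cmod (f t k))\<^sup>2) \<le> N\<^sup>2 + e" if e: "0 < e" for e
  proof (cases "t = 0")
    case True
    have "(\<Sum>k\<in>F0. (cmod (a0 k))\<^sup>2) \<le> N\<^sup>2" using N F0 by (auto simp: l2bd_def L2_set_def intro: sqrt_le_D)
    then show ?thesis using True e by (simp add: f_0)
  next
    case False
    then have tp: "0 < t" "t \<le> T" using t by auto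
    \<comment> \<open>The flux enters the derivative of the energy with the factor 2 and acts for a
      time at most T, so the energy gains at most e.\<close>
    define e' where "e' = e / (2 * T)"
    have e': "0 < e'" using e T_pos by (simp add: e'_def)
    have "\<forall>\<^sub>F F in finite_subsets_at_top UNIV. finite F \<and> F0 \<subseteq> F"
      unfolding eventually_finite_subsets_at_top by (intro exI[of _ F0]) (auto simp: F0)
    with energy_flux_small[OF e'] have "\<forall>\<^sub>F F in finite_subsets_at_top UNIV. (finite F \<and> F0 \<subseteq> F) \<and>
        (\<forall>t\<in>{0..T}. \<bar>\<Sum>k\<in>F. Re (cnj (f t k) * g k t)\<bar> < e')"
      by eventually_elim auto
    then obtain F where F: "finite F" "F0 \<subseteq> F" "\<And>t. t \<in> {0..T} \<Longrightarrow> \<bar>\<Sum>k\<in>F. Re (cnj (f t k) * g k t)\<bar> < e'"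
      by (auto dest: eventually_happens' [OF finite_subsets_at_top_neq_bot])
    define y where "y s = exp (- 2 * C0 * s) * (\<Sum>k\<in>F. (cmod (f s k))\<^sup>2)" for s
    define y' where "y' s = exp (- 2 * C0 * s) * (\<Sum>k\<in>F. - 2 * sg k * (cmod (f s k))\<^sup>2 - 2 * Re (cnj (f s k) * g k s))
        + (- 2 * C0 * exp (- 2 * C0 * s)) * (\<Sum>k\<in>F. (cmod (f s k))\<^sup>2)" for s
    have dy: "(y has_real_derivative y' s) (at s within {0..t})" if s: "s \<in> {0..t}" for s
    proof -
      have s': "s \<in> {0..T}" using s tp by auto
      have sub: "{0..t} \<subseteq> {0..T}" using tp by auto
      have 1: "((\<lambda>s. \<Sum>k\<in>F. (cmod (f s k))\<^sup>2) has_real_derivative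
          (\<Sum>k\<in>F. - 2 * sg k * (cmod (f s k))\<^sup>2 - 2 * Re (cnj (f s k) * g k s))) (at s within {0..t})"
        by (rule DERIV_sum) (rule has_field_derivative_subset[OF energy_derivative[OF s'] sub])
      have 2: "((\<lambda>s. exp (- 2 * C0 * s)) has_real_derivative (- 2 * C0 * exp (- 2 * C0 * s))) (at s within {0..t})"
        by (auto intro!: derivative_eq_intros)
      show ?thesis unfolding y_def[abs_def] y'_def
        by (rule DERIV_cong[OF DERIV_mult[OF 2 1]]) simp
    qed
    have y'le: "y' s \<le> 2 * e'" if s: "s \<in> {0..t}" for s
    proof -
      have s': "s \<in> {0..T}" using s tp by auto
      have "(\<Sum>k\<in>F. - 2 * sg k * (cmod (f s k))\<^sup>2 - 2 * Re (cnj (f s k) * g k s)) + (- 2 * C0) * (\<Sum>k\<in>F. (cmod (f s k))\<^sup>2)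
          = (\<Sum>k\<in>F. - 2 * (sg k + C0) * (cmod (f s k))\<^sup>2) - 2 * (\<Sum>k\<in>F. Re (cnj (f s k) * g k s))"
        by (simp add: sum_distrib_left sum_subtractf sum.distrib algebra_simps sum_negf)
      also have "\<dots> \<le> 0 + 2 * e'"
      proof -
        have "(\<Sum>k\<in>F. - 2 * (sg k + C0) * (cmod (f s k))\<^sup>2) \<le> 0"
        proof (rule sum_nonpos, rule mult_nonpos_nonneg)
          show "- 2 * (sg k + C0) \<le> 0" for k using sg_C0_pos[of k] by simp
        qed simp
        then show ?thesis using F(3)[OF s'] by linarith
      qed
      finally have le: "(\<Sum>k\<in>F. - 2 * sg k * (cmod (f s k))\<^sup>2 - 2 * Re (cnj (f s k) * g k s))
          + (- 2 * C0) * (\<Sum>k\<in>F. (cmod (f s k))\<^sup>2) \<le> 2 * e'" by simp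
      have "y' s = exp (- 2 * C0 * s) * ((\<Sum>k\<in>F. - 2 * sg k * (cmod (f s k))\<^sup>2 - 2 * Re (cnj (f s k) * g k s))
          + (- 2 * C0) * (\<Sum>k\<in>F. (cmod (f s k))\<^sup>2))"
        by (simp only: y'_def distrib_left mult_ac)
      also have "\<dots> \<le> exp (- 2 * C0 * s) * (2 * e')"
        by (rule mult_left_mono[OF le]) simp
      also have "\<dots> \<le> 1 * (2 * e')" using e' s C0_nonneg by (intro mult_right_mono) auto
      finally show ?thesis by simp
    qed
    have "\<exists>s\<in>{0<..<t}. y t - y 0 = (\<lambda>x. x * y' s) (t - 0)"
    proof (rule mvt_simple[OF tp(1)])
      fix s assume s: "0 \<le> s" "s \<le> t"
      show "(y has_derivative (\<lambda>x. x * y' s)) (at s within {0..t})"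
        using dy[of s] s by (simp add: has_field_derivative_def mult_commute_abs)
    qed
    then obtain s where s: "s \<in> {0<..<t}" "y t - y 0 = t * y' s" by auto
    have "t * y' s \<le> T * (2 * e')"
      using y'le[of s] s(1) tp e' by (intro order_trans[OF mult_left_mono[OF y'le] mult_right_mono]) auto
    then have "y t \<le> y 0 + e" using s(2) T_pos by (simp add: e'_def)
    also have "y 0 \<le> N\<^sup>2"
      using N F(1) by (auto simp: y_def f_0 l2bd_def L2_set_def intro: sqrt_le_D)
    finally have "y t \<le> N\<^sup>2 + e" by simp
    moreover have "exp (- 2 * C0 * t) * (\<Sum>k\<in>F0. (cmod (f t k))\<^sup>2) \<le> y t"
      unfolding y_def by (intro mult_left_mono sum_mono2 F) auto
    ultimately show ?thesis by simp
  qed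
  then have "exp (- 2 * C0 * t) * (\<Sum>k\<in>F0. (cmod (f t k))\<^sup>2) \<le> N\<^sup>2"
    by (rule field_le_epsilon)
  then have "exp (2 * C0 * t) * (exp (- 2 * C0 * t) * (\<Sum>k\<in>F0. (cmod (f t k))\<^sup>2)) \<le> exp (2 * C0 * t) * N\<^sup>2"
    by (rule mult_left_mono) simp
  also have "exp (2 * C0 * t) * (exp (- 2 * C0 * t) * (\<Sum>k\<in>F0. (cmod (f t k))\<^sup>2)) = (\<Sum>k\<in>F0. (cmod (f t k))\<^sup>2)"
    by (simp flip: mult.assoc exp_add)
  also have "exp (2 * C0 * t) * N\<^sup>2 \<le> exp (2 * C0 * T) * N\<^sup>2"
    using t C0_nonneg by (intro mult_right_mono) (auto simp: mult_left_mono)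
  also have "\<dots> = (exp (C0 * T) * N)\<^sup>2"
    by (simp add: power_mult_distrib flip: exp_of_nat_mult)
  finally show "(\<Sum>k\<in>F0. (cmod (f t k))\<^sup>2) \<le> (exp (C0 * T) * N)\<^sup>2" .
qed

end

context symbol
begin

text \<open>Since \<open>nl\<close> is quadratic, the retraction turns it into
  \<open>(\<theta> t)\<^sup>2\<close> times itself; the truncated solution is thus a
  \<open>mild_sol\<close> with this factor, and the energy bound holds for it before the truncation
  is removed. The orthogonality behind that bound requires Hermitian coefficients, which are
  obtained beforehand.\<close>

lemma mild_existence:
  assumes a0: "l2bd (\<lambda>k. of_real ((jb k)\<^sup>2) * a0 k) B" and h: "herm a0"
  shows "\<exists>f A. mild_sol sg c C0 C1 T f a0 (\<lambda>_. 1) A B"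
proof -
  have "l2bd a0 B"
  proof (rule l2bd_mono[OF a0])
    fix k
    have "1 * cmod (a0 k) \<le> (jb k)\<^sup>2 * cmod (a0 k)"
      using jb_ge_1[of k] by (intro mult_right_mono) (auto simp: one_le_power)
    then show "cmod (a0 k) \<le> cmod (of_real ((jb k)\<^sup>2) * a0 k)" by (simp add: norm_mult norm_power)
  qed simp
  then obtain a where a: "cf a = a0" using l2_exists by blast
  \<comment> \<open>The energy bound, increased by 1 so that the radius is positive for the zero
    datum as well.\<close>
  define R where "R = exp (C0 * T) * norm a + 1"
  have R: "0 < R" by (simp add: R_def add_nonneg_pos)
  obtain x where x: "continuous_on {0..T} x" and xphi: "\<And>t. t \<in> {0..T} \<Longrightarrow> x t = phi R a x t"
    using truncated_solution[OF R, of a] by blast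
  have xeq: "cf (x t) k = of_real (exp (- sg k * t)) * a0 k - duh (sg k) (\<lambda>s. tnl R k (x s)) t"
    if "t \<in> {0..T}" for t k
    using cf_phi[OF R x that, of a k] xphi[OF that] by (simp add: a)
  have "compact (x ` {0..T})" by (intro compact_continuous_image x compact_Icc)
  then obtain A where A: "\<And>t. t \<in> {0..T} \<Longrightarrow> norm (x t) \<le> A"
    by (metis bounded_iff compact_imp_bounded imageI)
  define \<theta> where "\<theta> t = R / max R (norm (x t))" for t
  have \<theta>: "0 \<le> \<theta> t" "\<theta> t \<le> 1" for t using R by (auto simp: \<theta>_def max_def divide_le_eq_1)
  have rad: "cf (rad R (x t)) = (\<lambda>k. of_real (\<theta> t) * cf (x t) k)" for t
    by (auto simp: rad_def \<theta>_def)
  have tnl: "tnl R k (x t) = of_real ((\<theta> t)\<^sup>2) * nl (cf (x t)) k" for t k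
    unfolding tnl_def rad nl_scale by simp
  have cut: "continuous_on {0..T} (\<lambda>s. tnl R k (x s))" for k by (rule tnl_continuous[OF R x])
  \<comment> \<open>The reflected conjugate of the solution solves the same truncated equation with
    the same datum. As the retraction acts by the real factor \<open>\<theta> t\<close>, it commutes
    with this reflection, and \<open>duh_contraction_zero\<close> annihilates the
    difference.\<close>
  have flip: "cf (x t) k - cnj (cf (x t) (- k)) = 0" if t: "t \<in> {0..T}" for t k
  proof (rule duh_contraction_zero[where h = "\<lambda>k s. tnl R k (x s) - cnj (tnl R (- k) (x s))"
        and G = "2 * R" and d = "\<lambda>t k. cf (x t) k - cnj (cf (x t) (- k))", OF _ _ _ _ _ t])
    have lf: "l2bd (\<lambda>k. cnj (h (- k))) C" if "l2bd h C" for h :: "int \<times> int \<Rightarrow> complex" and C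
      by (rule l2bd_mono[OF l2bd_reindex[OF that, of uminus]]) (auto simp: inj_def)
    show "0 \<le> 2 * R" using R by simp
    show "l2bd (\<lambda>k. cf (x t) k - cnj (cf (x t) (- k))) (A + A)" if "t \<in> {0..T}" for t
      using A[OF that] by (intro l2bd_diff lf l2bd_mono[OF l2bd_cf]) auto
    show "continuous_on {0..T} (\<lambda>s. tnl R k (x s) - cnj (tnl R (- k) (x s)))" for k
      by (intro continuous_intros cut)
    show "cmod (cf (x t) k - cnj (cf (x t) (- k)))
        \<le> cmod (duh (sg k) (\<lambda>s. tnl R k (x s) - cnj (tnl R (- k) (x s))) t)" if t: "t \<in> {0..T}" for t k
    proof -
      have c: "continuous_on {0..t} (\<lambda>s. tnl R k (x s))" "continuous_on {0..t} (\<lambda>s. cnj (tnl R (- k) (x s)))"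
        using t by (auto intro!: continuous_intros continuous_on_subset[OF cut])
      have "cf (x t) k - cnj (cf (x t) (- k)) = - duh (sg k) (\<lambda>s. tnl R k (x s) - cnj (tnl R (- k) (x s))) t"
        unfolding duh_diff[OF c, symmetric] xeq[OF t]
        using hermD[OF h, of k] by (simp add: duh_flip sg_minus)
      then show ?thesis by simp
    qed
    show "cmod (tnl R k (x t) - cnj (tnl R (- k) (x t))) \<le> jb k * (2 * R * C)"
      if t: "t \<in> {0..T}" and C: "l2bd (\<lambda>k. cf (x t) k - cnj (cf (x t) (- k))) C" for t k C
    proof -
      have lR: "l2bd (cf (rad R (x t))) R" by (rule l2bd_mono[OF l2bd_cf]) (auto simp: norm_rad_le R)
      have "cmod (nl (cf (rad R (x t))) k - nl (\<lambda>k. cnj (cf (rad R (x t)) (- k))) k) \<le> jb k * (C * (R + R))"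
      proof (rule nl_diff_bound[OF lR lf[OF lR]])
        show "l2bd (\<lambda>k. cf (rad R (x t)) k - cnj (cf (rad R (x t)) (- k))) C"
        proof (rule l2bd_mono[OF C])
          fix k
          have "cf (rad R (x t)) k - cnj (cf (rad R (x t)) (- k)) = of_real (\<theta> t) * (cf (x t) k - cnj (cf (x t) (- k)))"
            by (simp add: rad algebra_simps)
          then show "cmod (cf (rad R (x t)) k - cnj (cf (rad R (x t)) (- k))) \<le> cmod (cf (x t) k - cnj (cf (x t) (- k)))"
            using \<theta>[of t] by (simp add: norm_mult mult_left_le_one_le)
        qed simp
      qed
      then show ?thesis by (simp add: tnl_def nl_flip mult_ac)
    qed
  qed
  have hx: "herm (cf (x t))" if "t \<in> {0..T}" for t
    unfolding herm_def
  proof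
    fix k show "cf (x t) (- k) = cnj (cf (x t) k)" using flip[OF that, of "- k"] by simp
  qed
  interpret m: mild_sol sg c C0 C1 T "\<lambda>t. cf (x t)" a0 "\<lambda>t. (\<theta> t)\<^sup>2" A B
  proof
    show "cf (x t) k = of_real (exp (- sg k * t)) * a0 k - duh (sg k) (\<lambda>s. of_real ((\<theta> s)\<^sup>2) * nl (cf (x s)) k) t"
      if "t \<in> {0..T}" for t k using xeq[OF that, of k] by (simp only: tnl)
    show "0 \<le> (\<theta> t)\<^sup>2 \<and> (\<theta> t)\<^sup>2 \<le> 1" for t using \<theta>[of t] by (simp add: power_le_one)
    show "continuous_on {0..T} (\<lambda>s. of_real ((\<theta> s)\<^sup>2) * nl (cf (x s)) k)" for k
      using cut[of k] by (simp only: tnl)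
    show "l2bd (cf (x t)) A" if "t \<in> {0..T}" for t using A[OF that] by (intro l2bd_mono[OF l2bd_cf]) auto
  qed (fact a0 hx)+
  have "norm (x t) \<le> R" if t: "t \<in> {0..T}" for t
  proof -
    have "l2bd a0 (norm a)" using l2bd_cf[of a] by (simp add: a)
    from norm_l2_le[OF m.energy_bound[OF this t]] show ?thesis by (simp add: R_def)
  qed
  then have "max R (norm (x t)) = R" if "t \<in> {0..T}" for t using that by (simp add: max.absorb1)
  then have one: "\<theta> t = 1" if "t \<in> {0..T}" for t using R that by (simp add: \<theta>_def)
  have tnl1: "tnl R k (x t) = nl (cf (x t)) k" if "t \<in> {0..T}" for t k
    using that by (simp add: tnl one)
  have "mild_sol sg c C0 C1 T (\<lambda>t. cf (x t)) a0 (\<lambda>_. 1) A B"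
  proof
    show "cf (x t) k = of_real (exp (- sg k * t)) * a0 k - duh (sg k) (\<lambda>s. of_real 1 * nl (cf (x s)) k) t"
      if t: "t \<in> {0..T}" for t k
    proof -
      have "duh (sg k) (\<lambda>s. tnl R k (x s)) t = duh (sg k) (\<lambda>s. of_real 1 * nl (cf (x s)) k) t"
        unfolding duh_def using t by (intro arg_cong2[where f = "(*)"] refl integral_cong) (auto simp: tnl1)
      then show ?thesis using xeq[OF t, of k] by simp
    qed
    show "continuous_on {0..T} (\<lambda>s. of_real 1 * nl (cf (x s)) k)" for k
      using cut[of k] by (rule continuous_on_eq) (simp add: tnl1)
  qed (use m.f_bd a0 hx in auto)
  then show ?thesis by blast
qed

lemma mild_uniqueness:
  assumes eq: "\<And>t k. t \<in> {0..T} \<Longrightarrow> f t k = of_real (exp (- sg k * t)) * a0 k - duh (sg k) (\<lambda>s. nl (f s) k) t"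
    "\<And>t k. t \<in> {0..T} \<Longrightarrow> f' t k = of_real (exp (- sg k * t)) * a0 k - duh (sg k) (\<lambda>s. nl (f' s) k) t"
    and cont: "\<And>k. continuous_on {0..T} (\<lambda>s. nl (f s) k)" "\<And>k. continuous_on {0..T} (\<lambda>s. nl (f' s) k)"
    and bd: "\<And>t. t \<in> {0..T} \<Longrightarrow> l2bd (f t) A" "\<And>t. t \<in> {0..T} \<Longrightarrow> l2bd (f' t) A'"
    and t: "t \<in> {0..T}"
  shows "f t k = f' t k"
proof -
  have "f t k - f' t k = 0"
  proof (rule duh_contraction_zero[where h = "\<lambda>k s. nl (f s) k - nl (f' s) k" and G = "A + A'"
        and d = "\<lambda>t k. f t k - f' t k", OF _ _ _ _ _ t])
    show "0 \<le> A + A'" using bd[THEN l2bd_nonneg, OF t] t by auto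
    show "l2bd (\<lambda>k. f t k - f' t k) (A + A')" if "t \<in> {0..T}" for t using bd that by (intro l2bd_diff) auto
    show "continuous_on {0..T} (\<lambda>s. nl (f s) k - nl (f' s) k)" for k by (intro continuous_intros cont)
    show "cmod (f t k - f' t k) \<le> cmod (duh (sg k) (\<lambda>s. nl (f s) k - nl (f' s) k) t)" if t: "t \<in> {0..T}" for t k
    proof -
      have c: "continuous_on {0..t} (\<lambda>s. nl (f s) k)" "continuous_on {0..t} (\<lambda>s. nl (f' s) k)"
        using t by (auto intro!: continuous_on_subset[OF cont(1)] continuous_on_subset[OF cont(2)])
      have "f t k - f' t k = - duh (sg k) (\<lambda>s. nl (f s) k - nl (f' s) k) t"
        using eq[OF t, of k] by (simp add: duh_diff[OF c, symmetric])
      then show ?thesis by simp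
    qed
    show "cmod (nl (f t) k - nl (f' t) k) \<le> jb k * ((A + A') * C)"
      if "t \<in> {0..T}" "l2bd (\<lambda>k. f t k - f' t k) C" for t k C
      using nl_diff_bound[OF bd(1)[OF that(1)] bd(2)[OF that(1)] that(2), of k] by (simp add: mult_ac)
  qed
  then show ?thesis by simp
qed

end

section \<open>Test functions and the fundamental lemma\<close>

definition smooth :: "(real \<Rightarrow> real) \<Rightarrow> bool" where
  "smooth \<phi> \<longleftrightarrow> (\<forall>n. (deriv ^^ n) \<phi> differentiable_on UNIV)"

lemma differentiable_on_UNIV_real:
  "(\<And>x. (\<phi> has_real_derivative \<psi> x) (at x)) \<Longrightarrow> \<phi> differentiable_on UNIV"
  unfolding differentiable_on_def by (auto simp: real_differentiable_def)

text \<open>Closure under differentiation replaces formulas for higher derivatives: every iterated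
  derivative stays in the class, and members of the class are differentiable.\<close>

lemma smooth_coinduct:
  assumes "\<phi> \<in> S" "\<And>\<phi>. \<phi> \<in> S \<Longrightarrow> \<exists>\<psi>\<in>S. \<forall>x. (\<phi> has_real_derivative \<psi> x) (at x)"
  shows "smooth \<phi>"
proof -
  have step: "deriv \<phi> \<in> S \<and> \<phi> differentiable_on UNIV" if \<phi>: "\<phi> \<in> S" for \<phi>
  proof -
    obtain \<psi> where \<psi>: "\<psi> \<in> S" "\<And>x. (\<phi> has_real_derivative \<psi> x) (at x)" using assms(2)[OF \<phi>] by blast
    have "deriv \<phi> = \<psi>" using DERIV_imp_deriv[OF \<psi>(2)] by auto
    moreover have "\<phi> differentiable_on UNIV"
      by (rule differentiable_on_UNIV_real[OF \<psi>(2)])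
    ultimately show ?thesis using \<psi>(1) by simp
  qed
  have "(deriv ^^ n) \<phi> \<in> S" for n
    by (induction n) (use assms(1) step in auto)
  then show ?thesis using step by (simp add: smooth_def)
qed

lemma smooth_antiderivative:
  assumes "smooth \<psi>" "\<And>x. (\<phi> has_real_derivative \<psi> x) (at x)"
  shows "smooth \<phi>"
  unfolding smooth_def
proof
  fix n
  have d: "deriv \<phi> = \<psi>" using DERIV_imp_deriv[OF assms(2)] by auto
  show "(deriv ^^ n) \<phi> differentiable_on UNIV"
  proof (cases n)
    case 0
    then show ?thesis
      using differentiable_on_UNIV_real[OF assms(2)] by simp
  next
    case (Suc m)
    then have "(deriv ^^ n) \<phi> = (deriv ^^ m) \<psi>" by (simp add: d funpow_swap1)
    then show ?thesis using assms(1) by (simp add: smooth_def)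
  qed
qed

text \<open>The functions \<open>p (1 / x) exp (- 1 / x)\<close>, extended by 0, are closed under differentiation.\<close>

definition flat :: "real poly \<Rightarrow> real \<Rightarrow> real" where
  "flat p x = (if x \<le> 0 then 0 else poly p (1 / x) * exp (- (1 / x)))"

lemma poly_exp_tendsto_0:
  fixes p :: "real poly"
  shows "((\<lambda>y. poly p y * exp (- y)) \<longlongrightarrow> 0) at_top"
proof -
  have "poly p y * exp (- y) = (\<Sum>i\<le>degree p. coeff p i * (y ^ i / exp y))" for y
    by (simp add: poly_altdef sum_distrib_right exp_minus divide_inverse mult.assoc)
  moreover have "((\<lambda>y. \<Sum>i\<le>degree p. coeff p i * (y ^ i / exp y)) \<longlongrightarrow> (\<Sum>i\<le>degree p. coeff p i * 0)) at_top"
    by (intro tendsto_sum tendsto_mult tendsto_const tendsto_power_div_exp_0)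
  ultimately show ?thesis by simp
qed

lemma flat_tendsto_0: "(flat p \<longlongrightarrow> 0) (at 0)"
proof -
  have "((\<lambda>x. poly p (inverse x) * exp (- inverse x)) \<longlongrightarrow> 0) (at_right 0)"
    using filterlim_compose[OF poly_exp_tendsto_0 filterlim_inverse_at_top_right] .
  then have "(flat p \<longlongrightarrow> 0) (at_right 0)"
    by (rule Lim_transform_eventually)
      (auto simp: flat_def eventually_at_right_field inverse_eq_divide intro!: exI[of _ 1])
  moreover have "(flat p \<longlongrightarrow> 0) (at_left 0)"
    by (rule tendsto_eventually) (auto simp: flat_def eventually_at_left_field intro!: exI[of _ "-1"])
  ultimately show ?thesis by (simp add: filterlim_split_at)
qed

text \<open>With y = 1 / x the chain rule contributes - y^2, so the polynomial p(y) becomes y^2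
  (p(y) - p'(y)); on the negative axis everything is zero.\<close>

lemma flat_deriv: "(flat p has_real_derivative flat ([:0, 0, 1:] * (p - pderiv p)) x) (at x)"
proof -
  consider "x < 0" | "x = 0" | "x > 0" by linarith
  then show ?thesis
  proof cases
    case 1
    have "((\<lambda>x. 0) has_real_derivative 0) (at x)" by simp
    then have "(flat p has_real_derivative 0) (at x)"
      by (rule has_field_derivative_transform_within_open[of _ _ _ "{..<0}"]) (use 1 in \<open>auto simp: flat_def\<close>)
    then show ?thesis using 1 by (simp add: flat_def)
  next
    case 2
    have "((\<lambda>h. (flat p (0 + h) - flat p 0) / h) \<longlongrightarrow> 0) (at 0)"
    proof -
      \<comment> \<open>Division by h multiplies the polynomial in 1 / h by its variable, so the
        difference quotient at the origin is again of the form \<open>flat\<close> and tends to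
        zero.\<close>
      have "(flat p (0 + h) - flat p 0) / h = flat ([:0, 1:] * p) h" for h
        by (simp add: flat_def)
      then show ?thesis using flat_tendsto_0[of "[:0, 1:] * p"] by simp
    qed
    then show ?thesis using 2 by (simp add: DERIV_def flat_def)
  next
    case 3
    have "((\<lambda>x. poly p (1 / x) * exp (- (1 / x))) has_real_derivative
        (poly (pderiv p) (1 / x) * (- 1 / x\<^sup>2)) * exp (- (1 / x)) + poly p (1 / x) * (exp (- (1 / x)) * (1 / x\<^sup>2))) (at x)"
      using 3 by (auto intro!: derivative_eq_intros DERIV_chain2[OF poly_DERIV] simp: power2_eq_square)
    then have "(flat p has_real_derivative
        (poly (pderiv p) (1 / x) * (- 1 / x\<^sup>2)) * exp (- (1 / x)) + poly p (1 / x) * (exp (- (1 / x)) * (1 / x\<^sup>2))) (at x)"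
      by (rule has_field_derivative_transform_within_open[of _ _ _ "{0<..}"]) (use 3 in \<open>auto simp: flat_def\<close>)
    moreover have "(poly (pderiv p) (1 / x) * (- 1 / x\<^sup>2)) * exp (- (1 / x)) + poly p (1 / x) * (exp (- (1 / x)) * (1 / x\<^sup>2))
        = flat ([:0, 0, 1:] * (p - pderiv p)) x"
      using 3 by (simp add: flat_def power2_eq_square field_simps)
    ultimately show ?thesis by simp
  qed
qed

text \<open>A class of functions vanishing outside (a, b) that contains a bump and is closed under
  differentiation. Differences suffice because the inner derivative of b - x is -1, which makes the
  product rule a difference.\<close>

inductive_set flat_products :: "real \<Rightarrow> real \<Rightarrow> (real \<Rightarrow> real) set" for a b where
  prod: "(\<lambda>x. flat p (x - a) * flat q (b - x)) \<in> flat_products a b"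
| diff: "\<phi> \<in> flat_products a b \<Longrightarrow> \<psi> \<in> flat_products a b \<Longrightarrow> (\<lambda>x. \<phi> x - \<psi> x) \<in> flat_products a b"

lemma flat_products_deriv:
  "\<phi> \<in> flat_products a b \<Longrightarrow> \<exists>\<psi>\<in>flat_products a b. \<forall>x. (\<phi> has_real_derivative \<psi> x) (at x)"
proof (induction rule: flat_products.induct)
    case (prod p q)
    let ?D = "\<lambda>p. [:0, 0, 1:] * (p - pderiv p)"
    have "((\<lambda>x. flat p (x - a) * flat q (b - x)) has_real_derivative
        flat (?D p) (x - a) * flat q (b - x) - flat p (x - a) * flat (?D q) (b - x)) (at x)" for x
    proof -
      have 1: "((\<lambda>x. flat p (x - a)) has_real_derivative flat (?D p) (x - a) * 1) (at x)"
        by (rule DERIV_chain2[OF flat_deriv]) (auto intro!: derivative_eq_intros)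
      have 2: "((\<lambda>x. flat q (b - x)) has_real_derivative flat (?D q) (b - x) * (- 1)) (at x)"
        by (rule DERIV_chain2[OF flat_deriv]) (auto intro!: derivative_eq_intros)
      show ?thesis by (rule DERIV_cong[OF DERIV_mult[OF 1 2]]) simp
    qed
    then show ?case by (intro bexI[OF _ flat_products.diff[OF flat_products.prod flat_products.prod]]) blast
  next
    case (diff \<phi> \<psi>)
    then obtain \<phi>' \<psi>' where "\<phi>' \<in> flat_products a b" "\<psi>' \<in> flat_products a b"
      "\<And>x. (\<phi> has_real_derivative \<phi>' x) (at x)" "\<And>x. (\<psi> has_real_derivative \<psi>' x) (at x)" by blast
    then show ?case
      by (intro bexI[of _ "\<lambda>x. \<phi>' x - \<psi>' x"] flat_products.diff) (auto intro!: DERIV_diff)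
qed

lemma flat_products_smooth: "\<phi> \<in> flat_products a b \<Longrightarrow> smooth \<phi>"
  by (rule smooth_coinduct[OF _ flat_products_deriv])

lemma smooth_deriv:
  assumes "smooth \<phi>"
  shows "smooth (deriv \<phi>)" "(\<phi> has_real_derivative deriv \<phi> x) (at x)"
proof -
  show "smooth (deriv \<phi>)"
    unfolding smooth_def
  proof
    fix n
    have "(deriv ^^ Suc n) \<phi> differentiable_on UNIV" using assms unfolding smooth_def by blast
    then show "(deriv ^^ n) (deriv \<phi>) differentiable_on UNIV" by (simp add: funpow_swap1)
  qed
  have "\<phi> differentiable_on UNIV" using assms unfolding smooth_def by (metis funpow_0)
  then show "(\<phi> has_real_derivative deriv \<phi> x) (at x)"
    by (simp add: differentiable_on_def DERIV_deriv_iff_real_differentiable)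
qed

lemma smooth_diff: "smooth \<phi> \<Longrightarrow> smooth \<psi> \<Longrightarrow> smooth (\<lambda>x. \<phi> x - \<psi> x)"
proof (rule smooth_coinduct[of _ "{\<lambda>x. \<phi> x - \<psi> x | \<phi> \<psi>. smooth \<phi> \<and> smooth \<psi>}"])
  fix \<theta> assume "\<theta> \<in> {\<lambda>x. \<phi> x - \<psi> x | \<phi> \<psi>. smooth \<phi> \<and> smooth \<psi>}"
  then obtain \<phi> \<psi> where *: "\<theta> = (\<lambda>x. \<phi> x - \<psi> x)" "smooth \<phi>" "smooth \<psi>" by blast
  show "\<exists>\<xi>\<in>{\<lambda>x. \<phi> x - \<psi> x | \<phi> \<psi>. smooth \<phi> \<and> smooth \<psi>}. \<forall>x. (\<theta> has_real_derivative \<xi> x) (at x)"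
    unfolding *(1) using smooth_deriv[OF *(2)] smooth_deriv[OF *(3)]
    by (intro bexI[of _ "\<lambda>x. deriv \<phi> x - deriv \<psi> x"]) (auto intro!: DERIV_diff)
qed blast

lemma smooth_continuous: "smooth \<phi> \<Longrightarrow> continuous_on S \<phi>"
proof -
  assume "smooth \<phi>"
  then have "\<phi> differentiable_on UNIV" unfolding smooth_def by (metis funpow_0)
  then show ?thesis by (metis continuous_on_subset differentiable_imp_continuous_on subset_UNIV)
qed

lemma bump_exists:
  assumes "a < b"
  obtains \<rho> where "smooth \<rho>" "\<And>x. 0 \<le> \<rho> x" "\<And>x. x \<notin> {a<..<b} \<Longrightarrow> \<rho> x = 0" "integral {a..b} \<rho> = 1"
proof -
  define \<omega> where "\<omega> x = flat 1 (x - a) * flat 1 (b - x)" for x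
  have mem: "\<omega> \<in> flat_products a b" unfolding \<omega>_def[abs_def] by (rule flat_products.prod)
  have sm: "smooth \<omega>" by (rule flat_products_smooth[OF mem])
  have c: "continuous_on {a..b} \<omega>" by (rule smooth_continuous[OF sm])
  have pos: "0 \<le> \<omega> x" for x by (simp add: \<omega>_def flat_def)
  define I where "I = integral {a..b} \<omega>"
  have "I \<noteq> 0"
  proof
    assume "I = 0"
    then have "(\<omega> has_integral 0) {a..b}"
      using integrable_continuous_real[OF c] by (simp add: I_def has_integral_iff)
    then have "\<omega> ((a + b) / 2) = 0"
      using has_integral_0_cbox_imp_0[of a b \<omega> "(a + b) / 2"] c pos assms by (auto simp: cbox_interval)
    then show False using assms by (simp add: \<omega>_def flat_def field_simps split: if_splits)
  qed
  moreover have "0 \<le> I" unfolding I_def by (rule integral_nonneg[OF integrable_continuous_real[OF c]]) (rule pos)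
  ultimately have I: "0 < I" by simp
  have "smooth (\<lambda>x. \<omega> x / I)"
  proof (rule smooth_coinduct[of _ "(\<lambda>\<phi> x. \<phi> x / I) ` flat_products a b"])
    show "(\<lambda>x. \<omega> x / I) \<in> (\<lambda>\<phi> x. \<phi> x / I) ` flat_products a b" using mem by blast
    fix \<phi> assume "\<phi> \<in> (\<lambda>\<phi> x. \<phi> x / I) ` flat_products a b"
    then obtain \<phi>0 where \<phi>0: "\<phi>0 \<in> flat_products a b" "\<phi> = (\<lambda>x. \<phi>0 x / I)" by blast
    obtain \<psi> where "\<psi> \<in> flat_products a b" "\<And>x. (\<phi>0 has_real_derivative \<psi> x) (at x)"
      using flat_products_deriv[OF \<phi>0(1)] by blast
    then show "\<exists>\<psi>\<in>(\<lambda>\<phi> x. \<phi> x / I) ` flat_products a b. \<forall>x. (\<phi> has_real_derivative \<psi> x) (at x)"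
      unfolding \<phi>0(2) by (intro bexI[of _ "\<lambda>x. \<psi> x / I"]) (auto intro!: DERIV_cdivide)
  qed
  moreover have "\<omega> x / I = 0" if "x \<notin> {a<..<b}" for x
    using that by (auto simp: \<omega>_def flat_def)
  moreover have "integral {a..b} (\<lambda>x. \<omega> x / I) = 1" using I by (simp add: I_def)
  moreover have "0 \<le> \<omega> x / I" for x using pos I by simp
  ultimately show ?thesis using that by blast
qed

section \<open>Approximate identities and functions determined by their weak derivative\<close>

lemma integral_support:
  fixes g :: "real \<Rightarrow> real"
  assumes "\<And>x. x \<notin> {a..b} \<Longrightarrow> g x = 0" "{a..b} \<subseteq> S"
  shows "integral S g = integral {a..b} g"
proof -
  have "integral S g = integral S (\<lambda>x. if x \<in> {a..b} then g x else 0)"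
    by (rule integral_cong) (use assms(1) in auto)
  also have "\<dots> = integral {a..b} g" using assms(2) by (simp add: integral_restrict_Int Int_absorb1 Int_absorb2 del: atLeastAtMost_iff)
  finally show ?thesis .
qed

lemma bump_mean:
  assumes w: "continuous_on {0..T} w" and s: "s \<in> {0<..<T}" and e: "0 < e"
  shows "\<exists>a b \<rho>. 0 < a \<and> a < b \<and> b < T \<and> smooth \<rho> \<and> (\<forall>x. x \<notin> {a..b} \<longrightarrow> \<rho> x = 0) \<and>
    integral {0..T} \<rho> = 1 \<and> \<bar>integral {0..T} (\<lambda>x. \<rho> x * w x) - w s\<bar> \<le> e"
proof -
  have "continuous (at s within {0..T}) w" using w s by (auto simp: continuous_on_eq_continuous_within)
  then obtain d where d: "0 < d" "\<And>x. x \<in> {0..T} \<Longrightarrow> \<bar>x - s\<bar> < d \<Longrightarrow> \<bar>w x - w s\<bar> < e"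
    using e unfolding continuous_within_eps_delta by (auto simp: dist_real_def)
  \<comment> \<open>The halves keep the closed interval of radius \<open>h\<close> around
    \<open>s\<close> strictly inside (0, T) and within the modulus of continuity
    \<open>d\<close>.\<close>
  define h where "h = min (d / 2) (min (s / 2) ((T - s) / 2))"
  have h: "0 < h" "h < d" "0 < s - h" "s + h < T" using d(1) s by (auto simp: h_def min_def field_simps)
  obtain \<rho> where \<rho>: "smooth \<rho>" "\<And>x. 0 \<le> \<rho> x" "\<And>x. x \<notin> {s - h<..<s + h} \<Longrightarrow> \<rho> x = 0"
    "integral {s - h..s + h} \<rho> = 1"
    using bump_exists[of "s - h" "s + h"] h(1) by auto
  let ?J = "{s - h..s + h}"
  have J: "?J \<subseteq> {0..T}" using h by auto
  have c: "continuous_on S \<rho>" for S by (rule smooth_continuous[OF \<rho>(1)])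
  have cw: "continuous_on ?J w" by (rule continuous_on_subset[OF w J])
  have z: "\<rho> x = 0" if "x \<notin> ?J" for x using \<rho>(3) that by auto
  have 1: "integral {0..T} \<rho> = 1" using integral_support[OF z J] \<rho>(4) by simp
  have "integral {0..T} (\<lambda>x. \<rho> x * w x) - w s = integral ?J (\<lambda>x. \<rho> x * (w x - w s))"
  proof -
    have i: "(\<lambda>x. \<rho> x * w x) integrable_on ?J" "(\<lambda>x. \<rho> x * w s) integrable_on ?J"
      by (intro integrable_continuous_real continuous_intros c cw)+
    have "integral {0..T} (\<lambda>x. \<rho> x * w x) = integral ?J (\<lambda>x. \<rho> x * w x)"
      by (rule integral_support[OF _ J]) (simp add: z)
    moreover have "integral ?J (\<lambda>x. \<rho> x * w s) = w s" using \<rho>(4) by simp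
    ultimately show ?thesis using integral_diff[OF i] by (simp add: right_diff_distrib)
  qed
  also have "norm (integral ?J (\<lambda>x. \<rho> x * (w x - w s))) \<le> integral ?J (\<lambda>x. \<rho> x * e)"
  proof (rule integral_norm_bound_integral)
    show "(\<lambda>x. \<rho> x * (w x - w s)) integrable_on ?J" "(\<lambda>x. \<rho> x * e) integrable_on ?J"
      by (intro integrable_continuous_real continuous_intros c cw)+
    fix x assume x: "x \<in> ?J"
    then have "\<bar>w x - w s\<bar> < e" using h J by (intro d(2)) auto
    then show "norm (\<rho> x * (w x - w s)) \<le> \<rho> x * e" using \<rho>(2)[of x] by (simp add: abs_mult mult_left_mono)
  qed
  also have "\<dots> = e" using \<rho>(4) by simp
  finally have "\<bar>integral {0..T} (\<lambda>x. \<rho> x * w x) - w s\<bar> \<le> e" by simp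
  then show ?thesis using h \<rho>(1) z 1 by (intro exI[of _ "s - h"] exI[of _ "s + h"] exI[of _ \<rho>]) auto
qed

text \<open>The antiderivative that vanishes at \<open>a\<close> vanishes to the left of it. Mean
  zero makes it vanish to the right of \<open>b\<close> too, so its support is compact in (0,
  T).\<close>

lemma antiderivative_test_function:
  assumes \<psi>: "smooth \<psi>" and ab: "0 < a" "a < b" "b < T" and z: "\<And>x. x \<notin> {a..b} \<Longrightarrow> \<psi> x = 0"
    and I: "integral {0..T} \<psi> = 0"
  shows "\<exists>\<phi>. test_function T \<phi> \<and> (\<forall>x. (\<phi> has_real_derivative \<psi> x) (at x))"
proof -
  have c: "continuous_on S \<psi>" for S by (rule smooth_continuous[OF \<psi>])
  \<comment> \<open>The hypothesis speaks of points outside the closed interval; the end points are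
    added by continuity, so that the antiderivative is constant on closed half-lines.\<close>
  have z': "\<psi> x = 0" if "x \<le> a \<or> b \<le> x" for x
  proof -
    have cl: "closed {x. \<psi> x = 0}" using continuous_closed_preimage_constant[of UNIV \<psi> 0] c by simp
    have "\<psi> a = 0"
    proof (rule tendsto_unique[of "at_left a"])
      have "isCont \<psi> a" using c[of UNIV] by (simp add: continuous_on_eq_continuous_at)
      then show "(\<psi> \<longlongrightarrow> \<psi> a) (at_left a)" by (simp add: isCont_def filterlim_at_split)
      show "(\<psi> \<longlongrightarrow> 0) (at_left a)"
        by (rule tendsto_eventually) (auto simp: eventually_at_left_field z intro!: exI[of _ "a - 1"])
    qed simp
    moreover have "\<psi> b = 0"
    proof (rule tendsto_unique[of "at_right b"])
      have "isCont \<psi> b" using c[of UNIV] by (simp add: continuous_on_eq_continuous_at)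
      then show "(\<psi> \<longlongrightarrow> \<psi> b) (at_right b)" by (simp add: isCont_def filterlim_at_split)
      show "(\<psi> \<longlongrightarrow> 0) (at_right b)"
        by (rule tendsto_eventually) (auto simp: eventually_at_right_field z intro!: exI[of _ "b + 1"])
    qed simp
    ultimately show ?thesis using that z[of x] by (cases "x = a"; cases "x = b") auto
  qed
  obtain \<Phi> where \<Phi>: "\<And>x. (\<Phi> has_real_derivative \<psi> x) (at x)"
  proof -
    have "isCont \<psi> x" for x using c[of UNIV] by (simp add: continuous_on_eq_continuous_at)
    then have "\<exists>g. \<forall>x. (g has_vector_derivative \<psi> x) (at x)"
      using einterval_antiderivative[of "-\<infinity>" "\<infinity>" \<psi>] by auto
    then show ?thesis using that by (auto simp: has_real_derivative_iff_has_vector_derivative)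
  qed
  define \<phi> where "\<phi> x = \<Phi> x - \<Phi> a" for x
  have d\<phi>: "(\<phi> has_real_derivative \<psi> x) (at x)" for x
    unfolding \<phi>_def[abs_def] using DERIV_diff[OF \<Phi>[of x] DERIV_const[of "\<Phi> a"]] by simp
  have left: "\<phi> x = 0" if "x \<le> a" for x
  proof -
    have "\<exists>k. \<forall>x\<in>{..a}. \<phi> x = k"
      by (rule has_field_derivative_zero_constant)
        (auto intro: has_field_derivative_at_within[OF DERIV_cong[OF d\<phi>]] simp: z')
    then obtain k where k: "\<And>x. x \<le> a \<Longrightarrow> \<phi> x = k" by auto
    have "\<phi> a = 0" by (simp add: \<phi>_def)
    then show ?thesis using k[of a] k[OF that] by simp
  qed
  have right: "\<phi> x = 0" if "b \<le> x" for x
  proof -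
    have "\<exists>k. \<forall>x\<in>{b..}. \<phi> x = k"
      by (rule has_field_derivative_zero_constant)
        (auto intro: has_field_derivative_at_within[OF DERIV_cong[OF d\<phi>]] simp: z')
    then have "\<phi> x = \<phi> T" using that ab by auto
    moreover have "(\<psi> has_integral \<phi> T - \<phi> 0) {0..T}"
      using ab by (intro fundamental_theorem_of_calculus)
        (auto simp: has_real_derivative_iff_has_vector_derivative[symmetric] intro: has_field_derivative_at_within[OF d\<phi>])
    then have "\<phi> T - \<phi> 0 = 0" using I by (simp add: has_integral_iff)
    ultimately show ?thesis using left[of 0] ab by simp
  qed
  have "{t. \<phi> t \<noteq> 0} \<subseteq> {a..b}"
  proof
    fix x assume "x \<in> {t. \<phi> t \<noteq> 0}"
    then have "\<not> x \<le> a" "\<not> b \<le> x" using left right by blast+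
    then show "x \<in> {a..b}" by simp
  qed
  then have "closure {t. \<phi> t \<noteq> 0} \<subseteq> {a..b}" by (rule closure_minimal) simp
  also have "{a..b} \<subseteq> {0<..<T}" using ab by auto
  finally have "test_function T \<phi>"
    using smooth_antiderivative[OF \<psi> d\<phi>] by (simp add: test_function_def smooth_def)
  then show ?thesis using d\<phi> by blast
qed

text \<open>The difference of two normalised bumps concentrated near \<open>s\<close> and
  \<open>t\<close> has mean zero and is therefore the derivative of a test function. Its pairing
  with \<open>w\<close> is zero and, up to e, equal to w(s) - w(t).\<close>

lemma du_bois_reymond:
  assumes w: "continuous_on {0..T} w"
    and z: "\<And>\<phi>. test_function T \<phi> \<Longrightarrow> integral {0..T} (\<lambda>t. deriv \<phi> t * w t) = 0"
    and s: "s \<in> {0<..<T}" and t: "t \<in> {0<..<T}"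
  shows "w s = (w t :: real)"
proof -
  have "\<bar>w s - w t\<bar> \<le> e" if e: "0 < e" for e
  proof -
    obtain a1 b1 \<rho>1 where 1: "0 < a1" "a1 < b1" "b1 < T" "smooth \<rho>1" "\<And>x. x \<notin> {a1..b1} \<Longrightarrow> \<rho>1 x = 0"
      "integral {0..T} \<rho>1 = 1" "\<bar>integral {0..T} (\<lambda>x. \<rho>1 x * w x) - w s\<bar> \<le> e / 2"
      using bump_mean[OF w s, of "e / 2"] e by auto
    obtain a2 b2 \<rho>2 where 2: "0 < a2" "a2 < b2" "b2 < T" "smooth \<rho>2" "\<And>x. x \<notin> {a2..b2} \<Longrightarrow> \<rho>2 x = 0"
      "integral {0..T} \<rho>2 = 1" "\<bar>integral {0..T} (\<lambda>x. \<rho>2 x * w x) - w t\<bar> \<le> e / 2"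
      using bump_mean[OF w t, of "e / 2"] e by auto
    define \<psi> where "\<psi> x = \<rho>1 x - \<rho>2 x" for x
    have c: "continuous_on S \<rho>1" "continuous_on S \<rho>2" for S using 1(4) 2(4) by (auto intro: smooth_continuous)
    have "smooth \<psi>" unfolding \<psi>_def[abs_def] by (rule smooth_diff[OF 1(4) 2(4)])
    moreover have "\<psi> x = 0" if "x \<notin> {min a1 a2..max b1 b2}" for x
    proof -
      have "x \<notin> {a1..b1}" "x \<notin> {a2..b2}" using that by auto
      then show ?thesis by (simp add: \<psi>_def 1(5) 2(5))
    qed
    moreover have "integral {0..T} \<psi> = 0"
      unfolding \<psi>_def using 1(6) 2(6)
      by (subst integral_diff) (auto intro!: integrable_continuous_real c)
    ultimately obtain \<phi> where \<phi>: "test_function T \<phi>" "\<And>x. (\<phi> has_real_derivative \<psi> x) (at x)"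
      using antiderivative_test_function[of \<psi> "min a1 a2" "max b1 b2" T] 1(1-3) 2(1-3) by force
    have "deriv \<phi> = \<psi>" using DERIV_imp_deriv[OF \<phi>(2)] by auto
    then have "integral {0..T} (\<lambda>x. \<psi> x * w x) = 0" using z[OF \<phi>(1)] by simp
    moreover have "integral {0..T} (\<lambda>x. \<psi> x * w x) = integral {0..T} (\<lambda>x. \<rho>1 x * w x) - integral {0..T} (\<lambda>x. \<rho>2 x * w x)"
      unfolding \<psi>_def left_diff_distrib
      by (intro integral_diff integrable_continuous_real continuous_intros c w)
    ultimately show ?thesis using 1(7) 2(7) by linarith
  qed
  then have "\<bar>w s - w t\<bar> \<le> 0" by (rule field_le_epsilon[of _ 0, simplified])
  then show ?thesis by simp
qed

section \<open>The spatial operators\<close>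

text \<open>The operators are choices of a function with prescribed coefficients. This relation lets
  them be composed through their symbols, independently of which representative is chosen.\<close>

definition has_fc :: "tfun \<Rightarrow> (int \<times> int \<Rightarrow> complex) \<Rightarrow> bool" where
  "has_fc u f \<longleftrightarrow> u \<in> L2_space \<and> (\<forall>k. fourier_coeff u k = f k)"

text \<open>\<open>hs j f\<close>: the family \<open>f\<close> has the decay of the Fourier coefficients of an \<open>H\<^sup>j\<close> function.\<close>

definition hs :: "nat \<Rightarrow> (int \<times> int \<Rightarrow> complex) \<Rightarrow> bool" where
  "hs j f \<longleftrightarrow> (\<lambda>k. (cmod (of_real (jb k ^ j) * f k))\<^sup>2) summable_on UNIV"

lemma has_fcD: "has_fc u f \<Longrightarrow> u \<in> L2_space" "has_fc u f \<Longrightarrow> fourier_coeff u k = f k"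
  unfolding has_fc_def by blast+

lemma has_fc_coeff: "u \<in> L2_space \<Longrightarrow> has_fc u (fourier_coeff u)"
  by (simp add: has_fc_def)

lemma has_fc_herm: "has_fc u f \<Longrightarrow> herm f"
  using herm_fourier_coeff[of u] unfolding has_fc_def herm_def by metis

lemma has_fc_exists: "hs 0 f \<Longrightarrow> herm f \<Longrightarrow> \<exists>u. has_fc u f"
  using riesz_fischer[of f] unfolding has_fc_def hs_def by auto

lemma has_fc_unique: "has_fc u f \<Longrightarrow> has_fc v f \<Longrightarrow> AE p in torus. u p = v p"
  by (rule fourier_coeff_unique) (auto simp: has_fcD L2_integrable)

lemma has_fc_add: "has_fc u f \<Longrightarrow> has_fc v g \<Longrightarrow> has_fc (\<lambda>p. u p + v p) (\<lambda>k. f k + g k)"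
  unfolding has_fc_def by (auto simp: L2_add fourier_coeff_add L2_integrable)

lemma has_fc_diff: "has_fc u f \<Longrightarrow> has_fc v g \<Longrightarrow> has_fc (\<lambda>p. u p - v p) (\<lambda>k. f k - g k)"
  unfolding has_fc_def by (auto simp: L2_diff fourier_coeff_diff L2_integrable)

lemma has_fc_cmult: "has_fc u f \<Longrightarrow> has_fc (\<lambda>p. c * u p) (\<lambda>k. of_real c * f k)"
  unfolding has_fc_def by (auto simp: L2_cmult fourier_coeff_cmult)

lemma has_fc_cong: "has_fc u f \<Longrightarrow> (\<And>k. f k = g k) \<Longrightarrow> has_fc u g"
  unfolding has_fc_def by auto

lemma hs_multiplier:
  assumes f: "hs (i + j) f" and m: "\<And>k. cmod (m k) \<le> C * jb k ^ i"
  shows "hs j (\<lambda>k. m k * f k)"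
  unfolding hs_def
proof (rule summable_on_comparison_test)
  show "(\<lambda>k. C\<^sup>2 * (cmod (of_real (jb k ^ (i + j)) * f k))\<^sup>2) summable_on UNIV"
    using f unfolding hs_def by (rule summable_on_cmult_right)
  fix k
  have "jb k ^ j * (cmod (m k) * cmod (f k)) \<le> jb k ^ j * ((C * jb k ^ i) * cmod (f k))"
    by (intro mult_left_mono mult_right_mono m) (auto simp: jb_nonneg)
  then have "cmod (of_real (jb k ^ j) * (m k * f k)) \<le> C * cmod (of_real (jb k ^ (i + j)) * f k)"
    by (simp add: norm_mult norm_power jb_nonneg power_add mult_ac)
  then have "(cmod (of_real (jb k ^ j) * (m k * f k)))\<^sup>2 \<le> (C * cmod (of_real (jb k ^ (i + j)) * f k))\<^sup>2"
    by (rule power_mono) simp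
  then show "(cmod (of_real (jb k ^ j) * (m k * f k)))\<^sup>2 \<le> C\<^sup>2 * (cmod (of_real (jb k ^ (i + j)) * f k))\<^sup>2"
    by (simp add: power_mult_distrib)
qed simp

lemma hs_mono: "hs j f \<Longrightarrow> i \<le> j \<Longrightarrow> hs i f"
  using hs_multiplier[of "j - i" i f "\<lambda>_. 1" 1] by (simp add: one_le_power jb_ge_1)

lemma hs_l2bd: "hs j f \<Longrightarrow> \<exists>B. l2bd (\<lambda>k. of_real (jb k ^ j) * f k) B"
  unfolding hs_def by (drule l2bd_sqrt_infsum) (rule exI)

lemma l2bd_hs: "l2bd (\<lambda>k. of_real (jb k ^ j) * f k) B \<Longrightarrow> hs j f"
  unfolding hs_def by (rule l2bd_summable)

lemma sobolev_weight:
  "(1 + (freq_norm k)\<^sup>2) ^ s * (cmod z)\<^sup>2 = (cmod (of_real (jb k ^ s) * z))\<^sup>2"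
proof -
  have "(1 + (freq_norm k)\<^sup>2) ^ s = (jb k ^ s)\<^sup>2"
    unfolding jb_power_even[symmetric] power_mult[symmetric] by (simp only: mult.commute)
  then show ?thesis by (simp add: norm_mult norm_power jb_nonneg power_mult_distrib)
qed

lemma sobolev_iff: "u \<in> sobolev s \<longleftrightarrow> u \<in> L2_space \<and> hs s (fourier_coeff u)"
  by (simp add: sobolev_def hs_def sobolev_weight)

lemma sobolev_norm_eq: "sobolev_norm s u = sqrt (\<Sum>\<^sub>\<infinity>k. (cmod (of_real (jb k ^ s) * fourier_coeff u k))\<^sup>2)"
  by (simp add: sobolev_norm_def sobolev_weight)

text \<open>Riesz-Fischer shows that the choice in \<open>fourier_multiplier\<close> is made from a
  nonempty set. The symmetry of the symbol makes the new family that of a real function, and one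
  derivative in the weight pays for its growth.\<close>

lemma has_fc_multiplier:
  assumes u: "has_fc u f" and f: "hs 1 f" and m: "\<And>k. cmod (m k) \<le> jb k" "\<And>k. m (- k) = cnj (m k)"
  shows "has_fc (fourier_multiplier m u) (\<lambda>k. m k * f k)"
proof -
  have "herm (\<lambda>k. m k * f k)" unfolding herm_def using hermD[OF has_fc_herm[OF u]] m(2) by simp
  moreover have "hs 0 (\<lambda>k. m k * f k)" by (rule hs_multiplier[of 1 0 f m 1]) (use f m in auto)
  ultimately obtain v where "has_fc v (\<lambda>k. m k * f k)" using has_fc_exists by blast
  then have "\<exists>v. v \<in> L2_space \<and> (\<forall>k. fourier_coeff v k = m k * fourier_coeff u k)"
    unfolding has_fc_def has_fcD(2)[OF u] by blast
  from someI_ex[OF this] show ?thesis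
    unfolding has_fc_def fourier_multiplier_def has_fcD(2)[OF u] by blast
qed

lemma has_fc_dx: "has_fc u f \<Longrightarrow> hs 1 f \<Longrightarrow> has_fc (dx u) (\<lambda>k. \<i> * of_int (fst k) * f k)"
  unfolding dx_def by (rule has_fc_multiplier) (auto simp: norm_mult fst_le_jb)

lemma has_fc_dy: "has_fc u f \<Longrightarrow> hs 1 f \<Longrightarrow> has_fc (dy u) (\<lambda>k. \<i> * of_int (snd k) * f k)"
  unfolding dy_def by (rule has_fc_multiplier) (auto simp: norm_mult snd_le_jb)

lemma has_fc_Lam: "has_fc u f \<Longrightarrow> hs 1 f \<Longrightarrow> has_fc (Lam u) (\<lambda>k. of_real (freq_norm k) * f k)"
  unfolding Lam_def by (rule has_fc_multiplier) (auto simp: freq_norm_le_jb)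

lemma hs_dx: "hs (Suc j) f \<Longrightarrow> hs j (\<lambda>k. \<i> * of_int (fst k) * f k)"
  by (rule hs_multiplier[of 1 j f _ 1]) (auto simp: norm_mult fst_le_jb)

lemma hs_dy: "hs (Suc j) f \<Longrightarrow> hs j (\<lambda>k. \<i> * of_int (snd k) * f k)"
  by (rule hs_multiplier[of 1 j f _ 1]) (auto simp: norm_mult snd_le_jb)

lemma hs_Lam: "hs (Suc j) f \<Longrightarrow> hs j (\<lambda>k. of_real (freq_norm k) * f k)"
  by (rule hs_multiplier[of 1 j f _ 1]) (auto simp: freq_norm_le_jb)

lemma has_fc_dx2:
  assumes "has_fc u f" "hs 2 f" shows "has_fc (dx (dx u)) (\<lambda>k. - (of_int (fst k))\<^sup>2 * f k)"
proof -
  have "hs 1 f" by (rule hs_mono[OF assms(2)]) simp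
  moreover have "hs (Suc 1) f" using assms(2) by (simp add: numeral_2_eq_2)
  ultimately have "has_fc (dx (dx u)) (\<lambda>k. \<i> * of_int (fst k) * (\<i> * of_int (fst k) * f k))"
    by (intro has_fc_dx hs_dx assms(1)) auto
  then show ?thesis by (rule has_fc_cong) (simp add: power2_eq_square mult_ac)
qed

lemma has_fc_dy2:
  assumes "has_fc u f" "hs 2 f" shows "has_fc (dy (dy u)) (\<lambda>k. - (of_int (snd k))\<^sup>2 * f k)"
proof -
  have "hs 1 f" by (rule hs_mono[OF assms(2)]) simp
  moreover have "hs (Suc 1) f" using assms(2) by (simp add: numeral_2_eq_2)
  ultimately have "has_fc (dy (dy u)) (\<lambda>k. \<i> * of_int (snd k) * (\<i> * of_int (snd k) * f k))"
    by (intro has_fc_dy hs_dy assms(1)) auto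
  then show ?thesis by (rule has_fc_cong) (simp add: power2_eq_square mult_ac)
qed

lemma has_fc_laplacian:
  assumes "has_fc u f" "hs 2 f" shows "has_fc (laplacian u) (\<lambda>k. - of_real ((freq_norm k)\<^sup>2) * f k)"
  unfolding laplacian_def
  by (rule has_fc_cong[OF has_fc_add[OF has_fc_dx2[OF assms] has_fc_dy2[OF assms]]])
    (simp add: freq_norm_def algebra_simps)

lemma has_fc_Lam3:
  assumes "has_fc u f" "hs 3 f" shows "has_fc ((Lam ^^ 3) u) (\<lambda>k. of_real (freq_norm k ^ 3) * f k)"
proof -
  have "hs 1 f" "hs (Suc 1) f" "hs (Suc (Suc 1)) f"
    using assms(2) by (auto intro: hs_mono[OF assms(2)])
  then have "has_fc (Lam (Lam (Lam u))) (\<lambda>k. of_real (freq_norm k) * (of_real (freq_norm k) * (of_real (freq_norm k) * f k)))"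
    by (intro has_fc_Lam hs_Lam assms(1))
  then show ?thesis
    by (simp add: numeral_3_eq_3) (rule has_fc_cong, assumption, simp add: mult.assoc)
qed

section \<open>The linear part, its symbol, and the nonlinear term\<close>

definition symb :: "real \<Rightarrow> real \<Rightarrow> real \<Rightarrow> int \<times> int \<Rightarrow> real" where
  "symb \<beta> \<delta> \<epsilon> k = - (\<beta> - 1) * (of_int (fst k))\<^sup>2 + (of_int (snd k))\<^sup>2 - \<delta> * freq_norm k ^ 3 + \<epsilon> * freq_norm k ^ 4"

definition linpart :: "real \<Rightarrow> real \<Rightarrow> real \<Rightarrow> tfun \<Rightarrow> tfun" where
  "linpart \<beta> \<delta> \<epsilon> u p = (\<beta> - 1) * dx (dx u) p - dy (dy u) p - \<delta> * (Lam ^^ 3) u p + \<epsilon> * laplacian (laplacian u) p"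

lemma has_fc_linpart:
  assumes u: "has_fc u f" and f: "hs 4 f"
  shows "has_fc (linpart \<beta> \<delta> \<epsilon> u) (\<lambda>k. of_real (symb \<beta> \<delta> \<epsilon> k) * f k)"
proof -
  have f2: "hs 2 f" and f3: "hs 3 f" by (auto intro: hs_mono[OF f])
  have "hs 2 (\<lambda>k. - of_real ((freq_norm k)\<^sup>2) * f k)"
  proof (rule hs_multiplier[of 2 2 f _ 1])
    show "hs (2 + 2) f" using f by simp
    show "cmod (- of_real ((freq_norm k)\<^sup>2)) \<le> 1 * (jb k)\<^sup>2" for k
      by (simp add: norm_power freq_norm_le_jb power_mono)
  qed
  from has_fc_laplacian[OF has_fc_laplacian[OF u f2] this]
  have lap: "has_fc (laplacian (laplacian u)) (\<lambda>k. of_real (freq_norm k ^ 4) * f k)"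
    by (rule has_fc_cong) (simp add: power_numeral_reduce mult.assoc)
  show ?thesis
    unfolding linpart_def[abs_def]
    by (rule has_fc_cong[OF has_fc_add[OF has_fc_diff[OF has_fc_diff[OF has_fc_cmult[OF has_fc_dx2[OF u f2]]
      has_fc_dy2[OF u f2]] has_fc_cmult[OF has_fc_Lam3[OF u f3]]] has_fc_cmult[OF lap]]])
      (simp add: symb_def algebra_simps)
qed

text \<open>The identity u u_x = (u^2)_x / 2 on the frequency side: adding the commuted convolution
  combines the factors \<open>k - l\<close> and \<open>l\<close> into \<open>k\<close>, which leaves
  the sum over \<open>l\<close>.\<close>

lemma conv_derivative:
  assumes "l2bd f A" "l2bd (\<lambda>k. \<i> * of_int (fst k) * f k) B"
  shows "conv f (\<lambda>k. \<i> * of_int (fst k) * f k) k = nl f k"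
proof -
  let ?g = "\<lambda>k. \<i> * of_int (fst k) * f k"
  have s1: "(\<lambda>l. f l * ?g (k - l)) summable_on UNIV" by (rule conv_summable[OF assms])
  have s2: "(\<lambda>l. ?g l * f (k - l)) summable_on UNIV" by (rule conv_summable[OF assms(2,1)])
  have "2 * conv f ?g k = conv f ?g k + conv ?g f k" using conv_commute[of ?g f k] by simp
  also have "\<dots> = (\<Sum>\<^sub>\<infinity>l. f l * ?g (k - l) + ?g l * f (k - l))"
    unfolding conv_def by (rule infsum_add[OF s1 s2, symmetric])
  also have "\<dots> = (\<Sum>\<^sub>\<infinity>l. \<i> * of_int (fst k) * (f l * f (k - l)))"
    by (rule infsum_cong) (simp add: algebra_simps)
  also have "\<dots> = \<i> * of_int (fst k) * conv f f k" by (simp only: conv_def infsum_cmult_right')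
  finally have "2 * conv f ?g k / 2 = \<i> * of_int (fst k) * conv f f k / 2" by simp
  then show ?thesis by (simp add: nl_def)
qed

lemma fourier_coeff_nonlinear:
  assumes u: "has_fc u f" and f: "hs 1 f"
  shows "integrable torus (\<lambda>p. u p * dx u p)" "fourier_coeff (\<lambda>p. u p * dx u p) k = nl f k"
proof -
  note d = has_fc_dx[OF u f]
  show "integrable torus (\<lambda>p. u p * dx u p)" by (rule L2_mult_integrable[OF has_fcD(1)[OF u] has_fcD(1)[OF d]])
  have fe: "fourier_coeff u = f" "fourier_coeff (dx u) = (\<lambda>k. \<i> * of_int (fst k) * f k)"
    using has_fcD(2)[OF u] has_fcD(2)[OF d] by blast+
  have "fourier_coeff (\<lambda>p. u p * dx u p) k = conv f (\<lambda>k. \<i> * of_int (fst k) * f k) k"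
    unfolding fourier_coeff_mult[OF has_fcD(1)[OF u] has_fcD(1)[OF d]] fe ..
  also have "\<dots> = nl f k"
    using l2bd_fourier_coeff[OF has_fcD(1)[OF u]] l2bd_fourier_coeff[OF has_fcD(1)[OF d]]
    unfolding fe by (rule conv_derivative)
  finally show "fourier_coeff (\<lambda>p. u p * dx u p) k = nl f k" .
qed

lemma L2_cong_AE:
  assumes "v \<in> L2_space" "u \<in> borel_measurable torus" "AE p in torus. u p = v p"
  shows "u \<in> L2_space"
proof -
  have "integrable torus (\<lambda>p. (u p)\<^sup>2) \<longleftrightarrow> integrable torus (\<lambda>p. (v p)\<^sup>2)"
  proof (rule integrable_cong_AE)
    show "(\<lambda>p. (u p)\<^sup>2) \<in> borel_measurable torus" using assms(2) by (rule borel_measurable_power)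
    show "(\<lambda>p. (v p)\<^sup>2) \<in> borel_measurable torus" using L2_measurable[OF assms(1)] by (rule borel_measurable_power)
    show "AE p in torus. (u p)\<^sup>2 = (v p)\<^sup>2" using assms(3) by eventually_elim simp
  qed
  then show ?thesis using L2_sq_integrable[OF assms(1)] assms(2) by (simp add: L2_space_def)
qed

text \<open>A product of two L^2 functions is a priori only integrable. By the tame estimate with
  three derivatives \<open>nl f\<close> decays like J^-2, so it belongs to an L^2 function, with
  which the product agrees almost everywhere by uniqueness of coefficients.\<close>

lemma has_fc_nonlinear:
  assumes u: "has_fc u f" and f: "hs 3 f"
  shows "has_fc (\<lambda>p. u p * dx u p) (nl f)"
proof -
  have f1: "hs 1 f" by (rule hs_mono[OF f]) simp
  note nlc = fourier_coeff_nonlinear[OF u f1]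
  obtain B where B: "l2bd (\<lambda>k. of_real (jb k ^ 3) * f k) B" using hs_l2bd[OF f] by blast
  have "hs 0 f" by (rule hs_mono[OF f]) simp
  then obtain A where A: "l2bd f A" using hs_l2bd[of 0 f] by auto
  have AB: "0 \<le> A" "0 \<le> B" using A B l2bd_nonneg by blast+
  have "l2bd (nl f) (2 ^ 3 * (2 * B * A) * sqrt jsum)"
  proof (rule l2bd_decay)
    fix k
    have "jb k * ((jb k)\<^sup>2 * cmod (nl f k)) \<le> jb k * (2 ^ 3 * (2 * B * A))"
      using nl_tame[OF B A, of k] by (simp add: power_numeral_reduce mult.assoc)
    then have "(jb k)\<^sup>2 * cmod (nl f k) \<le> 2 ^ 3 * (2 * B * A)"
      using jb_pos[of k] by (simp only: mult_le_cancel_left_pos)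
    then have "cmod (nl f k) * (jb k)\<^sup>2 \<le> 2 ^ 3 * (2 * B * A)" by (simp only: mult.commute)
    then show "cmod (nl f k) \<le> 2 ^ 3 * (2 * B * A) / (jb k)\<^sup>2"
      using jb_pos[of k] by (subst pos_le_divide_eq) auto
  qed (use AB in auto)
  then have "hs 0 (nl f)" by (intro l2bd_hs[of 0]) simp
  moreover have "herm (nl f)" unfolding herm_def using nl_herm[OF has_fc_herm[OF u]] by blast
  ultimately obtain v where v: "has_fc v (nl f)" using has_fc_exists by blast
  have "AE p in torus. u p * dx u p = v p"
    by (rule fourier_coeff_unique[OF nlc(1) L2_integrable[OF has_fcD(1)[OF v]]]) (simp add: nlc(2) has_fcD(2)[OF v])
  then have "(\<lambda>p. u p * dx u p) \<in> L2_space"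
    by (rule L2_cong_AE[OF has_fcD(1)[OF v] borel_measurable_integrable[OF nlc(1)]])
  then show ?thesis unfolding has_fc_def using nlc(2) by blast
qed

lemma has_fc_rhs:
  assumes "has_fc u f" "hs 4 f"
  shows "has_fc (\<lambda>p. - (u p * dx u p) - linpart \<beta> \<delta> \<epsilon> u p)
    (\<lambda>k. - of_real (symb \<beta> \<delta> \<epsilon> k) * f k - nl f k)"
proof -
  have "hs 3 f" by (rule hs_mono[OF assms(2)]) simp
  from has_fc_diff[OF has_fc_cmult[OF has_fc_nonlinear[OF assms(1) this], of "-1"]
      has_fc_linpart[OF assms, of \<beta> \<delta> \<epsilon>]] show ?thesis
    by (simp add: mult.commute has_fc_def)
qed

lemma has_fc_L2_norm: "has_fc u f \<Longrightarrow> L2_norm u = 2 * pi * sqrt (\<Sum>\<^sub>\<infinity>k. (cmod (f k))\<^sup>2)"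
proof -
  assume u: "has_fc u f"
  then have "fourier_coeff u = f" using has_fcD(2) by blast
  then show ?thesis using L2_norm_parseval[OF has_fcD(1)[OF u]] by simp
qed

lemma has_fc_L2_inner:
  assumes "has_fc u f" "has_fc v g"
  shows "L2_inner u v = (2 * pi)\<^sup>2 * Re (\<Sum>\<^sub>\<infinity>k. f k * g (- k))"
proof -
  have eqs: "fourier_coeff u = f" "fourier_coeff v = g" using assms has_fcD(2) by blast+
  have "complex_of_real (L2_inner u v) = of_real ((2 * pi)\<^sup>2) * (\<Sum>\<^sub>\<infinity>k. f k * g (- k))"
    using parseval_inner[OF has_fcD(1)[OF assms(1)] has_fcD(1)[OF assms(2)]]
    unfolding L2_inner_def eqs .
  then have "Re (complex_of_real (L2_inner u v)) = Re ((2 * pi)\<^sup>2 *\<^sub>R (\<Sum>\<^sub>\<infinity>k. f k * g (- k)))"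
    by (simp only: scaleR_conv_of_real)
  then show ?thesis by (simp only: Re_complex_of_real scaleR_complex.sel)
qed

text \<open>The cubic term and then the second-order terms are absorbed by completing squares, at
  the expense of a quarter of \<epsilon> r^4 each. The remaining half dominates \<epsilon> J^4 / 4
  up to a constant.\<close>

lemma symb_symbol:
  assumes e: "0 < \<epsilon>" and d: "0 \<le> \<delta>" and T: "0 < T"
  shows "\<exists>c C0 C1. symbol (symb \<beta> \<delta> \<epsilon>) c C0 C1 T"
proof -
  \<comment> \<open>The coefficient of r^2 after the cubic term has been absorbed. \<open>C0\<close>
    collects the constant of the second square and the one from J^4 \<le> 2 + 2 r^4.\<close>
  define B where "B = \<bar>\<beta> - 1\<bar> + \<delta>\<^sup>2 / \<epsilon>"
  define C0 where "C0 = \<epsilon> / 2 + B\<^sup>2 / \<epsilon>"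
  have lower: "\<epsilon> / 4 * jb k ^ 4 \<le> symb \<beta> \<delta> \<epsilon> k + C0" for k
  proof -
    define r where "r = freq_norm k"
    have r: "0 \<le> r" by (simp add: r_def)
    have sq: "(of_int (fst k))\<^sup>2 \<le> r\<^sup>2" "(0::real) \<le> (of_int (snd k))\<^sup>2" by (simp_all add: r_def freq_norm_def)
    have "(\<beta> - 1) * (of_int (fst k))\<^sup>2 \<le> \<bar>\<beta> - 1\<bar> * r\<^sup>2"
      using sq(1) by (intro mult_mono) auto
    moreover have "\<delta> * r ^ 3 \<le> \<epsilon> / 4 * r ^ 4 + \<delta>\<^sup>2 / \<epsilon> * r\<^sup>2"
    proof -
      have "0 \<le> (\<epsilon> / 2 * r - \<delta>)\<^sup>2 * (r\<^sup>2 / \<epsilon>)" using e by simp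
      also have "\<dots> = \<epsilon> / 4 * r ^ 4 - \<delta> * r ^ 3 + \<delta>\<^sup>2 / \<epsilon> * r\<^sup>2"
        using e by (simp add: field_simps power2_eq_square power_numeral_reduce)
      finally show ?thesis by simp
    qed
    moreover have "B * r\<^sup>2 \<le> \<epsilon> / 4 * r ^ 4 + B\<^sup>2 / \<epsilon>"
    proof -
      have "0 \<le> (\<epsilon> / 2 * r\<^sup>2 - B)\<^sup>2 / \<epsilon>" using e by simp
      also have "\<dots> = \<epsilon> / 4 * r ^ 4 - B * r\<^sup>2 + B\<^sup>2 / \<epsilon>"
        using e by (simp add: field_simps power2_eq_square power_numeral_reduce)
      finally show ?thesis by simp
    qed
    moreover have "B * r\<^sup>2 = \<bar>\<beta> - 1\<bar> * r\<^sup>2 + \<delta>\<^sup>2 / \<epsilon> * r\<^sup>2" by (simp add: B_def distrib_right)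
    moreover have "\<epsilon> / 4 * jb k ^ 4 \<le> \<epsilon> / 2 + \<epsilon> / 2 * r ^ 4"
    proof -
      have "jb k ^ 4 = ((jb k)\<^sup>2)\<^sup>2" by simp
      also have "\<dots> = (1 + r\<^sup>2)\<^sup>2" by (simp only: jb_sq r_def)
      also have "\<dots> \<le> 2 + 2 * r ^ 4"
        using zero_le_power2[of "1 - r\<^sup>2"] by (simp add: power2_eq_square power_numeral_reduce algebra_simps)
      finally have "\<epsilon> / 4 * jb k ^ 4 \<le> \<epsilon> / 4 * (2 + 2 * r ^ 4)" using e by (intro mult_left_mono) auto
      then show ?thesis by (simp add: algebra_simps)
    qed
    moreover have "symb \<beta> \<delta> \<epsilon> k = - ((\<beta> - 1) * (of_int (fst k))\<^sup>2) + (of_int (snd k))\<^sup>2 - \<delta> * r ^ 3 + \<epsilon> * r ^ 4"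
      by (simp add: symb_def r_def algebra_simps)
    ultimately show ?thesis using sq(2) unfolding C0_def by linarith
  qed
  have upper: "\<bar>symb \<beta> \<delta> \<epsilon> k\<bar> \<le> (\<bar>\<beta> - 1\<bar> + 1 + \<delta> + \<epsilon>) * jb k ^ 4" for k
  proof -
    have p: "jb k ^ i \<le> jb k ^ 4" if "i \<le> 4" for i by (rule power_increasing[OF that jb_ge_1])
    have f2: "(of_int (fst k))\<^sup>2 \<le> jb k ^ 4" "(of_int (snd k))\<^sup>2 \<le> jb k ^ 4"
      using power_mono[OF fst_le_jb, of k 2] power_mono[OF snd_le_jb, of k 2] p[of 2] by auto
    have f3: "freq_norm k ^ 3 \<le> jb k ^ 4" "freq_norm k ^ 4 \<le> jb k ^ 4"
      using power_mono[OF freq_norm_le_jb freq_norm_nonneg, of k 3] power_mono[OF freq_norm_le_jb freq_norm_nonneg, of k 4] p[of 3] by auto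
    have "\<bar>symb \<beta> \<delta> \<epsilon> k\<bar> \<le> \<bar>\<beta> - 1\<bar> * (of_int (fst k))\<^sup>2 + (of_int (snd k))\<^sup>2 + \<delta> * freq_norm k ^ 3 + \<epsilon> * freq_norm k ^ 4"
    proof -
      define X where "X = (\<beta> - 1) * (of_int (fst k))\<^sup>2"
      have "\<bar>X\<bar> = \<bar>\<beta> - 1\<bar> * (of_int (fst k))\<^sup>2" by (simp add: X_def abs_mult)
      moreover have "X \<le> \<bar>X\<bar>" "- X \<le> \<bar>X\<bar>" by simp_all
      moreover have "0 \<le> \<delta> * freq_norm k ^ 3" "0 \<le> \<epsilon> * freq_norm k ^ 4" using d e by simp_all
      moreover have "(0::real) \<le> (of_int (snd k))\<^sup>2" by simp
      moreover have "symb \<beta> \<delta> \<epsilon> k = - X + (of_int (snd k))\<^sup>2 - \<delta> * freq_norm k ^ 3 + \<epsilon> * freq_norm k ^ 4"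
        by (simp add: symb_def X_def algebra_simps)
      ultimately show ?thesis unfolding abs_le_iff by linarith
    qed
    also have "\<dots> \<le> \<bar>\<beta> - 1\<bar> * jb k ^ 4 + jb k ^ 4 + \<delta> * jb k ^ 4 + \<epsilon> * jb k ^ 4"
      using f2 f3 d e by (intro add_mono mult_left_mono) auto
    finally show ?thesis by (simp add: algebra_simps)
  qed
  have "symbol (symb \<beta> \<delta> \<epsilon>) (\<epsilon> / 4) C0 (\<bar>\<beta> - 1\<bar> + 1 + \<delta> + \<epsilon>) T"
  proof
    show "0 \<le> C0" using e by (simp add: C0_def)
    show "symb \<beta> \<delta> \<epsilon> (- k) = symb \<beta> \<delta> \<epsilon> k" for k by (simp add: symb_def)
  qed (use e T lower upper in auto)
  then show ?thesis by blast
qed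

section \<open>Integration in time\<close>

lemma continuous_lebesgue_open:
  fixes h :: "real \<Rightarrow> real"
  assumes h: "continuous_on {0..T} h"
  shows "integrable (lebesgue_on {0<..<T}) h" "integral\<^sup>L (lebesgue_on {0<..<T}) h = integral {0..T} h"
proof -
  have "integrable (lebesgue_on {0..T}) h" by (rule continuous_imp_integrable_real[OF h])
  then have "set_integrable lebesgue {0..T} h"
    by (simp add: set_integrable_def integrable_restrict_space)
  then have "set_integrable lebesgue {0<..<T} h"
    by (rule set_integrable_subset) auto
  then show i: "integrable (lebesgue_on {0<..<T}) h"
    by (simp add: set_integrable_def integrable_restrict_space)
  have "integral\<^sup>L (lebesgue_on {0<..<T}) h = integral {0<..<T} h"
    by (rule lebesgue_integral_eq_integral[OF i]) simp
  also have "\<dots> = integral {0..T} h" by (rule integral_open_interval_real[symmetric])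
  finally show "integral\<^sup>L (lebesgue_on {0<..<T}) h = integral {0..T} h" .
qed

text \<open>An exhaustion of the lattice by finite sets that turns unordered sums into limits of
  sequences, as Fatou's lemma and dominated convergence demand.\<close>

definition bx :: "nat \<Rightarrow> (int \<times> int) set" where
  "bx n = {- int n..int n} \<times> {- int n..int n}"

lemma finite_bx [simp]: "finite (bx n)"
  by (simp add: bx_def)

lemma bx_infsum:
  fixes h :: "int \<times> int \<Rightarrow> 'a::banach"
  assumes "h summable_on UNIV"
  shows "(\<lambda>n. sum h (bx n)) \<longlonglongrightarrow> infsum h UNIV"
proof -
  have ev: "\<forall>\<^sub>F n in sequentially. X \<subseteq> bx n" if "finite X" for X
    using that
  proof (induction X)
    case (insert k X)
    have "\<forall>\<^sub>F n in sequentially. k \<in> bx n"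
      using eventually_ge_at_top[of "nat (max \<bar>fst k\<bar> \<bar>snd k\<bar>)"]
    proof eventually_elim
      case (elim n)
      then show ?case by (cases k) (auto simp: bx_def)
    qed
    with insert.IH show ?case by eventually_elim simp
  qed simp
  have "filterlim bx (finite_subsets_at_top UNIV) sequentially"
    unfolding filterlim_finite_subsets_at_top
  proof (intro allI impI)
    fix X :: "(int \<times> int) set" assume "finite X \<and> X \<subseteq> UNIV"
    then have "\<forall>\<^sub>F n in sequentially. X \<subseteq> bx n" using ev by blast
    then show "\<forall>\<^sub>F n in sequentially. finite (bx n) \<and> X \<subseteq> bx n \<and> bx n \<subseteq> UNIV"
      by eventually_elim simp
  qed
  moreover have "(sum h \<longlongrightarrow> infsum h UNIV) (finite_subsets_at_top UNIV)"
    using has_sum_infsum[OF assms] by (simp add: has_sum_def)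
  ultimately show ?thesis by (rule filterlim_compose[rotated])
qed

text \<open>Fatou's lemma along the exhaustion \<open>bx\<close>.\<close>

lemma infsum_integrable:
  fixes h :: "int \<times> int \<Rightarrow> real \<Rightarrow> real"
  assumes m: "\<And>k. h k \<in> borel_measurable M" and p: "\<And>k t. 0 \<le> h k t"
    and s: "\<And>t. t \<in> space M \<Longrightarrow> (\<lambda>k. h k t) summable_on UNIV"
    and i: "\<And>n. integrable M (\<lambda>t. \<Sum>k\<in>bx n. h k t)" "\<And>n. (\<integral>t. (\<Sum>k\<in>bx n. h k t) \<partial>M) \<le> C"
  shows "integrable M (\<lambda>t. \<Sum>\<^sub>\<infinity>k. h k t)"
proof (rule integrableI_bounded)
  have lim: "(\<lambda>n. \<Sum>k\<in>bx n. h k t) \<longlonglongrightarrow> (\<Sum>\<^sub>\<infinity>k. h k t)" if "t \<in> space M" for t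
    by (rule bx_infsum[OF s[OF that]])
  show "(\<lambda>t. \<Sum>\<^sub>\<infinity>k. h k t) \<in> borel_measurable M"
    by (rule borel_measurable_LIMSEQ_real[OF lim]) (auto intro!: borel_measurable_sum m)
  have "(\<integral>\<^sup>+t. ennreal (norm (\<Sum>\<^sub>\<infinity>k. h k t)) \<partial>M) \<le> (\<integral>\<^sup>+t. liminf (\<lambda>n. ennreal (\<Sum>k\<in>bx n. h k t)) \<partial>M)"
  proof (rule nn_integral_mono)
    fix t assume t: "t \<in> space M"
    have "(\<lambda>n. ennreal (\<Sum>k\<in>bx n. h k t)) \<longlonglongrightarrow> ennreal (\<Sum>\<^sub>\<infinity>k. h k t)"
      by (rule tendsto_ennrealI[OF lim[OF t]])
    then have "liminf (\<lambda>n. ennreal (\<Sum>k\<in>bx n. h k t)) = ennreal (\<Sum>\<^sub>\<infinity>k. h k t)"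
      by (rule lim_imp_Liminf[OF sequentially_bot])
    moreover have "0 \<le> (\<Sum>\<^sub>\<infinity>k. h k t)" by (rule infsum_nonneg) (rule p)
    ultimately show "ennreal (norm (\<Sum>\<^sub>\<infinity>k. h k t)) \<le> liminf (\<lambda>n. ennreal (\<Sum>k\<in>bx n. h k t))" by simp
  qed
  also have "\<dots> \<le> liminf (\<lambda>n. \<integral>\<^sup>+t. ennreal (\<Sum>k\<in>bx n. h k t) \<partial>M)"
    by (rule nn_integral_liminf) (intro measurable_compose[OF _ measurable_ennreal] borel_measurable_sum m)
  also have "\<dots> \<le> ennreal C"
  proof (rule Liminf_le[OF sequentially_bot], rule always_eventually, rule allI)
    fix n
    have "(\<integral>\<^sup>+t. ennreal (\<Sum>k\<in>bx n. h k t) \<partial>M) = ennreal (\<integral>t. (\<Sum>k\<in>bx n. h k t) \<partial>M)"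
      by (rule nn_integral_eq_integral[OF i(1)]) (simp add: sum_nonneg p)
    also have "\<dots> \<le> ennreal C" by (rule ennreal_leI[OF i(2)])
    finally show "(\<integral>\<^sup>+t. ennreal (\<Sum>k\<in>bx n. h k t) \<partial>M) \<le> ennreal C" .
  qed
  finally show "(\<integral>\<^sup>+t. ennreal (norm (\<Sum>\<^sub>\<infinity>k. h k t)) \<partial>M) < \<infinity>" by (simp add: le_less_trans)
qed

text \<open>The value at the right end point of the cell of length \<open>T / (n + 1)\<close> that contains \<open>t\<close>.\<close>

definition grid :: "real \<Rightarrow> nat \<Rightarrow> real \<Rightarrow> real" where
  "grid T n t = T * (of_int \<lfloor>real (Suc n) * t / T\<rfloor> + 1) / real (Suc n)"

lemma grid_facts:
  assumes T: "0 < T" and t: "t \<in> {0<..<T}"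
  shows "grid T n t \<in> {0<..T}" "\<bar>grid T n t - t\<bar> \<le> T / real (Suc n)" "\<lfloor>real (Suc n) * t / T\<rfloor> \<in> {0..int n}"
proof -
  define y where "y = real (Suc n) * t / T"
  have y: "0 < y" unfolding y_def using T t by (intro divide_pos_pos mult_pos_pos) auto
  have y: "0 < y" "y < real (Suc n)"
    using y T t by (simp_all add: y_def pos_divide_less_eq del: of_nat_Suc)
  have f: "0 \<le> \<lfloor>y\<rfloor>" "\<lfloor>y\<rfloor> < int (Suc n)" using y by (simp_all add: floor_less_iff)
  then show "\<lfloor>real (Suc n) * t / T\<rfloor> \<in> {0..int n}" by (simp add: y_def)
  have fr: "of_int \<lfloor>y\<rfloor> + 1 \<le> real (Suc n)" using f(2) by linarith
  have "T * (of_int \<lfloor>y\<rfloor> + 1) \<le> T * real (Suc n)" using T fr by (intro mult_left_mono) auto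
  moreover have "0 < T * (of_int \<lfloor>y\<rfloor> + 1)"
  proof (rule mult_pos_pos[OF T])
    show "0 < (of_int \<lfloor>y\<rfloor> + 1 :: real)" using f(1) by linarith
  qed
  ultimately show "grid T n t \<in> {0<..T}" unfolding grid_def y_def[symmetric]
    by (simp add: divide_le_eq)
  have ty: "t = T * y / real (Suc n)" using T by (simp add: y_def)
  have "grid T n t - t = T * (of_int \<lfloor>y\<rfloor> + 1) / real (Suc n) - T * y / real (Suc n)"
    unfolding grid_def y_def[symmetric] by (simp only: ty[symmetric])
  then have "grid T n t - t = T / real (Suc n) * (of_int \<lfloor>y\<rfloor> + 1 - y)"
    by (simp only: right_diff_distrib diff_divide_distrib times_divide_eq_left)
  moreover have "\<bar>of_int \<lfloor>y\<rfloor> + 1 - y\<bar> \<le> 1" by linarith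
  ultimately have "\<bar>grid T n t - t\<bar> \<le> T / real (Suc n) * 1"
    using T by (simp only: abs_mult) (intro mult_mono; simp)
  then show "\<bar>grid T n t - t\<bar> \<le> T / real (Suc n)" by simp
qed

lemma grid_tendsto:
  assumes T: "0 < T" and t: "t \<in> {0<..<T}"
  shows "(\<lambda>n. grid T n t) \<longlonglongrightarrow> t"
proof -
  have "(\<lambda>n. grid T n t - t) \<longlonglongrightarrow> 0"
  proof (rule Lim_null_comparison)
    show "\<forall>\<^sub>F n in sequentially. norm (grid T n t - t) \<le> T / real (Suc n)"
      using grid_facts(2)[OF assms] by simp
    show "(\<lambda>n. T / real (Suc n)) \<longlonglongrightarrow> 0" by (rule LIMSEQ_Suc[OF lim_const_over_n])
  qed
  then show ?thesis by (simp add: LIM_zero_iff)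
qed

text \<open>On (0, T) the function depends on \<open>t\<close> only through an integer between 0 and
  \<open>n\<close>, so composing it with any map, whatever the values, gives a simple
  function.\<close>

lemma grid_simple:
  assumes T: "0 < T"
  shows "simple_function (lebesgue_on {0<..<T}) (\<lambda>t. (u :: real \<Rightarrow> 'b) (grid T n t))"
proof -
  let ?M = "lebesgue_on {0<..<T}"
  have "simple_function ?M (\<lambda>t. \<lfloor>real (Suc n) * t / T\<rfloor>)"
    unfolding simple_function_def
  proof (intro conjI ballI)
    have "(\<lambda>t. \<lfloor>real (Suc n) * t / T\<rfloor>) ` space ?M \<subseteq> {0..int n}"
      using grid_facts(3)[OF T] by auto
    then show "finite ((\<lambda>t. \<lfloor>real (Suc n) * t / T\<rfloor>) ` space ?M)" by (rule finite_subset) simp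
    fix j
    have "(\<lambda>t. real (Suc n) * t / T) \<in> borel_measurable ?M"
      by (intro continuous_imp_measurable_on_sets_lebesgue continuous_intros) (use T in auto)
    then have "(\<lambda>t. \<lfloor>real (Suc n) * t / T\<rfloor>) \<in> measurable ?M (count_space UNIV)"
      by (rule measurable_compose[OF _ measurable_real_floor])
    then show "(\<lambda>t. \<lfloor>real (Suc n) * t / T\<rfloor>) -` {j} \<inter> space ?M \<in> sets ?M"
      by (rule measurable_sets) simp
  qed
  from simple_function_compose[OF this, of "\<lambda>j. u (T * (of_int j + 1) / real (Suc n))"]
  show ?thesis by (simp add: grid_def o_def)
qed

text \<open>Sampling at right end points keeps the arguments in (0, T], where the solution has its
  full regularity; at time zero it is only in H^2. The family \<open>G\<close> and the constant
  \<open>K\<close> stand for the weighted coefficients and the normalisation, so that the Sobolev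
  norm with \<open>K = 1\<close> and the L^2 norm with \<open>K = 2 * pi\<close> are treated
  together.\<close>

lemma bochner_L2I:
  fixes G :: "real \<Rightarrow> int \<times> int \<Rightarrow> complex"
  assumes T: "0 < T" and X: "\<And>t. t \<in> {0<..T} \<Longrightarrow> u t \<in> X"
    and N: "\<And>t. t \<in> {0<..T} \<Longrightarrow> N (u t) = K * sqrt (\<Sum>\<^sub>\<infinity>k. (cmod (G t k))\<^sup>2)"
    and ND: "\<And>s t. s \<in> {0<..T} \<Longrightarrow> t \<in> {0<..T} \<Longrightarrow>
        N (\<lambda>p. u s p - u t p) = K * sqrt (\<Sum>\<^sub>\<infinity>k. (cmod (G s k - G t k))\<^sup>2)"
    and lim: "\<And>t. t \<in> {0<..T} \<Longrightarrow> ((\<lambda>s. \<Sum>\<^sub>\<infinity>k. (cmod (G s k - G t k))\<^sup>2) \<longlongrightarrow> 0) (at t within {0<..T})"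
    and int: "integrable (lebesgue_on {0<..<T}) (\<lambda>t. \<Sum>\<^sub>\<infinity>k. (cmod (G t k))\<^sup>2)"
  shows "u \<in> bochner_L2 T X N"
proof -
  let ?M = "lebesgue_on {0<..<T}"
  have "strongly_measurable T X N u"
    unfolding strongly_measurable_def
  proof (intro exI[of _ "\<lambda>n t. u (grid T n t)"] conjI allI ballI)
    show "simple_function ?M (\<lambda>t. u (grid T n t))" for n by (rule grid_simple[OF T])
    show "u (grid T n t) \<in> X" if "t \<in> {0<..<T}" for n t by (rule X[OF grid_facts(1)[OF T that]])
    show "AE t in ?M. (\<lambda>n. N (\<lambda>p. u (grid T n t) p - u t p)) \<longlonglongrightarrow> 0"
    proof (rule AE_I2)
      fix t assume "t \<in> space ?M"
      then have t: "t \<in> {0<..<T}" "t \<in> {0<..T}" by auto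
      let ?D = "\<lambda>s. \<Sum>\<^sub>\<infinity>k. (cmod (G s k - G t k))\<^sup>2"
      have "continuous (at t within {0<..T}) ?D"
        unfolding continuous_within using lim[OF t(2)] by simp
      then have "(\<lambda>n. ?D (grid T n t)) \<longlonglongrightarrow> ?D t"
        by (rule continuous_within_tendsto_compose[OF _ _ grid_tendsto[OF T t(1)]])
          (use grid_facts(1)[OF T t(1)] in simp)
      then have "(\<lambda>n. K * sqrt (?D (grid T n t))) \<longlonglongrightarrow> K * sqrt (?D t)"
        by (intro tendsto_intros)
      then show "(\<lambda>n. N (\<lambda>p. u (grid T n t) p - u t p)) \<longlonglongrightarrow> 0"
        by (simp add: ND[OF grid_facts(1)[OF T t(1)] t(2)])
    qed
  qed
  moreover have "integrable ?M (\<lambda>t. (N (u t))\<^sup>2)"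
  proof -
    have "integrable ?M (\<lambda>t. K\<^sup>2 * (\<Sum>\<^sub>\<infinity>k. (cmod (G t k))\<^sup>2))" by (rule integrable_mult_right[OF int])
    moreover have "integrable ?M (\<lambda>t. (N (u t))\<^sup>2) \<longleftrightarrow> integrable ?M (\<lambda>t. K\<^sup>2 * (\<Sum>\<^sub>\<infinity>k. (cmod (G t k))\<^sup>2))"
      by (rule Bochner_Integration.integrable_cong[OF refl]) (simp add: N power_mult_distrib infsum_nonneg)
    ultimately show ?thesis by blast
  qed
  moreover have "AE t in ?M. u t \<in> X" by (rule AE_I2) (use X in auto)
  ultimately show ?thesis by (simp add: bochner_L2_def)
qed

lemma test_function_smooth: "test_function T \<phi> \<Longrightarrow> smooth \<phi>"
  by (simp add: test_function_def smooth_def)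

lemma test_function_ends:
  assumes "test_function T \<phi>" shows "\<phi> 0 = 0" "\<phi> T = 0"
proof -
  have "{t. \<phi> t \<noteq> 0} \<subseteq> {0<..<T}"
    using assms closure_subset[of "{t. \<phi> t \<noteq> 0}"] unfolding test_function_def by blast
  then show "\<phi> 0 = 0" "\<phi> T = 0" by auto
qed

section \<open>Existence\<close>

locale kse_sol = mild_sol sg c C0 C1 T f a0 "\<lambda>_. 1" A B
  for sg c C0 C1 T f a0 A B
begin

text \<open>A majorant for the squared modes in H^4 and for those of the time derivative. The first
  term is the datum under the semigroup with its two extra powers of J; the second is the integral
  part, where the six powers of \<open>duh_decay_smooth\<close> less four leave J^-2 before
  squaring.\<close>

definition maj :: "real \<Rightarrow> real \<Rightarrow> real \<Rightarrow> int \<times> int \<Rightarrow> real" where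
  "maj P Q t k = P * ((jb k)\<^sup>2 * exp (- c * jb k ^ 4 * t) * cmod (of_real ((jb k)\<^sup>2) * a0 k))\<^sup>2
    + Q * ((1 + rho (t / 2))\<^sup>2 * (1 / jb k ^ 4))"

text \<open>Near a positive time t the value at t / 2 is thereby a majorant that no longer depends
  on the time.\<close>

lemma maj_antimono:
  assumes "0 < s" "s \<le> t" "0 \<le> P" "0 \<le> Q"
  shows "maj P Q t k \<le> maj P Q s k"
proof -
  have "exp (- c * jb k ^ 4 * t) \<le> exp (- c * jb k ^ 4 * s)"
    using assms c_pos jb_nonneg[of k] by (simp add: mult_left_mono)
  then have 1: "((jb k)\<^sup>2 * exp (- c * jb k ^ 4 * t) * cmod (of_real ((jb k)\<^sup>2) * a0 k))\<^sup>2
        \<le> ((jb k)\<^sup>2 * exp (- c * jb k ^ 4 * s) * cmod (of_real ((jb k)\<^sup>2) * a0 k))\<^sup>2"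
    by (intro power_mono mult_right_mono mult_left_mono) (auto simp: jb_nonneg)
  have "(1 + rho (t / 2))\<^sup>2 \<le> (1 + rho (s / 2))\<^sup>2"
    using assms rho_nonneg[of "t / 2"] by (intro power_mono add_left_mono rho_antimono) auto
  then have 2: "(1 + rho (t / 2))\<^sup>2 * (1 / jb k ^ 4) \<le> (1 + rho (s / 2))\<^sup>2 * (1 / jb k ^ 4)"
    by (rule mult_right_mono) (simp add: jb_nonneg)
  show ?thesis
    unfolding maj_def by (intro add_mono mult_left_mono 1 2 assms)
qed

lemma maj_summable:
  assumes "0 < s" "0 \<le> P"
  shows "maj P Q s summable_on UNIV"
proof -
  have "(\<lambda>k. P * ((jb k)\<^sup>2 * exp (- c * jb k ^ 4 * s) * cmod (of_real ((jb k)\<^sup>2) * a0 k))\<^sup>2) summable_on UNIV"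
  proof (rule summable_on_comparison_test)
    show "(\<lambda>k. (P * ((rho (s / 2))\<^sup>2)\<^sup>2) * (cmod (of_real ((jb k)\<^sup>2) * a0 k))\<^sup>2) summable_on UNIV"
      by (intro summable_on_cmult_right l2bd_summable[OF a0_bd])
    fix k
    \<comment> \<open>Each of the two powers of \<open>jb k\<close> is paid for by one half of the
      exponential.\<close>
    have "(jb k)\<^sup>2 * exp (- c * jb k ^ 4 * s) = (jb k * exp (- c * jb k ^ 4 * (s / 2)))\<^sup>2"
      by (simp add: power_mult_distrib flip: exp_double)
    also have "\<dots> \<le> (rho (s / 2))\<^sup>2"
      using assms by (intro power_mono smoothing) (auto simp: jb_nonneg)
    finally have "((jb k)\<^sup>2 * exp (- c * jb k ^ 4 * s) * cmod (of_real ((jb k)\<^sup>2) * a0 k))\<^sup>2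
        \<le> ((rho (s / 2))\<^sup>2 * cmod (of_real ((jb k)\<^sup>2) * a0 k))\<^sup>2"
      by (intro power_mono mult_right_mono) auto
    from mult_left_mono[OF this assms(2)]
    show "P * ((jb k)\<^sup>2 * exp (- c * jb k ^ 4 * s) * cmod (of_real ((jb k)\<^sup>2) * a0 k))\<^sup>2
        \<le> (P * ((rho (s / 2))\<^sup>2)\<^sup>2) * (cmod (of_real ((jb k)\<^sup>2) * a0 k))\<^sup>2"
      by (simp only: power_mult_distrib mult.assoc)
  qed (use assms in auto)
  from summable_on_add[OF this summable_on_cmult_right[OF summable_on_cmult_right[OF summable_on_jb]]]
  show ?thesis unfolding maj_def[abs_def] .
qed

abbreviation "M \<equiv> lebesgue_on {0<..<T}"

lemma exp_time_integral:
  assumes "0 < m" shows "integrable M (\<lambda>t. exp (- m * t))" "(\<integral>t. exp (- m * t) \<partial>M) \<le> 1 / m"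
proof -
  have c: "continuous_on {0..T} (\<lambda>t. exp (- m * t))" by (intro continuous_intros)
  show "integrable M (\<lambda>t. exp (- m * t))" by (rule continuous_lebesgue_open(1)[OF c])
  have "((\<lambda>t. exp (- m * t)) has_integral (- exp (- m * T) / m) - (- exp (- m * 0) / m)) {0..T}"
    using T_pos assms by (intro fundamental_theorem_of_calculus)
      (auto intro!: derivative_eq_intros simp: has_real_derivative_iff_has_vector_derivative[symmetric])
  then have "integral {0..T} (\<lambda>t. exp (- m * t)) = (- exp (- m * T) / m) - (- exp (- m * 0) / m)"
    by (rule integral_unique)
  also have "\<dots> \<le> 1 / m" using assms by simp
  finally show "(\<integral>t. exp (- m * t) \<partial>M) \<le> 1 / m" by (simp only: continuous_lebesgue_open(2)[OF c])
qed

text \<open>The square of \<open>rho\<close> has the singularity t^(-1/2), which is integrable at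
  zero.\<close>

lemma rho_time_integrable: "integrable M (\<lambda>t. (1 + rho (t / 2))\<^sup>2)"
proof -
  have "((\<lambda>x. x powr (- 1 / 2)) has_integral (T powr (- 1 / 2 + 1) / (- 1 / 2 + 1))) {0..T}"
    using T_pos by (intro has_integral_powr_from_0) auto
  then have "(\<lambda>x. x powr (- 1 / 2)) absolutely_integrable_on {0..T}"
    by (intro nonnegative_absolutely_integrable_1) (auto simp: has_integral_integrable)
  then have "set_integrable lebesgue {0<..<T} (\<lambda>x. x powr (- 1 / 2))"
    by (rule set_integrable_subset) auto
  then have ip: "integrable M (\<lambda>x. x powr (- 1 / 2))"
    by (simp add: set_integrable_def integrable_restrict_space)
  have i1: "integrable M (\<lambda>t. 1 :: real)" by (rule continuous_lebesgue_open(1)) (intro continuous_intros)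
  have r: "(rho (t / 2))\<^sup>2 = (2 / c) powr (1 / 2) * t powr (- 1 / 2)" if "0 < t" for t
  proof -
    have "(rho (t / 2))\<^sup>2 = rho (t / 2) powr 2" using that c_pos by (simp add: rho_def powr_numeral)
    also have "\<dots> = (1 / (c * (t / 2))) powr (1 / 2)" unfolding rho_def powr_powr by simp
    also have "1 / (c * (t / 2)) = (2 / c) * (1 / t)" by simp
    also have "(\<dots>) powr (1 / 2) = (2 / c) powr (1 / 2) * (1 / t) powr (1 / 2)"
      by (rule powr_mult)
    also have "(1 / t) powr (1 / 2) = t powr (- 1 / 2)"
    proof -
      have "(1 / t) powr (1 / 2) = inverse (t powr (1 / 2))"
        by (simp only: powr_divide powr_one_eq_one inverse_eq_divide)
      also have "\<dots> = t powr (- (1 / 2))" by (rule powr_minus[symmetric])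
      finally show ?thesis by (simp only: minus_divide_left)
    qed
    finally show ?thesis .
  qed
  show ?thesis
  proof (rule Bochner_Integration.integrable_bound)
    show "integrable M (\<lambda>t. 2 * 1 + 2 * ((2 / c) powr (1 / 2) * t powr (- 1 / 2)))"
      by (intro Bochner_Integration.integrable_add integrable_mult_right i1 ip)
    have "continuous_on {0<..<T} (\<lambda>t. (1 + rho (t / 2))\<^sup>2)"
      unfolding rho_def using c_pos by (intro continuous_intros) auto
    then show "(\<lambda>t. (1 + rho (t / 2))\<^sup>2) \<in> borel_measurable M"
      by (rule continuous_imp_measurable_on_sets_lebesgue) simp
    show "AE t in M. norm ((1 + rho (t / 2))\<^sup>2) \<le> norm (2 * 1 + 2 * ((2 / c) powr (1 / 2) * t powr (- 1 / 2)))"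
    proof (rule AE_I2)
      fix t assume "t \<in> space M"
      then have t: "0 < t" by simp
      have "0 \<le> (1 - rho (t / 2))\<^sup>2" by simp
      then have "(1 + rho (t / 2))\<^sup>2 \<le> 2 * 1 + 2 * (rho (t / 2))\<^sup>2" by (simp add: power2_sum power2_diff)
      then have "(1 + rho (t / 2))\<^sup>2 \<le> 2 * 1 + 2 * ((2 / c) powr (1 / 2) * t powr (- 1 / 2))"
        by (simp only: r[OF t])
      then show "norm ((1 + rho (t / 2))\<^sup>2) \<le> norm (2 * 1 + 2 * ((2 / c) powr (1 / 2) * t powr (- 1 / 2)))"
        by simp
    qed
  qed
qed

text \<open>The time integral of exp(- 2 c J^4 t) is at most 1 / (2 c J^4) and cancels the J^4 that
  separates the squared H^2 and H^4 norms. This is why a datum in H^2 suffices for square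
  integrability in time with values in H^4.\<close>

lemma maj_integral:
  assumes PQ: "0 \<le> P" "0 \<le> Q"
  shows "\<exists>C. \<forall>n. integrable M (\<lambda>t. \<Sum>k\<in>bx n. maj P Q t k) \<and> (\<integral>t. (\<Sum>k\<in>bx n. maj P Q t k) \<partial>M) \<le> C"
proof -
  define I where "I = (\<integral>t. (1 + rho (t / 2))\<^sup>2 \<partial>M)"
  have I: "0 \<le> I" by (simp add: I_def)
  define b where "b k = (cmod (of_real ((jb k)\<^sup>2) * a0 k))\<^sup>2" for k
  have eq: "maj P Q t k = (P * jb k ^ 4 * b k) * exp (- (2 * c * jb k ^ 4) * t) + (Q * (1 / jb k ^ 4)) * (1 + rho (t / 2))\<^sup>2" for t k
  proof -
    have "(exp (- c * jb k ^ 4 * t))\<^sup>2 = exp (- (2 * c * jb k ^ 4) * t)"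
      by (simp add: mult.assoc flip: exp_double)
    moreover have "((jb k)\<^sup>2)\<^sup>2 = jb k ^ 4" by simp
    ultimately show ?thesis by (simp only: maj_def b_def power_mult_distrib mult_ac)
  qed
  have m: "0 < 2 * c * jb k ^ 4" for k using c_pos jb_pos[of k] by simp
  have i: "integrable M (\<lambda>t. maj P Q t k)" for k
    unfolding eq
    by (intro Bochner_Integration.integrable_add integrable_mult_right exp_time_integral(1)[OF m] rho_time_integrable)
  have le: "(\<integral>t. maj P Q t k \<partial>M) \<le> P / (2 * c) * b k + Q * I * (1 / jb k ^ 4)" for k
  proof -
    have "(\<integral>t. maj P Q t k \<partial>M) = (P * jb k ^ 4 * b k) * (\<integral>t. exp (- (2 * c * jb k ^ 4) * t) \<partial>M)
        + (Q * (1 / jb k ^ 4)) * I"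
      unfolding eq I_def Bochner_Integration.integral_mult_right_zero[symmetric]
      by (intro Bochner_Integration.integral_add integrable_mult_right exp_time_integral(1)[OF m] rho_time_integrable)
    also have "\<dots> \<le> (P * jb k ^ 4 * b k) * (1 / (2 * c * jb k ^ 4)) + (Q * (1 / jb k ^ 4)) * I"
      using PQ by (intro add_right_mono mult_left_mono exp_time_integral(2)[OF m]) (auto simp: b_def jb_nonneg)
    also have "\<dots> = P / (2 * c) * b k + Q * I * (1 / jb k ^ 4)"
      using jb_pos[of k] c_pos by (simp add: field_simps)
    finally show ?thesis .
  qed
  have "integrable M (\<lambda>t. \<Sum>k\<in>bx n. maj P Q t k) \<and>
      (\<integral>t. (\<Sum>k\<in>bx n. maj P Q t k) \<partial>M) \<le> P / (2 * c) * B\<^sup>2 + Q * I * jsum" for n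
  proof
    show "integrable M (\<lambda>t. \<Sum>k\<in>bx n. maj P Q t k)" by (intro Bochner_Integration.integrable_sum i)
    have "(\<integral>t. (\<Sum>k\<in>bx n. maj P Q t k) \<partial>M) = (\<Sum>k\<in>bx n. \<integral>t. maj P Q t k \<partial>M)"
      by (rule Bochner_Integration.integral_sum[OF i])
    also have "\<dots> \<le> (\<Sum>k\<in>bx n. P / (2 * c) * b k + Q * I * (1 / jb k ^ 4))" by (rule sum_mono[OF le])
    also have "\<dots> = P / (2 * c) * sum b (bx n) + Q * I * (\<Sum>k\<in>bx n. 1 / jb k ^ 4)"
      by (simp only: sum.distrib sum_distrib_left)
    also have "\<dots> \<le> P / (2 * c) * B\<^sup>2 + Q * I * jsum"
    proof (intro add_mono mult_left_mono sum_jb_le finite_bx)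
      show "sum b (bx n) \<le> B\<^sup>2"
        using a0_bd unfolding b_def l2bd_def L2_set_def by (auto intro: sqrt_le_D)
    qed (use PQ c_pos I in auto)
    finally show "(\<integral>t. (\<Sum>k\<in>bx n. maj P Q t k) \<partial>M) \<le> P / (2 * c) * B\<^sup>2 + Q * I * jsum" .
  qed
  then show ?thesis by blast
qed

context
  fixes G :: "real \<Rightarrow> int \<times> int \<Rightarrow> complex" and P Q :: real
  assumes cG: "\<And>k. continuous_on {0..T} (\<lambda>t. G t k)" and PQ: "0 \<le> P" "0 \<le> Q"
    and Gm: "\<And>t k. t \<in> {0<..T} \<Longrightarrow> (cmod (G t k))\<^sup>2 \<le> maj P Q t k"
begin

lemma family_summable: "t \<in> {0<..T} \<Longrightarrow> (\<lambda>k. (cmod (G t k))\<^sup>2) summable_on UNIV"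
  by (rule summable_on_comparison_test[OF maj_summable[of t P Q]]) (use PQ Gm in auto)

text \<open>Continuity is local, so the time interval may be restricted to [t / 2, T], where the
  majorant at t / 2 is summable and uniform.\<close>

lemma family_tendsto:
  assumes t: "t \<in> {0<..T}"
  shows "((\<lambda>s. \<Sum>\<^sub>\<infinity>k. (cmod (G s k - G t k))\<^sup>2) \<longlongrightarrow> 0) (at t within {0<..T})"
proof -
  have "((\<lambda>s. \<Sum>\<^sub>\<infinity>k. (cmod (G s k - G t k))\<^sup>2) \<longlongrightarrow> 0) (at t within {t / 2..T})"
  proof (rule infsum_square_tendsto)
    show "continuous_on {t / 2..T} (\<lambda>t. G t k)" for k
      by (rule continuous_on_subset[OF cG]) (use t in auto)
    show "(cmod (G s k))\<^sup>2 \<le> maj P Q (t / 2) k" if "s \<in> {t / 2..T}" for s k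
      using order_trans[OF Gm[of s k] maj_antimono[of "t / 2" s P Q k]] that t PQ by auto
    show "maj P Q (t / 2) summable_on UNIV" using t PQ by (intro maj_summable) auto
  qed (use t in auto)
  moreover have "at t within {t / 2..T} = at t within {0<..T}"
    by (rule at_within_nhd[of t "{t / 2<..}"]) (use t in auto)
  ultimately show ?thesis by simp
qed

lemma family_integrable: "integrable M (\<lambda>t. \<Sum>\<^sub>\<infinity>k. (cmod (G t k))\<^sup>2)"
proof -
  obtain C where C: "\<And>n. integrable M (\<lambda>t. \<Sum>k\<in>bx n. maj P Q t k)"
    "\<And>n. (\<integral>t. (\<Sum>k\<in>bx n. maj P Q t k) \<partial>M) \<le> C" using maj_integral[OF PQ] by blast
  have cs: "continuous_on {0..T} (\<lambda>t. \<Sum>k\<in>F. (cmod (G t k))\<^sup>2)" for F by (intro continuous_intros cG)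
  have iG: "integrable M (\<lambda>t. \<Sum>k\<in>F. (cmod (G t k))\<^sup>2)" for F by (rule continuous_lebesgue_open(1)[OF cs])
  show ?thesis
  proof (rule infsum_integrable)
    show "(\<lambda>t. (cmod (G t k))\<^sup>2) \<in> borel_measurable M" for k using iG[of "{k}"] by simp
    show "(\<lambda>k. (cmod (G t k))\<^sup>2) summable_on UNIV" if "t \<in> space M" for t
      by (rule family_summable) (use that in simp)
    show "integrable M (\<lambda>t. \<Sum>k\<in>bx n. (cmod (G t k))\<^sup>2)" for n by (rule iG)
    show "(\<integral>t. (\<Sum>k\<in>bx n. (cmod (G t k))\<^sup>2) \<partial>M) \<le> C" for n
    proof (rule order_trans[OF integral_mono[OF iG C(1)] C(2)])
      fix t assume "t \<in> space M"
      then show "(\<Sum>k\<in>bx n. (cmod (G t k))\<^sup>2) \<le> (\<Sum>k\<in>bx n. maj P Q t k)"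
        by (intro sum_mono Gm) simp
    qed
  qed simp
qed

end

section \<open>The modes weighted for H^4 and the modes of the time derivative\<close>

definition f4 :: "real \<Rightarrow> int \<times> int \<Rightarrow> complex" where
  "f4 t k = of_real (jb k ^ 4) * f t k"

definition ft :: "real \<Rightarrow> int \<times> int \<Rightarrow> complex" where
  "ft t k = - of_real (sg k) * f t k - nl (f t) k"

lemma f4_continuous: "continuous_on {0..T} (\<lambda>t. f4 t k)"
  unfolding f4_def by (intro continuous_intros f_continuous)

lemma ft_continuous: "continuous_on {0..T} (\<lambda>t. ft t k)"
proof -
  have "continuous_on {0..T} (\<lambda>t. nl (f t) k)" using cont_g[of k] by simp
  then show ?thesis unfolding ft_def by (intro continuous_intros f_continuous)
qed

lemma f4_maj: "\<exists>P\<ge>0. \<exists>Q\<ge>0. \<forall>t\<in>{0<..T}. \<forall>k. (cmod (f4 t k))\<^sup>2 \<le> maj P Q t k"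
proof -
  obtain E where E: "0 \<le> E" "\<And>t k. t \<in> {0<..T} \<Longrightarrow> jb k ^ 6 * cmod (duh (sg k) (g k) t) \<le> E * (1 + rho (t / 2))"
    using duh_decay_smooth by blast
  have "(cmod (f4 t k))\<^sup>2 \<le> maj (2 * (exp (C0 * T))\<^sup>2) (2 * E\<^sup>2) t k" if t: "t \<in> {0<..T}" for t k
  proof -
    have tT: "t \<in> {0..T}" using t by auto
    let ?a = "of_real (jb k ^ 4) * (of_real (exp (- sg k * t)) * a0 k)" and ?b = "of_real (jb k ^ 4) * duh (sg k) (g k) t"
    have eq: "f4 t k = ?a - ?b" by (simp only: f4_def f_eq[OF tT] right_diff_distrib)
    have "cmod ?a = exp (- sg k * t) * ((jb k)\<^sup>2 * cmod (of_real ((jb k)\<^sup>2) * a0 k))"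
      by (simp add: norm_mult norm_power jb_nonneg power_numeral_reduce)
    also have "\<dots> \<le> (exp (C0 * T) * exp (- c * jb k ^ 4 * t)) * ((jb k)\<^sup>2 * cmod (of_real ((jb k)\<^sup>2) * a0 k))"
      using tT by (intro mult_right_mono exp_sg_le) auto
    finally have "(cmod ?a)\<^sup>2 \<le> (exp (C0 * T) * ((jb k)\<^sup>2 * exp (- c * jb k ^ 4 * t) * cmod (of_real ((jb k)\<^sup>2) * a0 k)))\<^sup>2"
      by (intro power_mono) (simp_all only: mult_ac norm_ge_zero)
    moreover have "(cmod ?b)\<^sup>2 \<le> (E * (1 + rho (t / 2)) / (jb k)\<^sup>2)\<^sup>2"
    proof (intro power_mono)
      have "cmod ?b * (jb k)\<^sup>2 = jb k ^ 6 * cmod (duh (sg k) (g k) t)"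
        by (simp add: norm_mult norm_power jb_nonneg power_numeral_reduce)
      also have "\<dots> \<le> E * (1 + rho (t / 2))" by (rule E(2)[OF t])
      finally show "cmod ?b \<le> E * (1 + rho (t / 2)) / (jb k)\<^sup>2"
        using jb_pos[of k] by (subst pos_le_divide_eq) auto
    qed simp
    moreover have "(E * (1 + rho (t / 2)) / (jb k)\<^sup>2)\<^sup>2 = E\<^sup>2 * ((1 + rho (t / 2))\<^sup>2 * (1 / jb k ^ 4))"
      by (simp add: power_mult_distrib power_divide)
    ultimately show ?thesis unfolding eq maj_def
      using square_le_sum_squares[of ?a ?b] by (simp only: power_mult_distrib[of "exp (C0 * T)"])
  qed
  then show ?thesis using E(1)
    by (intro exI[of _ "2 * (exp (C0 * T))\<^sup>2"] exI[of _ "2 * E\<^sup>2"] conjI) auto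
qed

lemma ft_maj: "\<exists>P\<ge>0. \<exists>Q\<ge>0. \<forall>t\<in>{0<..T}. \<forall>k. (cmod (ft t k))\<^sup>2 \<le> maj P Q t k"
proof -
  obtain P Q where PQ: "0 \<le> P" "0 \<le> Q" "\<And>t k. t \<in> {0<..T} \<Longrightarrow> (cmod (f4 t k))\<^sup>2 \<le> maj P Q t k"
    using f4_maj by blast
  obtain H where H: "0 \<le> H" "\<And>s k. s \<in> {0<..T} \<Longrightarrow> (jb k)\<^sup>2 * cmod (g k s) \<le> H * (1 + rho s)"
    using f_weight3 by blast
  have "(cmod (ft t k))\<^sup>2 \<le> maj (2 * C1\<^sup>2 * P) (2 * C1\<^sup>2 * Q + 2 * H\<^sup>2) t k" if t: "t \<in> {0<..T}" for t k
  proof -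
    have "cmod (of_real (sg k) * f t k) \<le> (C1 * jb k ^ 4) * cmod (f t k)"
      unfolding norm_mult norm_of_real by (intro mult_right_mono sg_upper) simp
    also have "\<dots> = C1 * cmod (f4 t k)" by (simp add: f4_def norm_mult norm_power jb_nonneg)
    finally have "(cmod (of_real (sg k) * f t k))\<^sup>2 \<le> (C1 * cmod (f4 t k))\<^sup>2" by (rule power_mono) simp
    also have "\<dots> \<le> C1\<^sup>2 * maj P Q t k"
      unfolding power_mult_distrib by (intro mult_left_mono PQ(3) t) simp
    finally have 1: "(cmod (- (of_real (sg k) * f t k)))\<^sup>2 \<le> C1\<^sup>2 * maj P Q t k" by simp
    have "(jb k)\<^sup>2 * cmod (nl (f t) k) \<le> H * (1 + rho t)" using H(2)[OF t, of k] by simp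
    also have "\<dots> \<le> H * (1 + rho (t / 2))" using t H(1) by (intro mult_left_mono add_left_mono rho_antimono) auto
    finally have "cmod (nl (f t) k) * (jb k)\<^sup>2 \<le> H * (1 + rho (t / 2))" by (simp only: mult.commute)
    then have "cmod (nl (f t) k) \<le> H * (1 + rho (t / 2)) / (jb k)\<^sup>2"
      using jb_pos[of k] by (subst pos_le_divide_eq) auto
    then have "(cmod (nl (f t) k))\<^sup>2 \<le> (H * (1 + rho (t / 2)) / (jb k)\<^sup>2)\<^sup>2" by (rule power_mono) simp
    also have "\<dots> = H\<^sup>2 * ((1 + rho (t / 2))\<^sup>2 * (1 / jb k ^ 4))"
      by (simp add: power_mult_distrib power_divide)
    finally have 2: "(cmod (nl (f t) k))\<^sup>2 \<le> H\<^sup>2 * ((1 + rho (t / 2))\<^sup>2 * (1 / jb k ^ 4))" .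
    have "(cmod (ft t k))\<^sup>2 \<le> 2 * (cmod (- (of_real (sg k) * f t k)))\<^sup>2 + 2 * (cmod (nl (f t) k))\<^sup>2"
      using square_le_sum_squares[of "- (of_real (sg k) * f t k)" "nl (f t) k"] by (simp add: ft_def)
    also have "\<dots> \<le> 2 * (C1\<^sup>2 * maj P Q t k) + 2 * (H\<^sup>2 * ((1 + rho (t / 2))\<^sup>2 * (1 / jb k ^ 4)))"
      using 1 2 by linarith
    also have "\<dots> = maj (2 * C1\<^sup>2 * P) (2 * C1\<^sup>2 * Q + 2 * H\<^sup>2) t k"
      by (simp only: maj_def distrib_left distrib_right mult.assoc add.assoc)
    finally show ?thesis .
  qed
  then show ?thesis using PQ(1,2) H(1)
    by (intro exI[of _ "2 * C1\<^sup>2 * P"] exI[of _ "2 * C1\<^sup>2 * Q + 2 * H\<^sup>2"] conjI) auto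
qed

lemma f_hs4: "t \<in> {0<..T} \<Longrightarrow> hs 4 (f t)"
proof -
  assume t: "t \<in> {0<..T}"
  obtain P Q where PQ: "0 \<le> P" "0 \<le> Q" "\<And>t k. t \<in> {0<..T} \<Longrightarrow> (cmod (f4 t k))\<^sup>2 \<le> maj P Q t k"
    using f4_maj by blast
  from family_summable[OF f4_continuous PQ t] show ?thesis unfolding hs_def f4_def .
qed

lemma f_hs2: "t \<in> {0..T} \<Longrightarrow> hs 2 (f t)"
proof -
  assume t: "t \<in> {0..T}"
  obtain D where "l2bd (\<lambda>k. of_real (jb k ^ 2) * f t k) D" using f_weight[OF order_refl] t by blast
  then show ?thesis by (rule l2bd_hs)
qed

text \<open>Integration by parts is carried out for finitely many modes and passed to the limit by
  dominated convergence. A constant dominates on the side of the solution; on the side of its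
  derivative the integrable square norm \<open>Z\<close> does.\<close>

lemma weak_form:
  assumes \<phi>: "test_function T \<phi>" and h: "l2bd h Bh"
  shows "(\<integral>t. deriv \<phi> t * Re (\<Sum>\<^sub>\<infinity>k. f t k * h k) \<partial>M) = - (\<integral>t. \<phi> t * Re (\<Sum>\<^sub>\<infinity>k. ft t k * h k) \<partial>M)"
proof -
  note sm = test_function_smooth[OF \<phi>]
  have c\<phi>: "continuous_on S \<phi>" and c\<phi>': "continuous_on S (deriv \<phi>)" for S
    using smooth_continuous[OF sm] smooth_continuous[OF smooth_deriv(1)[OF sm]] by blast+
  have bnd: "\<exists>K. \<forall>t\<in>{0..T}. \<bar>w t\<bar> \<le> K" if "continuous_on {0..T} w" for w :: "real \<Rightarrow> real"
  proof -
    have "compact (w ` {0..T})" by (intro compact_continuous_image that compact_Icc)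
    then show ?thesis by (metis bounded_iff compact_imp_bounded imageI real_norm_def)
  qed
  obtain K1 where K1: "\<And>t. t \<in> {0..T} \<Longrightarrow> \<bar>\<phi> t\<bar> \<le> K1" using bnd[OF c\<phi>] by blast
  obtain K2 where K2: "\<And>t. t \<in> {0..T} \<Longrightarrow> \<bar>deriv \<phi> t\<bar> \<le> K2" using bnd[OF c\<phi>'] by blast
  define p where "p n t = (\<Sum>k\<in>bx n. Re (f t k * h k))" for n t
  define p' where "p' n t = (\<Sum>k\<in>bx n. Re (ft t k * h k))" for n t
  have cp: "continuous_on {0..T} (p n)" and cp': "continuous_on {0..T} (p' n)" for n
    unfolding p_def p'_def by (intro continuous_intros f_continuous ft_continuous)+
  have dp: "(p n has_real_derivative p' n t) (at t within {0..T})" if t: "t \<in> {0..T}" for n t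
    unfolding p_def[abs_def] p'_def
  proof (rule DERIV_sum)
    fix k
    have "((\<lambda>t. f t k) has_vector_derivative ft t k) (at t within {0..T})"
      using f_deriv[OF t, of k] by (simp add: ft_def)
    then have "((\<lambda>t. f t k * h k) has_vector_derivative ft t k * h k) (at t within {0..T})"
      by (rule has_vector_derivative_mult_left)
    then show "((\<lambda>t. Re (f t k * h k)) has_real_derivative Re (ft t k * h k)) (at t within {0..T})"
      unfolding has_real_derivative_iff_has_vector_derivative
      by (rule bounded_linear.has_vector_derivative[OF bounded_linear_Re])
  qed
  have parts: "(\<integral>t. deriv \<phi> t * p n t \<partial>M) = - (\<integral>t. \<phi> t * p' n t \<partial>M)" for n
  proof -
    have "((\<lambda>t. deriv \<phi> t * p n t + p' n t * \<phi> t) has_integral \<phi> T * p n T - \<phi> 0 * p n 0) {0..T}"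
    proof (rule fundamental_theorem_of_calculus)
      fix t assume t: "t \<in> {0..T}"
      have "(\<phi> has_real_derivative deriv \<phi> t) (at t within {0..T})"
        by (rule has_field_derivative_at_within[OF smooth_deriv(2)[OF sm]])
      from DERIV_mult[OF this dp[OF t]]
      show "((\<lambda>t. \<phi> t * p n t) has_vector_derivative deriv \<phi> t * p n t + p' n t * \<phi> t) (at t within {0..T})"
        by (simp only: has_real_derivative_iff_has_vector_derivative)
    qed (use T_pos in simp)
    then have "integral {0..T} (\<lambda>t. deriv \<phi> t * p n t + \<phi> t * p' n t) = 0"
      by (simp add: test_function_ends[OF \<phi>] integral_unique mult.commute)
    moreover have "integral {0..T} (\<lambda>t. deriv \<phi> t * p n t + \<phi> t * p' n t)
        = integral {0..T} (\<lambda>t. deriv \<phi> t * p n t) + integral {0..T} (\<lambda>t. \<phi> t * p' n t)"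
      by (intro Henstock_Kurzweil_Integration.integral_add integrable_continuous_real continuous_intros c\<phi> c\<phi>' cp cp')
    moreover have "(\<integral>t. deriv \<phi> t * p n t \<partial>M) = integral {0..T} (\<lambda>t. deriv \<phi> t * p n t)"
      "(\<integral>t. \<phi> t * p' n t \<partial>M) = integral {0..T} (\<lambda>t. \<phi> t * p' n t)"
      by (intro continuous_lebesgue_open(2) continuous_intros c\<phi> c\<phi>' cp cp')+
    ultimately show ?thesis by simp
  qed
  have limp: "(\<lambda>n. p n t) \<longlonglongrightarrow> Re (\<Sum>\<^sub>\<infinity>k. f t k * h k)" if t: "t \<in> {0<..<T}" for t
    unfolding p_def Re_sum[symmetric]
    by (intro tendsto_Re bx_infsum l2bd_prod_summable[OF f_bd h]) (use t in auto)
  obtain P Q where PQ: "0 \<le> P" "0 \<le> Q" "\<And>t k. t \<in> {0<..T} \<Longrightarrow> (cmod (ft t k))\<^sup>2 \<le> maj P Q t k"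
    using ft_maj by blast
  define Z where "Z t = (\<Sum>\<^sub>\<infinity>k. (cmod (ft t k))\<^sup>2)" for t
  have lft: "l2bd (ft t) (sqrt (Z t))" if t: "t \<in> {0<..<T}" for t
  proof -
    have "(\<lambda>k. (cmod (ft t k))\<^sup>2) summable_on UNIV"
      by (rule family_summable[OF ft_continuous PQ]) (use t in auto)
    then show ?thesis unfolding Z_def by (rule l2bd_sqrt_infsum)
  qed
  have iZ: "integrable M Z" unfolding Z_def by (rule family_integrable[OF ft_continuous PQ])
  have limp': "(\<lambda>n. p' n t) \<longlonglongrightarrow> Re (\<Sum>\<^sub>\<infinity>k. ft t k * h k)" if t: "t \<in> {0<..<T}" for t
    unfolding p'_def Re_sum[symmetric]
    by (intro tendsto_Re bx_infsum l2bd_prod_summable[OF lft h]) (use t in auto)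
  have pb: "\<bar>p n t\<bar> \<le> A * Bh" if t: "t \<in> {0<..<T}" for n t
  proof -
    have "\<bar>p n t\<bar> \<le> (\<Sum>k\<in>bx n. cmod (f t k * h k))"
      unfolding p_def by (intro order_trans[OF sum_abs] sum_mono abs_Re_le_cmod)
    also have "\<dots> \<le> A * Bh" by (rule l2bd_prod_sum[OF f_bd h finite_bx]) (use t in auto)
    finally show ?thesis .
  qed
  have pb': "\<bar>p' n t\<bar> \<le> (1 + Z t) * Bh" if t: "t \<in> {0<..<T}" for n t
  proof -
    have Z0: "0 \<le> Z t" unfolding Z_def by (rule infsum_nonneg) simp
    have "\<bar>p' n t\<bar> \<le> (\<Sum>k\<in>bx n. cmod (ft t k * h k))"
      unfolding p'_def by (intro order_trans[OF sum_abs] sum_mono abs_Re_le_cmod)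
    also have "\<dots> \<le> sqrt (Z t) * Bh" by (rule l2bd_prod_sum[OF lft[OF t] h finite_bx])
    also have "\<dots> \<le> (1 + Z t) * Bh"
    proof (rule mult_right_mono)
      \<comment> \<open>The pairing is linear in the norm of \<open>ft t\<close>, whereas
        integrability is known for its square.\<close>
      show "sqrt (Z t) \<le> 1 + Z t" using Z0 by (intro real_le_lsqrt) (auto simp: power2_sum)
    qed (rule l2bd_nonneg[OF h])
    finally show ?thesis .
  qed
  have mp: "(\<lambda>t. deriv \<phi> t * p n t) \<in> borel_measurable M" "(\<lambda>t. \<phi> t * p' n t) \<in> borel_measurable M" for n
    by (intro borel_measurable_integrable continuous_lebesgue_open(1) continuous_intros c\<phi> c\<phi>' cp cp')+
  have L1: "(\<lambda>n. \<integral>t. deriv \<phi> t * p n t \<partial>M) \<longlonglongrightarrow> (\<integral>t. deriv \<phi> t * Re (\<Sum>\<^sub>\<infinity>k. f t k * h k) \<partial>M)"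
  proof (rule integral_dominated_convergence[where w = "\<lambda>t. K2 * (A * Bh)"])
    have lim: "(\<lambda>n. deriv \<phi> t * p n t) \<longlonglongrightarrow> deriv \<phi> t * Re (\<Sum>\<^sub>\<infinity>k. f t k * h k)" if "t \<in> space M" for t
      by (intro tendsto_intros limp) (use that in simp)
    show "(\<lambda>t. deriv \<phi> t * Re (\<Sum>\<^sub>\<infinity>k. f t k * h k)) \<in> borel_measurable M"
      by (rule borel_measurable_LIMSEQ_real[OF lim mp(1)])
    show "integrable M (\<lambda>t. K2 * (A * Bh))" by (rule continuous_lebesgue_open(1)) (intro continuous_intros)
    show "AE t in M. (\<lambda>n. deriv \<phi> t * p n t) \<longlonglongrightarrow> deriv \<phi> t * Re (\<Sum>\<^sub>\<infinity>k. f t k * h k)"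
      by (rule AE_I2[OF lim])
    show "AE t in M. norm (deriv \<phi> t * p n t) \<le> K2 * (A * Bh)" for n
    proof (rule AE_I2)
      fix t assume t: "t \<in> space M"
      then have "\<bar>deriv \<phi> t\<bar> \<le> K2" by (intro K2) simp
      moreover have "\<bar>p n t\<bar> \<le> A * Bh" by (rule pb) (use t in simp)
      ultimately show "norm (deriv \<phi> t * p n t) \<le> K2 * (A * Bh)"
        unfolding real_norm_def abs_mult by (intro mult_mono) (auto intro: order_trans[OF abs_ge_zero])
    qed
  qed (rule mp(1))
  have L2: "(\<lambda>n. \<integral>t. \<phi> t * p' n t \<partial>M) \<longlonglongrightarrow> (\<integral>t. \<phi> t * Re (\<Sum>\<^sub>\<infinity>k. ft t k * h k) \<partial>M)"
  proof (rule integral_dominated_convergence[where w = "\<lambda>t. K1 * ((1 + Z t) * Bh)"])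
    have lim: "(\<lambda>n. \<phi> t * p' n t) \<longlonglongrightarrow> \<phi> t * Re (\<Sum>\<^sub>\<infinity>k. ft t k * h k)" if "t \<in> space M" for t
      by (intro tendsto_intros limp') (use that in simp)
    show "(\<lambda>t. \<phi> t * Re (\<Sum>\<^sub>\<infinity>k. ft t k * h k)) \<in> borel_measurable M"
      by (rule borel_measurable_LIMSEQ_real[OF lim mp(2)])
    have "integrable M (\<lambda>t. 1 :: real)" by (rule continuous_lebesgue_open(1)) (intro continuous_intros)
    then show "integrable M (\<lambda>t. K1 * ((1 + Z t) * Bh))"
      by (intro integrable_mult_right integrable_mult_left Bochner_Integration.integrable_add iZ)
    show "AE t in M. (\<lambda>n. \<phi> t * p' n t) \<longlonglongrightarrow> \<phi> t * Re (\<Sum>\<^sub>\<infinity>k. ft t k * h k)"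
      by (rule AE_I2[OF lim])
    show "AE t in M. norm (\<phi> t * p' n t) \<le> K1 * ((1 + Z t) * Bh)" for n
    proof (rule AE_I2)
      fix t assume t: "t \<in> space M"
      then have "\<bar>\<phi> t\<bar> \<le> K1" by (intro K1) simp
      moreover have "\<bar>p' n t\<bar> \<le> (1 + Z t) * Bh" by (rule pb') (use t in simp)
      ultimately show "norm (\<phi> t * p' n t) \<le> K1 * ((1 + Z t) * Bh)"
        unfolding real_norm_def abs_mult by (intro mult_mono) (auto intro: order_trans[OF abs_ge_zero])
    qed
  qed (rule mp(2))
  show ?thesis
    by (rule LIMSEQ_unique[OF L1]) (unfold parts, rule tendsto_minus[OF L2])
qed

end

lemma kse_solI: "mild_sol sg c C0 C1 T f a0 (\<lambda>_. 1) A B \<Longrightarrow> kse_sol sg c C0 C1 T f a0 A B"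
  by (simp add: kse_sol_def)

text \<open>Besides the solution, its mild form in Fourier space is part of the conclusion, so that
  uniqueness can be decided between two mild solutions.\<close>

lemma ivp_existence:
  assumes sym: "symbol (symb \<beta> \<delta> \<epsilon>) c C0 C1 T" and \<eta>\<^sub>0: "\<eta>\<^sub>0 \<in> sobolev 2"
  shows "\<exists>\<eta>\<in>solution_class T. solves_ivp \<beta> \<delta> \<epsilon> T \<eta>\<^sub>0 \<eta> \<and>
    (\<exists>f A B. mild_sol (symb \<beta> \<delta> \<epsilon>) c C0 C1 T f (fourier_coeff \<eta>\<^sub>0) (\<lambda>_. 1) A B \<and> (\<forall>t\<in>{0..T}. has_fc (\<eta> t) (f t)))"
proof -
  have L0: "\<eta>\<^sub>0 \<in> L2_space" and h0: "hs 2 (fourier_coeff \<eta>\<^sub>0)" using \<eta>\<^sub>0 by (simp_all add: sobolev_iff)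
  obtain B where B: "l2bd (\<lambda>k. of_real ((jb k)\<^sup>2) * fourier_coeff \<eta>\<^sub>0 k) B" using hs_l2bd[OF h0] by blast
  obtain f A where mild: "mild_sol (symb \<beta> \<delta> \<epsilon>) c C0 C1 T f (fourier_coeff \<eta>\<^sub>0) (\<lambda>_. 1) A B"
    using symbol.mild_existence[OF sym B herm_fourier_coeff] by blast
  interpret kse_sol "symb \<beta> \<delta> \<epsilon>" c C0 C1 T f "fourier_coeff \<eta>\<^sub>0" A B by (rule kse_solI[OF mild])
  \<comment> \<open>The representatives are chosen separately at each time. All norms and pairings
    in the solution class depend on the coefficients only, so no joint measurability is
    involved.\<close>
  define \<eta> where "\<eta> t = (SOME u. has_fc u (f t))" for t
  have fc: "has_fc (\<eta> t) (f t)" if t: "t \<in> {0..T}" for t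
  proof -
    have "hs 0 (f t)" by (rule hs_mono[OF f_hs2[OF t]]) simp
    from someI_ex[OF has_fc_exists[OF this f_herm[OF t]]] show ?thesis unfolding \<eta>_def .
  qed
  have fc': "has_fc (\<eta> t) (f t)" if "t \<in> {0<..T}" for t using fc that by simp
  \<comment> \<open>Defined as minus the other terms of the equation, so that the equation holds at
    every point; what has to be shown is that it is the weak time derivative.\<close>
  define G where "G t p = - (\<eta> t p * dx (\<eta> t) p) - linpart \<beta> \<delta> \<epsilon> (\<eta> t) p" for t p
  have fcG: "has_fc (G t) (ft t)" if t: "t \<in> {0<..T}" for t
    using has_fc_rhs[OF fc'[OF t] f_hs4[OF t], of \<beta> \<delta> \<epsilon>] unfolding G_def[abs_def] ft_def[abs_def] .
  have coeff: "fourier_coeff (\<eta> t) = f t" if "t \<in> {0..T}" for t using has_fcD(2)[OF fc[OF that]] by blast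
  have coeff_diff: "fourier_coeff (\<lambda>p. \<eta> s p - \<eta> t p) = (\<lambda>k. f s k - f t k)"
    if "s \<in> {0..T}" "t \<in> {0..T}" for s t
    using has_fcD(2)[OF has_fc_diff[OF fc[OF that(1)] fc[OF that(2)]]] by blast
  obtain P Q where PQ: "0 \<le> P" "0 \<le> Q" "\<And>t k. t \<in> {0<..T} \<Longrightarrow> (cmod (f4 t k))\<^sup>2 \<le> maj P Q t k"
    using f4_maj by blast
  obtain P' Q' where PQ': "0 \<le> P'" "0 \<le> Q'" "\<And>t k. t \<in> {0<..T} \<Longrightarrow> (cmod (ft t k))\<^sup>2 \<le> maj P' Q' t k"
    using ft_maj by blast
  have "\<eta> \<in> cont_space T (sobolev 2) (sobolev_norm 2)"
    unfolding cont_space_def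
  proof (intro CollectI conjI ballI)
    fix t assume t: "t \<in> {0..T}"
    show "\<eta> t \<in> sobolev 2" using has_fcD(1)[OF fc[OF t]] f_hs2[OF t] by (simp add: sobolev_iff coeff[OF t])
    obtain D where D: "D summable_on UNIV"
      "\<And>t k. t \<in> {0..T} \<Longrightarrow> (cmod (of_real ((jb k)\<^sup>2) * f t k))\<^sup>2 \<le> D k" using f_majorant by blast
    have "((\<lambda>s. \<Sum>\<^sub>\<infinity>k. (cmod (of_real ((jb k)\<^sup>2) * f s k - of_real ((jb k)\<^sup>2) * f t k))\<^sup>2) \<longlongrightarrow> 0) (at t within {0..T})"
      by (rule infsum_square_tendsto[OF _ D(2) D(1) t]) (intro continuous_intros f_continuous)
    then have "((\<lambda>s. sqrt (\<Sum>\<^sub>\<infinity>k. (cmod (of_real ((jb k)\<^sup>2) * f s k - of_real ((jb k)\<^sup>2) * f t k))\<^sup>2)) \<longlongrightarrow> sqrt 0) (at t within {0..T})"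
      by (rule tendsto_real_sqrt)
    moreover have "sobolev_norm 2 (\<lambda>p. \<eta> s p - \<eta> t p)
        = sqrt (\<Sum>\<^sub>\<infinity>k. (cmod (of_real ((jb k)\<^sup>2) * f s k - of_real ((jb k)\<^sup>2) * f t k))\<^sup>2)" if "s \<in> {0..T}" for s
      by (simp only: sobolev_norm_eq coeff_diff[OF that t] right_diff_distrib)
    ultimately show "((\<lambda>s. sobolev_norm 2 (\<lambda>p. \<eta> s p - \<eta> t p)) \<longlongrightarrow> 0) (at t within {0..T})"
      by (subst Lim_cong_within[OF refl refl refl]) auto
  qed
  moreover have "\<eta> \<in> bochner_L2 T (sobolev 4) (sobolev_norm 4)"
  proof (rule bochner_L2I[where K = 1 and G = f4, OF T_pos])
    fix t assume t: "t \<in> {0<..T}"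
    then have tT: "t \<in> {0..T}" by auto
    show "\<eta> t \<in> sobolev 4" using has_fcD(1)[OF fc[OF tT]] f_hs4[OF t] by (simp add: sobolev_iff coeff[OF tT])
    show "sobolev_norm 4 (\<eta> t) = 1 * sqrt (\<Sum>\<^sub>\<infinity>k. (cmod (f4 t k))\<^sup>2)"
      by (simp only: sobolev_norm_eq coeff[OF tT] f4_def mult_1)
    show "((\<lambda>s. \<Sum>\<^sub>\<infinity>k. (cmod (f4 s k - f4 t k))\<^sup>2) \<longlongrightarrow> 0) (at t within {0<..T})"
      by (rule family_tendsto[OF f4_continuous PQ t])
    fix s assume "s \<in> {0<..T}"
    then have sT: "s \<in> {0..T}" by auto
    show "sobolev_norm 4 (\<lambda>p. \<eta> s p - \<eta> t p) = 1 * sqrt (\<Sum>\<^sub>\<infinity>k. (cmod (f4 s k - f4 t k))\<^sup>2)"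
      by (simp only: sobolev_norm_eq coeff_diff[OF sT tT] f4_def mult_1 right_diff_distrib)
  qed (rule family_integrable[OF f4_continuous PQ])
  ultimately have cls: "\<eta> \<in> solution_class T" by (simp add: solution_class_def)
  have Gb: "G \<in> bochner_L2 T L2_space L2_norm"
  proof (rule bochner_L2I[where K = "2 * pi" and G = ft, OF T_pos])
    fix t assume t: "t \<in> {0<..T}"
    show "G t \<in> L2_space" by (rule has_fcD(1)[OF fcG[OF t]])
    show "L2_norm (G t) = 2 * pi * sqrt (\<Sum>\<^sub>\<infinity>k. (cmod (ft t k))\<^sup>2)" by (rule has_fc_L2_norm[OF fcG[OF t]])
    show "((\<lambda>s. \<Sum>\<^sub>\<infinity>k. (cmod (ft s k - ft t k))\<^sup>2) \<longlongrightarrow> 0) (at t within {0<..T})"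
      by (rule family_tendsto[OF ft_continuous PQ' t])
    fix s assume s: "s \<in> {0<..T}"
    show "L2_norm (\<lambda>p. G s p - G t p) = 2 * pi * sqrt (\<Sum>\<^sub>\<infinity>k. (cmod (ft s k - ft t k))\<^sup>2)"
      by (rule has_fc_L2_norm[OF has_fc_diff[OF fcG[OF s] fcG[OF t]]])
  qed (rule family_integrable[OF ft_continuous PQ'])
  have weak: "weak_time_derivative T \<eta> G"
    unfolding weak_time_derivative_def
  proof (intro allI impI)
    fix \<phi> \<psi> assume \<phi>: "test_function T \<phi>" and \<psi>: "\<psi> \<in> L2_space"
    let ?h = "\<lambda>k. fourier_coeff \<psi> (- k)"
    have h: "l2bd ?h (L2_norm \<psi> / (2 * pi))"
      by (rule l2bd_reindex[OF l2bd_fourier_coeff[OF \<psi>]]) (simp add: inj_def)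
    have 1: "(\<integral>t. deriv \<phi> t * L2_inner (\<eta> t) \<psi> \<partial>M) = (\<integral>t. (2 * pi)\<^sup>2 * (deriv \<phi> t * Re (\<Sum>\<^sub>\<infinity>k. f t k * ?h k)) \<partial>M)"
    proof (rule Bochner_Integration.integral_cong[OF refl])
      fix t assume "t \<in> space M"
      then have t: "t \<in> {0..T}" by simp
      show "deriv \<phi> t * L2_inner (\<eta> t) \<psi> = (2 * pi)\<^sup>2 * (deriv \<phi> t * Re (\<Sum>\<^sub>\<infinity>k. f t k * ?h k))"
        unfolding has_fc_L2_inner[OF fc[OF t] has_fc_coeff[OF \<psi>]] by (simp only: mult.left_commute)
    qed
    have 2: "(\<integral>t. \<phi> t * L2_inner (G t) \<psi> \<partial>M) = (\<integral>t. (2 * pi)\<^sup>2 * (\<phi> t * Re (\<Sum>\<^sub>\<infinity>k. ft t k * ?h k)) \<partial>M)"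
    proof (rule Bochner_Integration.integral_cong[OF refl])
      fix t assume "t \<in> space M"
      then have t: "t \<in> {0<..T}" by simp
      show "\<phi> t * L2_inner (G t) \<psi> = (2 * pi)\<^sup>2 * (\<phi> t * Re (\<Sum>\<^sub>\<infinity>k. ft t k * ?h k))"
        unfolding has_fc_L2_inner[OF fcG[OF t] has_fc_coeff[OF \<psi>]] by (simp only: mult.left_commute)
    qed
    show "(\<integral>t. deriv \<phi> t * L2_inner (\<eta> t) \<psi> \<partial>lebesgue_on {0<..<T})
        = - (\<integral>t. \<phi> t * L2_inner (G t) \<psi> \<partial>lebesgue_on {0<..<T})"
      unfolding 1 2 Bochner_Integration.integral_mult_right_zero weak_form[OF \<phi> h] by simp
  qed
  have eq: "G t p + \<eta> t p * dx (\<eta> t) p + (\<beta> - 1) * dx (dx (\<eta> t)) p - dy (dy (\<eta> t)) p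
      - \<delta> * (Lam ^^ 3) (\<eta> t) p + \<epsilon> * laplacian (laplacian (\<eta> t)) p = 0" for t p
    by (simp add: G_def linpart_def)
  have zero: "(0::real) \<in> {0..T}" using T_pos by simp
  have "f 0 = fourier_coeff \<eta>\<^sub>0" using f_0 by blast
  then have init: "AE p in torus. \<eta> 0 p = \<eta>\<^sub>0 p"
    using has_fc_unique[OF fc[OF zero]] has_fc_coeff[OF L0] by simp
  have "solves_ivp \<beta> \<delta> \<epsilon> T \<eta>\<^sub>0 \<eta>"
    unfolding solves_ivp_def
  proof (rule conjI[OF bexI[of _ G] init])
    show "weak_time_derivative T \<eta> G \<and> (AE t in M. AE p in torus.
        G t p + \<eta> t p * dx (\<eta> t) p + (\<beta> - 1) * dx (dx (\<eta> t)) p - dy (dy (\<eta> t)) p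
          - \<delta> * (Lam ^^ 3) (\<eta> t) p + \<epsilon> * laplacian (laplacian (\<eta> t)) p = 0)"
      by (intro conjI weak AE_I2 eq)
  qed (rule Gb)
  with cls mild fc show ?thesis by blast
qed

section \<open>Uniqueness\<close>

text \<open>Lebesgue measure is complete, so every subset of the exceptional null set is measurable.
  It applies to the pairings of a time derivative that are known to equal a continuous function
  almost everywhere only.\<close>

lemma borel_measurable_lebesgue_on_AE:
  fixes u v :: "real \<Rightarrow> real"
  assumes S: "S \<in> sets lebesgue" and v: "v \<in> borel_measurable (lebesgue_on S)"
    and ae: "AE t in lebesgue_on S. u t = v t"
  shows "u \<in> borel_measurable (lebesgue_on S)"
proof -
  obtain N where N: "{t \<in> space (lebesgue_on S). \<not> u t = v t} \<subseteq> N" "N \<in> null_sets (lebesgue_on S)"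
    using ae by (auto elim!: AE_E simp: null_sets_def)
  then have "negligible N" using S by (simp add: null_sets_restrict_space negligible_iff_null_sets)
  have sub: "X \<in> sets (lebesgue_on S)" if "X \<subseteq> {t \<in> S. u t \<noteq> v t}" for X
  proof -
    have "X \<subseteq> N" using that N(1) by auto
    then have "negligible X" by (rule negligible_subset[OF \<open>negligible N\<close>])
    then have "X \<in> sets lebesgue" by (rule negligible_imp_sets)
    then show ?thesis using that S by (auto simp: sets_restrict_space_iff)
  qed
  show ?thesis
  proof (rule measurableI)
    fix X :: "real set" assume X: "X \<in> sets borel"
    let ?D = "{t \<in> S. u t \<noteq> v t}"
    have "u -` X \<inter> space (lebesgue_on S) = (v -` X \<inter> space (lebesgue_on S) - ?D) \<union> (u -` X \<inter> ?D)" by auto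
    moreover have "v -` X \<inter> space (lebesgue_on S) \<in> sets (lebesgue_on S)" by (rule measurable_sets[OF v X])
    ultimately show "u -` X \<inter> space (lebesgue_on S) \<in> sets (lebesgue_on S)"
      using sub[of ?D] sub[of "u -` X \<inter> ?D"] by auto
  qed simp
qed

text \<open>The functional \<open>r\<close> is \<open>Re\<close> or \<open>Im\<close>, so that \<open>r (ex (- k))\<close> is an admissible test function.\<close>

lemma L2_inner_ex:
  assumes u: "u \<in> L2_space" and r: "bounded_linear r"
  shows "L2_inner u (\<lambda>p. r (ex (- k) p)) = (2 * pi)\<^sup>2 * r (fourier_coeff u k)"
proof -
  interpret r: bounded_linear r by fact
  have i: "integrable torus (\<lambda>p. ex (- k) p * of_real (u p))"
    by (rule integrable_ex_mult[OF integrable_of_real[OF L2_integrable[OF u]]])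
  have "u p * r (ex (- k) p) = r (ex (- k) p * of_real (u p))" for p
  proof -
    have "r (u p *\<^sub>R ex (- k) p) = u p *\<^sub>R r (ex (- k) p)" by (rule r.scaleR)
    then show ?thesis by (simp add: scaleR_conv_of_real mult.commute)
  qed
  then have "L2_inner u (\<lambda>p. r (ex (- k) p)) = (\<integral>p. r (ex (- k) p * of_real (u p)) \<partial>torus)"
    by (simp only: L2_inner_def)
  also have "\<dots> = r (\<integral>p. ex (- k) p * of_real (u p) \<partial>torus)"
    by (rule integral_bounded_linear[OF r i])
  also have "(\<integral>p. ex (- k) p * of_real (u p) \<partial>torus) = (2 * pi)\<^sup>2 *\<^sub>R fourier_coeff u k"
    by (simp add: fourier_coeff_fcc fcc_def scaleR_conv_of_real)
  also have "r \<dots> = (2 * pi)\<^sup>2 * r (fourier_coeff u k)" by (simp only: r.scaleR real_scaleR_def)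
  finally show ?thesis .
qed

text \<open>Subtracting the antiderivative of \<open>h\<close> leaves a continuous function with
  zero weak derivative, which is constant by du Bois-Reymond's lemma.\<close>

lemma weak_derivative_integral:
  fixes z h :: "real \<Rightarrow> real"
  assumes T: "0 < T" and z: "continuous_on {0..T} z" and h: "continuous_on {0..T} h"
    and w: "\<And>\<phi>. test_function T \<phi> \<Longrightarrow>
      (\<integral>t. deriv \<phi> t * z t \<partial>lebesgue_on {0<..<T}) = - (\<integral>t. \<phi> t * h t \<partial>lebesgue_on {0<..<T})"
    and t: "t \<in> {0..T}"
  shows "z t = z 0 + integral {0..t} h"
proof -
  define H where "H t = integral {0..t} h" for t
  have dH: "(H has_vector_derivative h t) (at t within {0..T})" if "t \<in> {0..T}" for t
    unfolding H_def[abs_def] by (rule integral_has_vector_derivative[OF h that])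
  have cH: "continuous_on {0..T} H"
    unfolding continuous_on_eq_continuous_within using dH has_vector_derivative_continuous by blast
  define w where "w t = z t - H t" for t
  have cw: "continuous_on {0..T} w" unfolding w_def by (intro continuous_intros z cH)
  have "integral {0..T} (\<lambda>t. deriv \<phi> t * w t) = 0" if \<phi>: "test_function T \<phi>" for \<phi>
  proof -
    note sm = test_function_smooth[OF \<phi>]
    have c: "continuous_on S \<phi>" "continuous_on S (deriv \<phi>)" for S
      using smooth_continuous[OF sm] smooth_continuous[OF smooth_deriv(1)[OF sm]] by blast+
    have i: "(\<lambda>t. deriv \<phi> t * z t) integrable_on {0..T}" "(\<lambda>t. deriv \<phi> t * H t) integrable_on {0..T}"
      "(\<lambda>t. h t * \<phi> t) integrable_on {0..T}"
      by (intro integrable_continuous_real continuous_intros c z h cH)+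
    have "((\<lambda>t. deriv \<phi> t * H t + h t * \<phi> t) has_integral \<phi> T * H T - \<phi> 0 * H 0) {0..T}"
    proof (rule fundamental_theorem_of_calculus)
      fix t assume t: "t \<in> {0..T}"
      have 1: "(\<phi> has_real_derivative deriv \<phi> t) (at t within {0..T})"
        by (rule has_field_derivative_at_within[OF smooth_deriv(2)[OF sm]])
      have 2: "(H has_real_derivative h t) (at t within {0..T})"
        unfolding has_real_derivative_iff_has_vector_derivative by (rule dH[OF t])
      show "((\<lambda>t. \<phi> t * H t) has_vector_derivative deriv \<phi> t * H t + h t * \<phi> t) (at t within {0..T})"
        using DERIV_mult[OF 1 2] by (simp only: has_real_derivative_iff_has_vector_derivative)
    qed (use T in simp)
    then have "integral {0..T} (\<lambda>t. deriv \<phi> t * H t + h t * \<phi> t) = 0"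
      by (simp add: test_function_ends[OF \<phi>] integral_unique)
    then have p: "integral {0..T} (\<lambda>t. deriv \<phi> t * H t) + integral {0..T} (\<lambda>t. h t * \<phi> t) = 0"
      using Henstock_Kurzweil_Integration.integral_add[OF i(2,3)] by simp
    have L: "(\<integral>t. deriv \<phi> t * z t \<partial>lebesgue_on {0<..<T}) = integral {0..T} (\<lambda>t. deriv \<phi> t * z t)"
      "(\<integral>t. \<phi> t * h t \<partial>lebesgue_on {0<..<T}) = integral {0..T} (\<lambda>t. \<phi> t * h t)"
      by (intro continuous_lebesgue_open(2) continuous_intros c z h)+
    have "integral {0..T} (\<lambda>t. deriv \<phi> t * w t)
        = integral {0..T} (\<lambda>t. deriv \<phi> t * z t) - integral {0..T} (\<lambda>t. deriv \<phi> t * H t)"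
      unfolding w_def right_diff_distrib by (rule Henstock_Kurzweil_Integration.integral_diff[OF i(1,2)])
    then show ?thesis using w[OF \<phi>] p unfolding L by (simp add: mult.commute)
  qed
  then have const: "w s = w (T / 2)" if "s \<in> {0<..<T}" for s
    using du_bois_reymond[OF cw _ that] T by simp
  \<comment> \<open>The lemma speaks of interior times; continuity carries the constant to the end
    points, where the initial value is read off.\<close>
  have cl: "closure {0<..<T} = {0..T}" using T by simp
  have all: "w s = w (T / 2)" if "s \<in> {0..T}" for s
    by (rule continuous_constant_on_closure[of "{0<..<T}" w, unfolded cl, OF cw const that])
  have "0 \<in> {0..T}" using T by simp
  from all[OF this] all[OF t] have "w t = w 0" by metis
  then show ?thesis by (simp add: w_def H_def)
qed

text \<open>The equation, paired with real and imaginary parts of a character, gives a weak scalar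
  equation with continuous right-hand side for each mode. It is integrated in time, hence holds
  classically, and the integrating factor turns it into Duhamel's formula. The other two conclusions
  are the bounds and the continuity that \<open>mild_uniqueness\<close> asks for.\<close>

lemma ivp_mild:
  assumes sym: "symbol (symb \<beta> \<delta> \<epsilon>) c C0 C1 T" and \<eta>\<^sub>0: "\<eta>\<^sub>0 \<in> sobolev 2"
    and cls: "\<zeta> \<in> solution_class T" and sol: "solves_ivp \<beta> \<delta> \<epsilon> T \<eta>\<^sub>0 \<zeta>"
  defines "z \<equiv> \<lambda>t. fourier_coeff (\<zeta> t)"
  shows "\<exists>A. \<forall>t\<in>{0..T}. l2bd (z t) A"
    and "continuous_on {0..T} (\<lambda>s. nl (z s) k)"
    and "t \<in> {0..T} \<Longrightarrow> z t k = of_real (exp (- symb \<beta> \<delta> \<epsilon> k * t)) * fourier_coeff \<eta>\<^sub>0 k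
      - duh (symb \<beta> \<delta> \<epsilon> k) (\<lambda>s. nl (z s) k) t"
proof -
  let ?sg = "symb \<beta> \<delta> \<epsilon>"
  let ?M = "lebesgue_on {0<..<T}"
  have T: "0 < T" using sym by (rule symbol.T_pos)
  have sob: "\<zeta> t \<in> sobolev 2" if "t \<in> {0..T}" for t
    using cls that unfolding solution_class_def cont_space_def by blast
  have lim: "((\<lambda>s. sobolev_norm 2 (\<lambda>p. \<zeta> s p - \<zeta> t p)) \<longlongrightarrow> 0) (at t within {0..T})" if "t \<in> {0..T}" for t
    using cls that unfolding solution_class_def cont_space_def by blast
  have L2: "\<zeta> t \<in> L2_space" and z2: "hs 2 (z t)" if "t \<in> {0..T}" for t
    using sob[OF that] by (simp_all add: sobolev_iff z_def)
  \<comment> \<open>Viewed as a path in \<open>l2\<close> the coefficients are continuous, because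
    the H^2 norm dominates; compactness then gives a bound uniform in time.\<close>
  define X where "X t = Abs_l2 (z t)" for t
  have cfX: "cf (X t) = z t" if "t \<in> {0..T}" for t
    unfolding X_def z_def by (rule cf_Abs_l2[OF l2bd_fourier_coeff[OF L2[OF that]]])
  have cX: "continuous_on {0..T} X"
    unfolding continuous_on_def
  proof
    fix t assume t: "t \<in> {0..T}"
    have le: "norm (X s - X t) \<le> sobolev_norm 2 (\<lambda>p. \<zeta> s p - \<zeta> t p)" if s: "s \<in> {0..T}" for s
    proof (rule norm_l2_le)
      have d: "fourier_coeff (\<lambda>p. \<zeta> s p - \<zeta> t p) k = z s k - z t k" for k
        unfolding z_def by (rule fourier_coeff_diff[OF L2_integrable[OF L2[OF s]] L2_integrable[OF L2[OF t]]])
      obtain B1 B2 where "l2bd (\<lambda>k. of_real ((jb k)\<^sup>2) * z s k) B1" "l2bd (\<lambda>k. of_real ((jb k)\<^sup>2) * z t k) B2"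
        using hs_l2bd[OF z2[OF s]] hs_l2bd[OF z2[OF t]] by blast
      from l2bd_summable[OF l2bd_diff[OF this]]
      have sm: "(\<lambda>k. (cmod (of_real ((jb k)\<^sup>2) * (z s k - z t k)))\<^sup>2) summable_on UNIV"
        by (simp only: right_diff_distrib)
      show "l2bd (cf (X s - X t)) (sobolev_norm 2 (\<lambda>p. \<zeta> s p - \<zeta> t p))"
        unfolding sobolev_norm_eq d
      proof (rule l2bd_mono[OF l2bd_sqrt_infsum[OF sm] _ order_refl])
        fix k
        have "1 * cmod (z s k - z t k) \<le> (jb k)\<^sup>2 * cmod (z s k - z t k)"
          by (rule mult_right_mono) (simp_all add: one_le_power jb_ge_1)
        then show "cmod (cf (X s - X t) k) \<le> cmod (of_real ((jb k)\<^sup>2) * (z s k - z t k))"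
          by (simp add: cfX[OF s] cfX[OF t] norm_mult norm_power)
      qed
    qed
    have "((\<lambda>s. X s - X t) \<longlongrightarrow> 0) (at t within {0..T})"
    proof (rule Lim_null_comparison[OF _ lim[OF t]])
      show "\<forall>\<^sub>F s in at t within {0..T}. norm (X s - X t) \<le> sobolev_norm 2 (\<lambda>p. \<zeta> s p - \<zeta> t p)"
        unfolding eventually_at_filter by (rule always_eventually) (use le in blast)
    qed
    then show "(X \<longlongrightarrow> X t) (at t within {0..T})" by (simp add: LIM_zero_iff)
  qed
  have "compact (X ` {0..T})" by (intro compact_continuous_image cX compact_Icc)
  then obtain A where A: "\<And>t. t \<in> {0..T} \<Longrightarrow> norm (X t) \<le> A"
    by (metis bounded_iff compact_imp_bounded imageI)
  have "l2bd (z t) A" if "t \<in> {0..T}" for t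
    using l2bd_mono[OF l2bd_cf[of "X t"] _ A[OF that]] by (simp add: cfX[OF that])
  then show bd: "\<exists>A. \<forall>t\<in>{0..T}. l2bd (z t) A" by blast
  \<comment> \<open>On a ball containing the whole path the retraction is the identity, so the
    continuity of \<open>nl\<close> is inherited from that of \<open>tnl\<close>.\<close>
  define R where "R = \<bar>A\<bar> + 1"
  have R: "0 < R" by (simp add: R_def)
  have "tnl R k (X t) = nl (z t) k" if "t \<in> {0..T}" for t k
    using rad_id[of "X t" R] A[OF that] R by (simp add: tnl_def R_def cfX[OF that])
  then show cnl: "continuous_on {0..T} (\<lambda>s. nl (z s) k)" for k
    by (rule continuous_on_eq[OF tnl_continuous[OF R cX]])
  have cz: "continuous_on {0..T} (\<lambda>t. z t k)" for k
    by (rule continuous_on_eq[OF continuous_on_cf[OF cX, of k]]) (simp add: cfX)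
  define h where "h k t = - of_real (?sg k) * z t k - nl (z t) k" for k t
  have ch: "continuous_on {0..T} (h k)" for k
    unfolding h_def by (intro continuous_intros cz cnl)
  obtain g where g: "g \<in> bochner_L2 T L2_space L2_norm" "weak_time_derivative T \<zeta> g"
    "AE t in ?M. AE p in torus. g t p + \<zeta> t p * dx (\<zeta> t) p + (\<beta> - 1) * dx (dx (\<zeta> t)) p
       - dy (dy (\<zeta> t)) p - \<delta> * (Lam ^^ 3) (\<zeta> t) p + \<epsilon> * laplacian (laplacian (\<zeta> t)) p = 0"
    and init: "AE p in torus. \<zeta> 0 p = \<eta>\<^sub>0 p"
    using sol unfolding solves_ivp_def by blast
  have "AE t in ?M. \<zeta> t \<in> sobolev 4" using cls unfolding solution_class_def bochner_L2_def by blast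
  moreover have "AE t in ?M. g t \<in> L2_space" using g(1) unfolding bochner_L2_def by blast
  \<comment> \<open>At almost every time the solution lies in H^4, and the equation identifies all
    coefficients of \<open>g t\<close> at once; the exceptional set does not depend on
    \<open>k\<close>.\<close>
  ultimately have aeh: "AE t in ?M. g t \<in> L2_space \<and> (\<forall>k. fourier_coeff (g t) k = h k t)"
    using g(3)
  proof eventually_elim
    case (elim t)
    have zt: "has_fc (\<zeta> t) (z t)" and z4: "hs 4 (z t)"
      using elim(1) by (simp_all add: sobolev_iff z_def has_fc_coeff)
    note rhs = has_fc_rhs[OF zt z4, of \<beta> \<delta> \<epsilon>]
    have "AE p in torus. g t p = - (\<zeta> t p * dx (\<zeta> t) p) - linpart \<beta> \<delta> \<epsilon> (\<zeta> t) p"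
      using elim(3) by eventually_elim (simp add: linpart_def)
    from fourier_coeff_cong_AE[OF L2_measurable[OF elim(2)] L2_measurable[OF has_fcD(1)[OF rhs]] this]
    show ?case using elim(2) has_fcD(2)[OF rhs] unfolding h_def by simp
  qed
  have int: "r (z t k) = r (z 0 k) + integral {0..t} (\<lambda>s. r (h k s))"
    if r: "bounded_linear r" and t: "t \<in> {0..T}" for r :: "complex \<Rightarrow> real" and t k
  proof (rule weak_derivative_integral[OF T _ _ _ t])
    show "continuous_on {0..T} (\<lambda>t. r (z t k))" by (rule bounded_linear.continuous_on[OF r cz])
    show crh: "continuous_on {0..T} (\<lambda>t. r (h k t))" by (rule bounded_linear.continuous_on[OF r ch])
    fix \<phi> assume \<phi>: "test_function T \<phi>"
    let ?\<psi> = "\<lambda>p. r (ex (- k) p)"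
    have \<psi>: "?\<psi> \<in> L2_space"
      by (intro continuous_L2 bounded_linear.continuous_on[OF r] continuous_ex)
    have c\<phi>: "continuous_on {0..T} \<phi>" by (rule smooth_continuous[OF test_function_smooth[OF \<phi>]])
    have "(2 * pi)\<^sup>2 * (\<integral>t. deriv \<phi> t * r (z t k) \<partial>?M) = (\<integral>t. deriv \<phi> t * L2_inner (\<zeta> t) ?\<psi> \<partial>?M)"
      unfolding Bochner_Integration.integral_mult_right_zero[symmetric]
    proof (rule Bochner_Integration.integral_cong[OF refl])
      fix t assume "t \<in> space ?M"
      then have "t \<in> {0..T}" by simp
      then show "(2 * pi)\<^sup>2 * (deriv \<phi> t * r (z t k)) = deriv \<phi> t * L2_inner (\<zeta> t) ?\<psi>"
        unfolding z_def by (simp only: L2_inner_ex[OF L2 r] mult.left_commute)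
    qed
    also have "\<dots> = - (\<integral>t. \<phi> t * L2_inner (g t) ?\<psi> \<partial>?M)"
      using g(2) \<phi> \<psi> unfolding weak_time_derivative_def by blast
    also have "(\<integral>t. \<phi> t * L2_inner (g t) ?\<psi> \<partial>?M) = (\<integral>t. (2 * pi)\<^sup>2 * (\<phi> t * r (h k t)) \<partial>?M)"
    proof -
      have ae: "AE t in ?M. \<phi> t * L2_inner (g t) ?\<psi> = (2 * pi)\<^sup>2 * (\<phi> t * r (h k t))"
        using aeh
      proof eventually_elim
        case (elim t)
        then have "L2_inner (g t) ?\<psi> = (2 * pi)\<^sup>2 * r (h k t)"
          using L2_inner_ex[OF _ r, of "g t" k] by metis
        then show ?case by (simp only: mult.left_commute)
      qed
      have m: "(\<lambda>t. (2 * pi)\<^sup>2 * (\<phi> t * r (h k t))) \<in> borel_measurable ?M"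
        by (intro borel_measurable_integrable continuous_lebesgue_open(1) continuous_intros c\<phi> crh)
      have S: "{0<..<T} \<in> sets lebesgue" by simp
      show ?thesis by (rule integral_cong_AE[OF borel_measurable_lebesgue_on_AE[OF S m ae] m ae])
    qed
    also have "\<dots> = (2 * pi)\<^sup>2 * (\<integral>t. \<phi> t * r (h k t) \<partial>?M)"
      by (rule Bochner_Integration.integral_mult_right_zero)
    finally have "(2 * pi)\<^sup>2 * (\<integral>t. deriv \<phi> t * r (z t k) \<partial>?M) = (2 * pi)\<^sup>2 * - (\<integral>t. \<phi> t * r (h k t) \<partial>?M)"
      by (simp only: mult_minus_right)
    moreover have "(2 * pi)\<^sup>2 \<noteq> 0" by simp
    ultimately show "(\<integral>t. deriv \<phi> t * r (z t k) \<partial>?M) = - (\<integral>t. \<phi> t * r (h k t) \<partial>?M)"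
      by (simp only: mult_cancel_left simp_thms)
  qed
  have zint: "z t k = z 0 k + integral {0..t} (h k)" if t: "t \<in> {0..T}" for t k
  proof -
    have i: "h k integrable_on {0..t}"
      by (rule integrable_continuous_real[OF continuous_on_subset[OF ch]]) (use t in auto)
    have "integral {0..t} (\<lambda>s. Re (h k s)) = Re (integral {0..t} (h k))"
      using integral_linear[OF i bounded_linear_Re] by (simp add: o_def)
    moreover have "integral {0..t} (\<lambda>s. Im (h k s)) = Im (integral {0..t} (h k))"
      using integral_linear[OF i bounded_linear_Im] by (simp add: o_def)
    ultimately show ?thesis
      using int[OF bounded_linear_Re t, of k] int[OF bounded_linear_Im t, of k] by (simp add: complex_eq_iff)
  qed
  have zd: "((\<lambda>t. z t k) has_vector_derivative h k t) (at t within {0..T})" if t: "t \<in> {0..T}" for t k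
  proof -
    have "((\<lambda>t. z 0 k + integral {0..t} (h k)) has_vector_derivative 0 + h k t) (at t within {0..T})"
      by (intro has_vector_derivative_add has_vector_derivative_const integral_has_vector_derivative ch t)
    then show ?thesis
      by (intro has_vector_derivative_transform[OF t zint]) simp_all
  qed
  have z0: "z 0 k = fourier_coeff \<eta>\<^sub>0 k" for k
    unfolding z_def using L2[of 0] T \<eta>\<^sub>0 init
    by (intro fourier_coeff_cong_AE L2_measurable) (simp_all add: sobolev_iff)
  show "z t k = of_real (exp (- ?sg k * t)) * fourier_coeff \<eta>\<^sub>0 k - duh (?sg k) (\<lambda>s. nl (z s) k) t"
    if t: "t \<in> {0..T}" for t
  proof -
    let ?e = "\<lambda>s. complex_of_real (exp (?sg k * s))"
    \<comment> \<open>The integrating factor cancels the linear term of \<open>h\<close>, so only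
      the nonlinearity remains to be integrated.\<close>
    have "((\<lambda>s. - (?e s * nl (z s) k)) has_integral ?e t * z t k - ?e 0 * z 0 k) {0..t}"
    proof (rule fundamental_theorem_of_calculus)
      fix s assume s: "s \<in> {0..t}"
      then have s': "s \<in> {0..T}" using t by auto
      have e: "(?e has_vector_derivative of_real (?sg k * exp (?sg k * s))) (at s within {0..T})"
        by (rule has_vector_derivative_of_real) (auto intro!: derivative_eq_intros)
      have "((\<lambda>s. ?e s * z s k) has_vector_derivative ?e s * h k s + of_real (?sg k * exp (?sg k * s)) * z s k) (at s within {0..T})"
        by (rule has_vector_derivative_mult[OF e zd[OF s']])
      then have "((\<lambda>s. ?e s * z s k) has_vector_derivative - (?e s * nl (z s) k)) (at s within {0..T})"
        by (rule has_vector_derivative_eq_rhs) (simp add: h_def algebra_simps)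
      then show "((\<lambda>s. ?e s * z s k) has_vector_derivative - (?e s * nl (z s) k)) (at s within {0..t})"
        by (rule has_vector_derivative_within_subset) (use t in auto)
    qed (use t in simp)
    then have "integral {0..t} (\<lambda>s. - (?e s * nl (z s) k)) = ?e t * z t k - ?e 0 * z 0 k"
      by (rule integral_unique)
    then have I: "?e t * z t k = z 0 k - integral {0..t} (\<lambda>s. ?e s * nl (z s) k)"
      by (simp add: algebra_simps)
    have one: "complex_of_real (exp (- ?sg k * t)) * ?e t = 1"
      by (simp flip: of_real_mult exp_add)
    have "z t k = (complex_of_real (exp (- ?sg k * t)) * ?e t) * z t k" by (simp only: one mult_1)
    also have "\<dots> = of_real (exp (- ?sg k * t)) * (z 0 k - integral {0..t} (\<lambda>s. ?e s * nl (z s) k))"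
      by (simp only: mult.assoc I)
    finally show ?thesis by (simp only: duh_def z0 right_diff_distrib)
  qed
qed

theorem theorem1:
  fixes \<beta> \<gamma> L lam \<delta> \<epsilon> T :: real and \<eta>\<^sub>0 :: "real \<times> real \<Rightarrow> real"
  assumes "\<beta> > 0" and "0 \<le> \<gamma>" and "\<gamma> \<le> 2" and "L > 0"
    and "lam = 2 * pi / L" and "\<delta> = \<gamma> * lam" and "\<epsilon> = lam\<^sup>2"
    and "\<eta>\<^sub>0 \<in> sobolev 2" and "(\<integral>p. \<eta>\<^sub>0 p \<partial>torus) = 0"
    and "T > 0"
  shows "\<exists>\<eta> \<in> solution_class T. solves_ivp \<beta> \<delta> \<epsilon> T \<eta>\<^sub>0 \<eta> \<and>
           (\<forall>\<zeta> \<in> solution_class T. solves_ivp \<beta> \<delta> \<epsilon> T \<eta>\<^sub>0 \<zeta> \<longrightarrow>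
              (\<forall>t\<in>{0..T}. AE p in torus. \<zeta> t p = \<eta> t p))"
proof -
  have lam: "0 < lam" using assms(4,5) by simp
  then have "0 < \<epsilon>" "0 \<le> \<delta>" using assms(2,6,7) by simp_all
  then obtain c C0 C1 where sym: "symbol (symb \<beta> \<delta> \<epsilon>) c C0 C1 T" using symb_symbol assms(10) by blast
  obtain \<eta> f A B where \<eta>: "\<eta> \<in> solution_class T" "solves_ivp \<beta> \<delta> \<epsilon> T \<eta>\<^sub>0 \<eta>"
    and mild: "mild_sol (symb \<beta> \<delta> \<epsilon>) c C0 C1 T f (fourier_coeff \<eta>\<^sub>0) (\<lambda>_. 1) A B"
    and fc: "\<And>t. t \<in> {0..T} \<Longrightarrow> has_fc (\<eta> t) (f t)"
    using ivp_existence[OF sym assms(8)] by blast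
  have "AE p in torus. \<zeta> t p = \<eta> t p"
    if \<zeta>: "\<zeta> \<in> solution_class T" "solves_ivp \<beta> \<delta> \<epsilon> T \<eta>\<^sub>0 \<zeta>" and t: "t \<in> {0..T}" for \<zeta> t
  proof -
    note z = ivp_mild[OF sym assms(8) \<zeta>]
    obtain A' where A': "\<And>t. t \<in> {0..T} \<Longrightarrow> l2bd (fourier_coeff (\<zeta> t)) A'" using z(1) by blast
    interpret m: mild_sol "symb \<beta> \<delta> \<epsilon>" c C0 C1 T f "fourier_coeff \<eta>\<^sub>0" "\<lambda>_. 1" A B by (rule mild)
    \<comment> \<open>Uniqueness is settled between the families of coefficients, both being bounded
      mild solutions with the same datum; equality almost everywhere follows from the
      coefficients.\<close>
    have "fourier_coeff (\<zeta> t) k = f t k" for k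
    proof (rule m.mild_uniqueness[OF _ _ z(2) _ A' m.f_bd t])
      show "f t k = of_real (exp (- symb \<beta> \<delta> \<epsilon> k * t)) * fourier_coeff \<eta>\<^sub>0 k
          - duh (symb \<beta> \<delta> \<epsilon> k) (\<lambda>s. nl (f s) k) t" if "t \<in> {0..T}" for t k
        using m.f_eq[OF that, of k] by simp
      show "continuous_on {0..T} (\<lambda>s. nl (f s) k)" for k using m.cont_g[of k] by simp
    qed (use z(3) in blast)
    then have "fourier_coeff (\<zeta> t) = f t" by blast
    moreover have "\<zeta> t \<in> L2_space"
      using \<zeta>(1) t unfolding solution_class_def cont_space_def sobolev_def by blast
    ultimately have "has_fc (\<zeta> t) (f t)" using has_fc_coeff[of "\<zeta> t"] by simp
    then show ?thesis using fc[OF t] by (rule has_fc_unique)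
  qed
  with \<eta> show ?thesis by blast
qed

end
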